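(* For every $d\in\mathbb{N}$ there is a computable function $f$ such that \textsc{Dilation $2$-Augmentation} can be solved in time $f(k,d)\cdot n^{\mathcal{O}(1)}$ on instances $(G,\Gamma,k)$ in which $G$ is $\mathcal{K}_{d,d}$-free, where $n=|V(G)|$ and $\Gamma$ is an arbitrary graph.
   Context: Let $\Gamma$ be a finite undirected unweighted graph with vertex set $V$, and let $d_\Gamma(u,v)$ denote the shortest-path (hop) distance in $\Gamma$. A graph $G$ on the same vertex set $V$ is viewed as edge-weighted: each edge $(u,v)$ of $G$ has weight $d_\Gamma(u,v)$, and $d_G(u,v)$ denotes the weighted shortest-path distance in $G$. For a set $S$ of unordered pairs of distinct vertices that are non-edges of $G$, $G+S$ is the graph $(V,E(G)\cup S)$, again with each edge $(u,v)$ weighted by $d_\Gamma(u,v)$. $G+S$ has dilation at most $t$ if $d_{G+S}(u,v)\le t\cdot d_\Gamma(u,v)$ for all $u,v\in V$. \textsc{Dilation $t$-Augmentation}: given $(G,\Gamma,k)$ with $k$ an integer, decide whether there is a set $S$ of at most $k$ non-edges of $G$ such that $G+S$ has dilation at most $t$. A graph is $\mathcal{K}_{d,d}$-free if it contains no complete bipartite graph with $d$ vertices on each side as a subgraph. *)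

theory Defs
  imports Main "HOL-Library.Extended_Nat"
begin

section \<open>Graphs and distances\<close>

definition vertex_pairs :: "'a set \<Rightarrow> 'a set set" where
  "vertex_pairs V = {{u, v} | u v. u \<in> V \<and> v \<in> V \<and> u \<noteq> v}"

definition finite_graph :: "'a set \<Rightarrow> 'a set set \<Rightarrow> bool" where
  "finite_graph V E \<longleftrightarrow> finite V \<and> E \<subseteq> vertex_pairs V"

definition is_path :: "'a set \<Rightarrow> 'a set set \<Rightarrow> 'a \<Rightarrow> 'a list \<Rightarrow> 'a \<Rightarrow> bool" where
  "is_path V E u xs v \<longleftrightarrow>
     xs \<noteq> [] \<and> hd xs = u \<and> last xs = v \<and> distinct xs \<and> set xs \<subseteq> V \<and>
     successively (\<lambda>x y. {x, y} \<in> E) xs"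

definition path_weight :: "('a \<Rightarrow> 'a \<Rightarrow> enat) \<Rightarrow> 'a list \<Rightarrow> enat" where
  "path_weight w xs = (\<Sum>i<length xs - 1. w (xs ! i) (xs ! Suc i))"

text \<open>Vertices that are not connected have distance \<open>\<infinity>\<close> (the infimum of the empty set).\<close>

definition weighted_dist ::
  "'a set \<Rightarrow> 'a set set \<Rightarrow> ('a \<Rightarrow> 'a \<Rightarrow> enat) \<Rightarrow> 'a \<Rightarrow> 'a \<Rightarrow> enat" where
  "weighted_dist V E w u v = (INF xs \<in> {xs. is_path V E u xs v}. path_weight w xs)"

definition hop_dist :: "'a set \<Rightarrow> 'a set set \<Rightarrow> 'a \<Rightarrow> 'a \<Rightarrow> enat" where
  "hop_dist V E = weighted_dist V E (\<lambda>_ _. 1)"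

text \<open>
  Below, \<open>H\<close> is the edge set of \<open>\<Gamma>\<close>. As \<open>\<Gamma>\<close> may be disconnected, an edge of \<open>G\<close> may have
  weight \<open>\<infinity>\<close>; a pair of vertices not connected in \<open>\<Gamma>\<close> imposes no condition.
\<close>

definition dilation_at_most :: "nat \<Rightarrow> 'a set \<Rightarrow> 'a set set \<Rightarrow> 'a set set \<Rightarrow> bool" where
  "dilation_at_most t V E H \<longleftrightarrow>
     (\<forall>u\<in>V. \<forall>v\<in>V. weighted_dist V E (hop_dist V H) u v \<le> enat t * hop_dist V H u v)"

definition dilation_augmentation ::
  "nat \<Rightarrow> 'a set \<Rightarrow> 'a set set \<Rightarrow> 'a set set \<Rightarrow> int \<Rightarrow> bool" where
  "dilation_augmentation t V E H k \<longleftrightarrow>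
     (\<exists>S \<subseteq> vertex_pairs V - E. int (card S) \<le> k \<and> dilation_at_most t V (E \<union> S) H)"

definition biclique_free :: "nat \<Rightarrow> 'a set \<Rightarrow> 'a set set \<Rightarrow> bool" where
  "biclique_free d V E \<longleftrightarrow>
     \<not> (\<exists>A B. A \<subseteq> V \<and> B \<subseteq> V \<and> A \<inter> B = {} \<and> card A = d \<and> card B = d \<and>
          (\<forall>a\<in>A. \<forall>b\<in>B. {a, b} \<in> E))"


section \<open>Random access machines\<close>

text \<open>
  Running time is measured on a random access machine, presented as a structured programming
  language. A state consists of registers and of an indirectly addressable memory, all cells of
  which hold integers. Every operation costs one time unit. Addition and subtraction are the only
  arithmetic operations, so the numbers occurring within \<open>T\<close> steps have at most \<open>T\<close> bits more
  than the constants and inputs; hence unit cost is polynomially equivalent to logarithmic cost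
  and to Turing machine time.
\<close>

type_synonym state = "(nat \<Rightarrow> int) \<times> (int \<Rightarrow> int)"

datatype expr =
    Const int
  | Reg nat
  | Mem expr
  | Add expr expr
  | Sub expr expr

datatype com =
    Skip
  | Assign nat expr
  | Store expr expr
  | Seq com com
  | Cond expr com com
  | While expr com

fun eval_expr :: "expr \<Rightarrow> state \<Rightarrow> int" where
  "eval_expr (Const i) s = i"
| "eval_expr (Reg x) s = fst s x"
| "eval_expr (Mem e) s = snd s (eval_expr e s)"
| "eval_expr (Add e1 e2) s = eval_expr e1 s + eval_expr e2 s"
| "eval_expr (Sub e1 e2) s = eval_expr e1 s - eval_expr e2 s"

fun cost_expr :: "expr \<Rightarrow> nat" where
  "cost_expr (Const i) = 1"
| "cost_expr (Reg x) = 1"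
| "cost_expr (Mem e) = 1 + cost_expr e"
| "cost_expr (Add e1 e2) = 1 + cost_expr e1 + cost_expr e2"
| "cost_expr (Sub e1 e2) = 1 + cost_expr e1 + cost_expr e2"

text \<open>
  \<open>exec c s T s'\<close>: started in state \<open>s\<close>, the program \<open>c\<close> halts in state \<open>s'\<close> after exactly \<open>T\<close>
  time units. Conditions test for positivity.
\<close>

inductive exec :: "com \<Rightarrow> state \<Rightarrow> nat \<Rightarrow> state \<Rightarrow> bool" where
  exec_Skip: "exec Skip s 1 s"
| exec_Assign: "exec (Assign x e) (r, m) (1 + cost_expr e) (r(x := eval_expr e (r, m)), m)"
| exec_Store:
    "exec (Store a e) (r, m) (1 + cost_expr a + cost_expr e)
       (r, m(eval_expr a (r, m) := eval_expr e (r, m)))"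
| exec_Seq:
    "exec c1 s T1 s' \<Longrightarrow> exec c2 s' T2 s'' \<Longrightarrow> exec (Seq c1 c2) s (T1 + T2) s''"
| exec_Cond_True:
    "eval_expr b s > 0 \<Longrightarrow> exec c1 s T s' \<Longrightarrow> exec (Cond b c1 c2) s (1 + cost_expr b + T) s'"
| exec_Cond_False:
    "\<not> eval_expr b s > 0 \<Longrightarrow> exec c2 s T s' \<Longrightarrow> exec (Cond b c1 c2) s (1 + cost_expr b + T) s'"
| exec_While_False:
    "\<not> eval_expr b s > 0 \<Longrightarrow> exec (While b c) s (1 + cost_expr b) s"
| exec_While_True:
    "eval_expr b s > 0 \<Longrightarrow> exec c s T1 s' \<Longrightarrow> exec (While b c) s' T2 s'' \<Longrightarrow>
       exec (While b c) s (1 + cost_expr b + T1 + T2) s''"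

inductive_cases exec_SkipE: "exec Skip s T s'"
inductive_cases exec_AssignE: "exec (Assign x e) s T s'"
inductive_cases exec_StoreE: "exec (Store a e) s T s'"
inductive_cases exec_SeqE: "exec (Seq c1 c2) s T s'"
inductive_cases exec_CondE: "exec (Cond b c1 c2) s T s'"
inductive_cases exec_WhileE: "exec (While b c) s T s'"

lemma exec_deterministic:
  "exec c s T s' \<Longrightarrow> exec c s U s'' \<Longrightarrow> T = U \<and> s' = s''"
proof (induction arbitrary: U s'' rule: exec.induct)
  case (exec_Seq c1 s T1 s' c2 T2 s2)
  from exec_Seq.prems obtain U1 U2 r where
    U: "U = U1 + U2" and 1: "exec c1 s U1 r" and 2: "exec c2 r U2 s''"
    by (rule exec_SeqE)
  from exec_Seq.IH(1)[OF 1] 2 have "exec c2 s' U2 s''" by simp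
  from exec_Seq.IH(2)[OF this] exec_Seq.IH(1)[OF 1] U show ?case by simp
next
  case (exec_While_True b s c T1 s' T2 s2)
  from exec_While_True.prems obtain U1 U2 r where
    U: "U = 1 + cost_expr b + U1 + U2" and 1: "exec c s U1 r" and 2: "exec (While b c) r U2 s''"
    by (rule exec_WhileE) (use exec_While_True.hyps in simp_all)
  from exec_While_True.IH(1)[OF 1] 2 have "exec (While b c) s' U2 s''" by simp
  from exec_While_True.IH(2)[OF this] exec_While_True.IH(1)[OF 1] U show ?case by simp
next
  case (exec_While_False b s c)
  from exec_While_False.prems show ?case
    by (rule exec_WhileE) (use exec_While_False.hyps in simp_all)
next
  case (exec_Cond_True b s c1 T s' c2)
  from exec_Cond_True.prems obtain U1 where
    "U = 1 + cost_expr b + U1" "exec c1 s U1 s''"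
    by (rule exec_CondE) (use exec_Cond_True.hyps in simp_all)
  with exec_Cond_True.IH show ?case by simp
next
  case (exec_Cond_False b s c2 T s' c1)
  from exec_Cond_False.prems obtain U1 where
    "U = 1 + cost_expr b + U1" "exec c2 s U1 s''"
    by (rule exec_CondE) (use exec_Cond_False.hyps in simp_all)
  with exec_Cond_False.IH show ?case by simp
qed (auto elim: exec_SkipE exec_AssignE exec_StoreE)

definition computable :: "(int \<Rightarrow> nat \<Rightarrow> nat) \<Rightarrow> bool" where
  "computable f \<longleftrightarrow>
     (\<exists>P. \<forall>k d. \<exists>T s. exec P ((\<lambda>_. 0)(0 := k, 1 := int d), \<lambda>_. 0) T s \<and> fst s 0 = int (f k d))"


section \<open>Deciding problems on pairs of graphs\<close>

text \<open>
  An input \<open>(G, \<Gamma>, k)\<close> has vertex set \<open>{0, \<dots>, n - 1}\<close>. Initially registers 0 and 1 hold \<open>n\<close> and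
  \<open>k\<close>, and the memory holds the adjacency matrix of \<open>G\<close>, row by row, at the addresses
  \<open>0, \<dots>, n\<^sup>2 - 1\<close>, followed by that of \<open>\<Gamma>\<close> at \<open>n\<^sup>2, \<dots>, 2n\<^sup>2 - 1\<close>. Everything else is 0.
\<close>

definition input_memory :: "nat \<Rightarrow> nat set set \<Rightarrow> nat set set \<Rightarrow> int \<Rightarrow> int" where
  "input_memory n E H a =
     (if \<exists>i<n. \<exists>j<n. {i, j} \<in> E \<and> a = int (i * n + j) then 1
      else if \<exists>i<n. \<exists>j<n. {i, j} \<in> H \<and> a = int (n * n + i * n + j) then 1
      else 0)"

definition input_state :: "nat \<Rightarrow> nat set set \<Rightarrow> nat set set \<Rightarrow> int \<Rightarrow> state" where
  "input_state n E H k = ((\<lambda>_. 0)(0 := int n, 1 := k), input_memory n E H)"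

text \<open>
  \<open>P\<close> decides \<open>Q\<close> on the instances satisfying \<open>I\<close>, within time \<open>b\<close>. The answer is left in
  register 0. Nothing is required of \<open>P\<close> on other instances.
\<close>

definition decides_within ::
  "com \<Rightarrow> (nat \<Rightarrow> nat set set \<Rightarrow> nat set set \<Rightarrow> int \<Rightarrow> bool) \<Rightarrow>
   (nat \<Rightarrow> nat set set \<Rightarrow> nat set set \<Rightarrow> int \<Rightarrow> bool) \<Rightarrow> (nat \<Rightarrow> int \<Rightarrow> nat) \<Rightarrow> bool" where
  "decides_within P Q I b \<longleftrightarrow>
     (\<forall>n E H k. finite_graph {..<n} E \<and> finite_graph {..<n} H \<and> I n E H k \<longrightarrow>
        (\<exists>T s. exec P (input_state n E H k) T s \<and> T \<le> b n k \<and>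
               fst s 0 = (if Q n E H k then 1 else 0)))"

end

(*
A path of weight at most 2 is a single edge or consists of two edges of weight 1. Hence G + S has
dilation at most 2 iff every edge uv of \<Gamma> is blue, meaning that it belongs to G + S as well, or is
spanned by two blue edges uw, wv; otherwise u and v are in conflict. Edges of S outside of \<Gamma> are
useless.

A solution extending a partial one has at most 2k endpoints, and they cover all conflicts. So a vertex
u with at least g(k, d) conflicts is an endpoint, and some new edge uw has w blue adjacent to about a
1/k fraction of the conflict partners of u. Because G is K_{d,d}-free, double counting leaves only
2kd such w. If there is no such u, the set T of vertices in conflict has bounded size. Vertices
outside of T with the same adjacencies to T, in blue and in \<Gamma>, can be swapped in a solution, so
it suffices to branch over pairs from T and pairs of a vertex in T and a representative of each type.
Either way at most F(k, d) candidates need to be tried in each of k rounds, and candidates are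
recognised in polynomial time. The branches are enumerated by numbers z < Z, read in base F.
*)
theory Submission
  imports Defs "HOL-Combinatorics.Transposition"
begin

section \<open>Compiling bounded loops\<close>

text \<open>Only \<open>G\<close> is biclique-free, not \<open>G + S\<close>. But chosen edges end
  in at most \<open>2 * k\<close> conflict partners of \<open>u\<close>; each other partner
  \<open>v\<close> is served through a new edge \<open>uw\<close> whose continuation
  \<open>wv\<close> lies in \<open>G\<close> itself. So candidates are tested against
  \<open>E\<close>, with a slack of \<open>2 * k\<close>.

  Candidates are few only for partial sets that extend to a solution. A branch that has left all
  solutions may see more of them, and its digits just do not reach these. The solution aimed at may
  change between rounds, since swaps move it; what falls is the number of its edges still missing.

  One exponent must serve all \<open>d\<close>. So the recursion is flattened into a loop over
  \<open>z\<close>, giving a program of fixed loop depth in which \<open>d\<close> is a mere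
  constant. Its time is a fixed polynomial in \<open>n + Z\<close>, and
  \<open>n + Z \<le> 2 ^ Z * max 1 n\<close> splits off \<open>n\<close>. As the machine only adds
  and subtracts, \<open>g\<close>, \<open>F\<close> and \<open>Z\<close> are generous powers that
  repeated addition can produce; the same code computes \<open>f\<close>.\<close>

definition runs :: "com \<Rightarrow> state \<Rightarrow> nat \<Rightarrow> (state \<Rightarrow> bool) \<Rightarrow> bool" where
  "runs c s t Q \<longleftrightarrow> (\<exists>T s'. exec c s T s' \<and> T \<le> t \<and> Q s')"

lemma runs_mono:
  "runs c s t Q \<Longrightarrow> t \<le> t' \<Longrightarrow> (\<And>s'. Q s' \<Longrightarrow> Q' s') \<Longrightarrow> runs c s t' Q'"
  unfolding runs_def by (meson le_trans)

lemma runs_Assign: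
  "Q (r(x := eval_expr e (r, m)), m) \<Longrightarrow> 1 + cost_expr e \<le> t \<Longrightarrow> runs (Assign x e) (r, m) t Q"
  unfolding runs_def by (meson exec_Assign)

lemma runs_Store:
  "Q (r, m(eval_expr a (r, m) := eval_expr e (r, m))) \<Longrightarrow> 1 + cost_expr a + cost_expr e \<le> t \<Longrightarrow>
   runs (Store a e) (r, m) t Q"
  unfolding runs_def by (meson exec_Store)

lemma runs_Seq:
  assumes "runs c1 s t1 P" "\<And>s'. P s' \<Longrightarrow> runs c2 s' t2 Q" "t1 + t2 \<le> t"
  shows "runs (Seq c1 c2) s t Q"
proof -
  obtain T1 s1 where 1: "exec c1 s T1 s1" "T1 \<le> t1" "P s1"
    using assms(1) unfolding runs_def by blast
  obtain T2 s2 where 2: "exec c2 s1 T2 s2" "T2 \<le> t2" "Q s2"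
    using assms(2)[OF 1(3)] unfolding runs_def by blast
  have "exec (Seq c1 c2) s (T1 + T2) s2"
    using 1 2 by (auto intro: exec_Seq)
  moreover have "T1 + T2 \<le> t" using 1(2) 2(2) assms(3) by linarith
  ultimately show ?thesis using 2(3) unfolding runs_def by blast
qed

lemma runs_Cond:
  assumes "eval_expr b s > 0 \<Longrightarrow> runs c1 s t1 Q" "\<not> eval_expr b s > 0 \<Longrightarrow> runs c2 s t1 Q"
    and "1 + cost_expr b + t1 \<le> t"
  shows "runs (Cond b c1 c2) s t Q"
proof (cases "eval_expr b s > 0")
  case True
  then obtain T1 s1 where 1: "exec c1 s T1 s1" "T1 \<le> t1" "Q s1"
    using assms(1) unfolding runs_def by blast
  have "exec (Cond b c1 c2) s (1 + cost_expr b + T1) s1"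
    using 1 True by (metis exec_Cond_True)
  moreover have "1 + cost_expr b + T1 \<le> t" using 1(2) assms(3) by linarith
  ultimately show ?thesis using 1(3) unfolding runs_def by blast
next
  case False
  then obtain T1 s1 where 1: "exec c2 s T1 s1" "T1 \<le> t1" "Q s1"
    using assms(2) unfolding runs_def by blast
  have "exec (Cond b c1 c2) s (1 + cost_expr b + T1) s1"
    using 1 False by (metis exec_Cond_False)
  moreover have "1 + cost_expr b + T1 \<le> t" using 1(2) assms(3) by linarith
  ultimately show ?thesis using 1(3) unfolding runs_def by blast
qed

text \<open>\<open>P\<close> is indexed by the iteration count and the induction runs downwards from
  \<open>n\<close>, so \<open>n - i\<close> counts the iterations left. The separate test in the
  bound is the final one, which fails.\<close>

lemma runs_While:
  assumes "P i s" "i \<le> n"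
    and step: "\<And>i s. i < n \<Longrightarrow> P i s \<Longrightarrow> eval_expr b s > 0 \<and> runs c s K (P (Suc i))"
    and stop: "\<And>s. P n s \<Longrightarrow> \<not> eval_expr b s > 0"
  shows "runs (While b c) s (1 + cost_expr b + (n - i) * (1 + cost_expr b + K)) (P n)"
  using assms(2,1)
proof (induction arbitrary: s rule: inc_induct)
  case base
  then show ?case using stop[OF base] unfolding runs_def
    by (metis exec_While_False le_add1)
next
  case (step j)
  obtain T1 s1 where 1: "exec c s T1 s1" "T1 \<le> K" "P (Suc j) s1" and b: "eval_expr b s > 0"
    using assms(3)[OF step(2) step.prems] unfolding runs_def by blast
  obtain T2 s2 where 2: "exec (While b c) s1 T2 s2"
     "T2 \<le> 1 + cost_expr b + (n - Suc j) * (1 + cost_expr b + K)" "P n s2"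
    using step.IH[OF 1(3)] unfolding runs_def by blast
  have "exec (While b c) s (1 + cost_expr b + T1 + T2) s2"
    using exec_While_True[OF b 1(1) 2(1)] .
  moreover have "n - j = Suc (n - Suc j)" using step(2) by simp
  then have "1 + cost_expr b + T1 + T2 \<le> 1 + cost_expr b + (n - j) * (1 + cost_expr b + K)"
    using 1(2) 2(2) by simp
  ultimately show ?case using 2(3) unfolding runs_def by blast
qed

section \<open>Expressions with bounded sums\<close>

text \<open>
  The programs are written in a small language in which every loop is bounded, so that its
  semantics is a total function, and are then compiled. \<open>XSum x y e\<close> sums \<open>e\<close> over the values
  \<open>0, \<dots>\<close> of register \<open>x\<close> below register \<open>y\<close>; restricting bounds to registers keeps all loop
  lengths below any bound on the registers.
\<close>

datatype xexp =
    XC int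
  | XR nat
  | XM xexp
  | XAdd xexp xexp
  | XSub xexp xexp
  | XIf xexp xexp xexp
  | XSum nat nat xexp

primrec xev :: "xexp \<Rightarrow> (nat \<Rightarrow> int) \<Rightarrow> (int \<Rightarrow> int) \<Rightarrow> int" where
  "xev (XC i) r m = i"
| "xev (XR x) r m = r x"
| "xev (XM e) r m = m (xev e r m)"
| "xev (XAdd a b) r m = xev a r m + xev b r m"
| "xev (XSub a b) r m = xev a r m - xev b r m"
| "xev (XIf c a b) r m = (if xev c r m > 0 then xev a r m else xev b r m)"
| "xev (XSum x y e) r m = (\<Sum>i<nat (r y). xev e (r(x := int i)) m)"

primrec xbelow :: "nat \<Rightarrow> xexp \<Rightarrow> bool" where
  "xbelow t (XC i) = True"
| "xbelow t (XR x) = (x < t)"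
| "xbelow t (XM e) = xbelow t e"
| "xbelow t (XAdd a b) = (xbelow t a \<and> xbelow t b)"
| "xbelow t (XSub a b) = (xbelow t a \<and> xbelow t b)"
| "xbelow t (XIf c a b) = (xbelow t c \<and> xbelow t a \<and> xbelow t b)"
| "xbelow t (XSum x y e) = (x < t \<and> y < t \<and> xbelow t e)"

text \<open>Temporaries of compiled code lie at or above \<open>b\<close>, so overwriting them does
  not change the value of an expression evaluated later.\<close>

lemma xev_cong: "xbelow b e \<Longrightarrow> (\<And>y. y < b \<Longrightarrow> r y = r' y) \<Longrightarrow> xev e r m = xev e r' m"
proof (induction e arbitrary: r r')
  case (XSum x y e)
  have "xev e (r(x := int i)) m = xev e (r'(x := int i)) m" for i
    by (rule XSum.IH) (use XSum.prems in auto)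
  with XSum.prems show ?case by simp
next
  case (XM e)
  have "xev e r m = xev e r' m" by (rule XM.IH) (use XM.prems in auto)
  then show ?case by simp
next
  case (XAdd e1 e2)
  have "xev e1 r m = xev e1 r' m" by (rule XAdd.IH) (use XAdd.prems in auto)
  moreover have "xev e2 r m = xev e2 r' m" by (rule XAdd.IH) (use XAdd.prems in auto)
  ultimately show ?case by simp
next
  case (XSub e1 e2)
  have "xev e1 r m = xev e1 r' m" by (rule XSub.IH) (use XSub.prems in auto)
  moreover have "xev e2 r m = xev e2 r' m" by (rule XSub.IH) (use XSub.prems in auto)
  ultimately show ?case by simp
next
  case (XIf e1 e2 e3)
  have "xev e1 r m = xev e1 r' m" by (rule XIf.IH) (use XIf.prems in auto)
  moreover have "xev e2 r m = xev e2 r' m" by (rule XIf.IH) (use XIf.prems in auto)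
  moreover have "xev e3 r m = xev e3 r' m" by (rule XIf.IH) (use XIf.prems in auto)
  ultimately show ?case by simp
qed auto

text \<open>The value is left in register \<open>t\<close>; the registers from \<open>t\<close> on
  are scratch. A sum parks the old value of \<open>x\<close> in \<open>t + 1\<close>, because the
  source binds \<open>x\<close> only locally, and copies its bound to \<open>t + 2\<close> before
  \<open>x\<close> is cleared, so \<open>x\<close> and \<open>y\<close> may coincide.\<close>

primrec xcomp :: "xexp \<Rightarrow> nat \<Rightarrow> com" where
  "xcomp (XC i) t = Assign t (Const i)"
| "xcomp (XR x) t = Assign t (Reg x)"
| "xcomp (XM e) t = Seq (xcomp e t) (Assign t (Mem (Reg t)))"
| "xcomp (XAdd a b) t =
     Seq (xcomp a t) (Seq (xcomp b (Suc t)) (Assign t (Add (Reg t) (Reg (Suc t)))))"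
| "xcomp (XSub a b) t =
     Seq (xcomp a t) (Seq (xcomp b (Suc t)) (Assign t (Sub (Reg t) (Reg (Suc t)))))"
| "xcomp (XIf c a b) t = Seq (xcomp c t) (Cond (Reg t) (xcomp a t) (xcomp b t))"
| "xcomp (XSum x y e) t =
     Seq (Assign t (Const 0)) (Seq (Assign (t + 1) (Reg x)) (Seq (Assign (t + 2) (Reg y))
       (Seq (Assign x (Const 0))
         (Seq (While (Sub (Reg (t + 2)) (Reg x))
                (Seq (xcomp e (t + 3))
                  (Seq (Assign t (Add (Reg t) (Reg (t + 3)))) (Assign x (Add (Reg x) (Const 1))))))
              (Assign x (Reg (t + 1)))))))"

primrec xcost :: "xexp \<Rightarrow> nat \<Rightarrow> nat" where
  "xcost (XC i) N = 2"
| "xcost (XR x) N = 2"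
| "xcost (XM e) N = xcost e N + 3"
| "xcost (XAdd a b) N = xcost a N + xcost b N + 4"
| "xcost (XSub a b) N = xcost a N + xcost b N + 4"
| "xcost (XIf c a b) N = xcost c N + xcost a N + xcost b N + 2"
| "xcost (XSum x y e) N = 14 + N * (xcost e N + 12)"

lemma runs_Seq_value:
  assumes "runs c1 (r, m) t1 (\<lambda>s. snd s = m \<and> fst s t = v \<and> (\<forall>y<t. fst s y = r y))"
    and "\<And>r'. r' t = v \<Longrightarrow> (\<And>y. y < t \<Longrightarrow> r' y = r y) \<Longrightarrow> runs c2 (r', m) t2 Q"
    and "t1 + t2 \<le> T"
  shows "runs (Seq c1 c2) (r, m) T Q"
  using assms(1) _ assms(3)
proof (rule runs_Seq)
  fix s' :: state assume s': "snd s' = m \<and> fst s' t = v \<and> (\<forall>y<t. fst s' y = r y)"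
  then have "s' = (fst s', m)" by (cases s') auto
  with s' assms(2)[of "fst s'"] show "runs c2 s' t2 Q" by auto
qed

lemma runs_xcomp:
  "xbelow b e \<Longrightarrow> b \<le> t \<Longrightarrow> (\<And>z. z < b \<Longrightarrow> r z \<le> int N) \<Longrightarrow>
   runs (xcomp e t) (r, m) (xcost e N)
     (\<lambda>s. snd s = m \<and> fst s t = xev e r m \<and> (\<forall>y<t. fst s y = r y))"
proof (induction e arbitrary: t r)
  case (XC i)
  show ?case by (auto intro: runs_Assign)
next
  case (XR x)
  show ?case by (auto intro: runs_Assign)
next
  case (XM e)
  show ?case unfolding xcomp.simps
    by (rule runs_Seq_value[OF XM.IH, where ?t2.0 = 3])
      (use XM.prems in \<open>auto intro!: runs_Assign\<close>)
next
  case (XAdd e1 e2)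
  show ?case unfolding xcomp.simps
  proof (rule runs_Seq_value[OF XAdd.IH(1)])
    fix r' assume r': "r' t = xev e1 r m" "\<And>y. y < t \<Longrightarrow> r' y = r y"
    have eq: "xev e2 r' m = xev e2 r m"
      by (rule xev_cong[of b]) (use XAdd.prems r' in auto)
    show "runs (Seq (xcomp e2 (Suc t)) (Assign t (Add (Reg t) (Reg (Suc t))))) (r', m) (xcost e2 N + 4)
       (\<lambda>s. snd s = m \<and> fst s t = xev (XAdd e1 e2) r m \<and> (\<forall>y<t. fst s y = r y))"
      by (rule runs_Seq_value[OF XAdd.IH(2), where ?t2.0 = 4])
        (use XAdd.prems r' eq in \<open>auto intro!: runs_Assign\<close>)
  qed (use XAdd.prems in auto)
next
  case (XSub e1 e2)
  show ?case unfolding xcomp.simps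
  proof (rule runs_Seq_value[OF XSub.IH(1)])
    fix r' assume r': "r' t = xev e1 r m" "\<And>y. y < t \<Longrightarrow> r' y = r y"
    have eq: "xev e2 r' m = xev e2 r m"
      by (rule xev_cong[of b]) (use XSub.prems r' in auto)
    show "runs (Seq (xcomp e2 (Suc t)) (Assign t (Sub (Reg t) (Reg (Suc t))))) (r', m) (xcost e2 N + 4)
       (\<lambda>s. snd s = m \<and> fst s t = xev (XSub e1 e2) r m \<and> (\<forall>y<t. fst s y = r y))"
      by (rule runs_Seq_value[OF XSub.IH(2), where ?t2.0 = 4])
        (use XSub.prems r' eq in \<open>auto intro!: runs_Assign\<close>)
  qed (use XSub.prems in auto)
next
  case (XIf e1 e2 e3)
  show ?case unfolding xcomp.simps
  proof (rule runs_Seq_value[OF XIf.IH(1)])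
    fix r' assume r': "r' t = xev e1 r m" "\<And>y. y < t \<Longrightarrow> r' y = r y"
    have eq: "xev e2 r' m = xev e2 r m" "xev e3 r' m = xev e3 r m"
      by (rule xev_cong[of b]; use XIf.prems r' in auto)+
    show "runs (Cond (Reg t) (xcomp e2 t) (xcomp e3 t)) (r', m) (xcost e2 N + xcost e3 N + 2)
       (\<lambda>s. snd s = m \<and> fst s t = xev (XIf e1 e2 e3) r m \<and> (\<forall>y<t. fst s y = r y))"
    proof (rule runs_Cond)
      assume "0 < eval_expr (Reg t) (r', m)"
      then show "runs (xcomp e2 t) (r', m) (xcost e2 N + xcost e3 N)
         (\<lambda>s. snd s = m \<and> fst s t = xev (XIf e1 e2 e3) r m \<and> (\<forall>y<t. fst s y = r y))"
        by (intro runs_mono[OF XIf.IH(2)]) (use XIf.prems r' eq in auto)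
    next
      assume "\<not> 0 < eval_expr (Reg t) (r', m)"
      then show "runs (xcomp e3 t) (r', m) (xcost e2 N + xcost e3 N)
         (\<lambda>s. snd s = m \<and> fst s t = xev (XIf e1 e2 e3) r m \<and> (\<forall>y<t. fst s y = r y))"
        by (intro runs_mono[OF XIf.IH(3)]) (use XIf.prems r' eq in auto)
    qed simp
  qed (use XIf.prems in auto)
next
  case (XSum x y e)
  define n where "n = nat (r y)"
  have xt: "x < b" "y < b" "xbelow b e" "b \<le> t" using XSum.prems by auto
  have nN: "n \<le> N" using XSum.prems(3)[of y] xt unfolding n_def by auto
  define P where "P i s \<longleftrightarrow> snd s = m \<and> fst s t = (\<Sum>i<i. xev e (r(x := int i)) m) \<and>
     fst s (t + 1) = r x \<and> fst s (t + 2) = r y \<and> fst s x = int i \<and> (\<forall>z<t. z \<noteq> x \<longrightarrow> fst s z = r z)"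
    for i :: nat and s :: state
  let ?body = "Seq (xcomp e (t + 3))
    (Seq (Assign t (Add (Reg t) (Reg (t + 3)))) (Assign x (Add (Reg x) (Const 1))))"
  let ?b = "Sub (Reg (t + 2)) (Reg x)"
  have step: "eval_expr ?b s > 0 \<and> runs ?body s (xcost e N + 8) (P (Suc i))"
    if "i < n" "P i s" for i s
  proof
    obtain r' where s: "s = (r', m)" using \<open>P i s\<close> unfolding P_def by (cases s) auto
    show "eval_expr ?b s > 0" using that unfolding P_def n_def s by auto
    have eq: "xev e r' m = xev e (r(x := int i)) m"
      by (rule xev_cong[of b]) (use xt \<open>P i s\<close> in \<open>auto simp: P_def s\<close>)
    show "runs ?body s (xcost e N + 8) (P (Suc i))" unfolding s
    proof (rule runs_Seq[OF XSum.IH, where ?t2.0 = 8])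
      \<comment> \<open>The body may use \<open>x\<close> as the bound of an inner sum; its current
        value \<open>i\<close> is below \<open>n\<close>, hence below \<open>N\<close>.\<close>
      show "r' z \<le> int N" if "z < b" for z
        using \<open>P i s\<close> XSum.prems(3)[OF that] \<open>i < n\<close> nN xt that unfolding P_def s
        by (cases "z = x") auto
    next
      fix s' assume s': "snd s' = m \<and> fst s' (t + 3) = xev e r' m \<and> (\<forall>y<t + 3. fst s' y = r' y)"
      obtain r'' where s'': "s' = (r'', m)" using s' by (cases s') auto
      show "runs (Seq (Assign t (Add (Reg t) (Reg (t + 3)))) (Assign x (Add (Reg x) (Const 1)))) s' 8 (P (Suc i))"
        unfolding s''
        apply (rule runs_Seq[where ?t1.0 = 4 and ?t2.0 = 4 and P = "\<lambda>s. s = (r''(t := r'' t + r'' (t + 3)), m)"])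
        using s' \<open>P i s\<close> xt
        apply (auto intro!: runs_Assign simp: s s'' P_def eq)
        done
    qed (use xt in auto)
  qed
  have stop: "\<not> eval_expr ?b s > 0" if "P n s" for s
    using that unfolding P_def n_def by auto
  have W: "runs (While ?b ?body) s (1 + cost_expr ?b + (n - 0) * (1 + cost_expr ?b + (xcost e N + 8))) (P n)"
    if "P 0 s" for s
    by (rule runs_While[where P = P]) (use step stop that in auto)
  have ncost: "(n - 0) * (1 + cost_expr ?b + (xcost e N + 8)) \<le> N * (xcost e N + 12)"
    using nN by (simp add: mult_le_mono)
  show ?case unfolding xcomp.simps
    apply (rule runs_Seq[where ?t1.0 = 2 and ?t2.0 = "12 + N * (xcost e N + 12)" and P = "\<lambda>s. s = (r(t := 0), m)"])
      apply (simp add: runs_Assign)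
     apply (rule runs_Seq[where ?t1.0 = 2 and ?t2.0 = "10 + N * (xcost e N + 12)" and P = "\<lambda>s. s = (r(t := 0, t + 1 := r x), m)"])
    subgoal using xt by (auto intro: runs_Assign)
     apply (rule runs_Seq[where ?t1.0 = 2 and ?t2.0 = "8 + N * (xcost e N + 12)" and P = "\<lambda>s. s = (r(t := 0, t + 1 := r x, t + 2 := r y), m)"])
    subgoal using xt by (auto intro: runs_Assign)
      apply (rule runs_Seq[where ?t1.0 = 2 and ?t2.0 = "6 + N * (xcost e N + 12)" and P = "P 0"])
    subgoal using xt by (auto intro!: runs_Assign simp: P_def)
       apply (rule runs_Seq[OF W, where ?t2.0 = 2])
         apply assumption
    subgoal for _ _ _ _ s'
      apply (cases s')
      using xt apply (auto intro!: runs_Assign simp: P_def n_def)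
      done
    subgoal using ncost by simp
    by simp_all
qed

section \<open>Commands with bounded loops and their compilation\<close>

datatype hcom = HSet nat xexp | HStore xexp xexp | HSeq hcom hcom | HFor nat nat hcom

primrec hsem :: "hcom \<Rightarrow> state \<Rightarrow> state" where
  "hsem (HSet x e) = (\<lambda>(r, m). (r(x := xev e r m), m))"
| "hsem (HStore a e) = (\<lambda>(r, m). (r, m(xev a r m := xev e r m)))"
| "hsem (HSeq c1 c2) = (\<lambda>s. hsem c2 (hsem c1 s))"
| "hsem (HFor x y c) =
     (\<lambda>s. fold (\<lambda>i s. hsem c ((fst s)(x := int i), snd s)) [0..<nat (fst s y)] s)"

text \<open>Every value assigned to a register, hence every loop bound, is at most \<open>N\<close>.\<close>

primrec hok :: "nat \<Rightarrow> hcom \<Rightarrow> state \<Rightarrow> bool" where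
  "hok N (HSet x e) = (\<lambda>(r, m). xev e r m \<le> int N)"
| "hok N (HStore a e) = (\<lambda>_. True)"
| "hok N (HSeq c1 c2) = (\<lambda>s. hok N c1 s \<and> hok N c2 (hsem c1 s))"
| "hok N (HFor x y c) =
     (\<lambda>s. \<forall>j<nat (fst s y).
        let s' = fold (\<lambda>i s. hsem c ((fst s)(x := int i), snd s)) [0..<j] s
        in hok N c ((fst s')(x := int j), snd s'))"

primrec hbelow :: "nat \<Rightarrow> hcom \<Rightarrow> bool" where
  "hbelow t (HSet x e) = (x < t \<and> xbelow t e)"
| "hbelow t (HStore a e) = (xbelow t a \<and> xbelow t e)"
| "hbelow t (HSeq c1 c2) = (hbelow t c1 \<and> hbelow t c2)"
| "hbelow t (HFor x y c) = (x < t \<and> y < t \<and> hbelow t c)"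

primrec hcomp :: "hcom \<Rightarrow> nat \<Rightarrow> com" where
  "hcomp (HSet x e) t = Seq (xcomp e t) (Assign x (Reg t))"
| "hcomp (HStore a e) t =
     Seq (xcomp a t) (Seq (xcomp e (Suc t)) (Store (Reg t) (Reg (Suc t))))"
| "hcomp (HSeq c1 c2) t = Seq (hcomp c1 t) (hcomp c2 t)"
| "hcomp (HFor x y c) t =
     Seq (Assign t (Reg y)) (Seq (Assign (t + 1) (Const 0))
       (While (Sub (Reg t) (Reg (t + 1)))
          (Seq (Assign x (Reg (t + 1)))
            (Seq (hcomp c (t + 2)) (Assign (t + 1) (Add (Reg (t + 1)) (Const 1)))))))"

primrec hcost :: "hcom \<Rightarrow> nat \<Rightarrow> nat" where
  "hcost (HSet x e) N = xcost e N + 2"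
| "hcost (HStore a e) N = xcost a N + xcost e N + 3"
| "hcost (HSeq c1 c2) N = hcost c1 N + hcost c2 N"
| "hcost (HFor x y c) N = 8 + N * (hcost c N + 10)"

text \<open>Machine and source states differ in the temporaries, so only registers below
  \<open>b\<close> are compared.\<close>

definition agree :: "nat \<Rightarrow> state \<Rightarrow> state \<Rightarrow> bool" where
  "agree b s s' \<longleftrightarrow> snd s = snd s' \<and> (\<forall>y<b. fst s y = fst s' y)"

lemma xev_agree: "xbelow b e \<Longrightarrow> agree b (r, m) (r', m) \<Longrightarrow> xev e r m = xev e r' m"
  by (rule xev_cong) (auto simp: agree_def)

text \<open>The compiled program keeps its temporaries in the registers from \<open>t\<close> on.\<close>

lemma runs_hcomp:
  "hbelow b c \<Longrightarrow> b \<le> t \<Longrightarrow> agree b s s0 \<Longrightarrow> (\<And>z. z < b \<Longrightarrow> fst s z \<le> int N) \<Longrightarrow> hok N c s0 \<Longrightarrow>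
   runs (hcomp c t) s (hcost c N)
     (\<lambda>s'. agree b s' (hsem c s0) \<and> (\<forall>z<b. fst s' z \<le> int N) \<and> (\<forall>y. b \<le> y \<and> y < t \<longrightarrow> fst s' y = fst s y))"
proof (induction c arbitrary: t s s0)
  case (HSet x e)
  obtain r m r0 where [simp]: "s = (r, m)" "s0 = (r0, m)"
    using HSet.prems(3) by (cases s; cases s0) (auto simp: agree_def)
  have eq: "xev e r m = xev e r0 m"
    by (rule xev_agree) (use HSet.prems in auto)
  show ?case unfolding hcomp.simps \<open>s = _\<close>
    by (rule runs_Seq_value[OF runs_xcomp, where ?t2.0 = 2])
      (use HSet.prems eq in \<open>auto intro!: runs_Assign simp: agree_def\<close>)
next
  case (HStore a e)
  obtain r m r0 where [simp]: "s = (r, m)" "s0 = (r0, m)"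
    using HStore.prems(3) by (cases s; cases s0) (auto simp: agree_def)
  have eqa: "xev a r m = xev a r0 m"
    by (rule xev_agree) (use HStore.prems in auto)
  have eqe: "xev e r m = xev e r0 m"
    by (rule xev_agree) (use HStore.prems in auto)
  show ?case unfolding hcomp.simps \<open>s = _\<close>
  proof (rule runs_Seq_value[OF runs_xcomp])
    fix r' assume r': "r' t = xev a r m" "\<And>y. y < t \<Longrightarrow> r' y = r y"
    have eq: "xev e r' m = xev e r m"
      by (rule xev_agree) (use HStore.prems r' in \<open>auto simp: agree_def\<close>)
    show "runs (Seq (xcomp e (Suc t)) (Store (Reg t) (Reg (Suc t)))) (r', m) (xcost e N + 3)
      (\<lambda>s'. agree b s' (hsem (HStore a e) s0) \<and> (\<forall>z<b. fst s' z \<le> int N) \<and>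
          (\<forall>y. b \<le> y \<and> y < t \<longrightarrow> fst s' y = fst (r, m) y))"
      by (rule runs_Seq_value[OF runs_xcomp, where ?t2.0 = 3])
        (use HStore.prems r' eq eqa eqe in \<open>auto intro!: runs_Store simp: agree_def\<close>)
  qed (use HStore.prems in auto)
next
  case (HSeq c1 c2)
  show ?case unfolding hcomp.simps
  proof (rule runs_Seq[OF HSeq.IH(1)])
    fix s' assume s': "agree b s' (hsem c1 s0) \<and> (\<forall>z<b. fst s' z \<le> int N) \<and>
      (\<forall>y. b \<le> y \<and> y < t \<longrightarrow> fst s' y = fst s y)"
    show "runs (hcomp c2 t) s' (hcost c2 N)
      (\<lambda>s'. agree b s' (hsem (HSeq c1 c2) s0) \<and> (\<forall>z<b. fst s' z \<le> int N) \<and>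
         (\<forall>y. b \<le> y \<and> y < t \<longrightarrow> fst s' y = fst s y))"
      by (rule runs_mono[OF HSeq.IH(2)[of t s' "hsem c1 s0"]]) (use HSeq.prems s' in simp_all)
  qed (use HSeq.prems in simp_all)
next
  case (HFor x y c)
  define n where "n = nat (fst s0 y)"
  have n: "n = nat (fst s y)" unfolding n_def using HFor.prems by (auto simp: agree_def)
  have xt: "x < b" "y < b" "hbelow b c" "b \<le> t" using HFor.prems by auto
  have nN: "n \<le> N" using HFor.prems(4)[of y] xt unfolding n by auto
  define it where "it i = fold (\<lambda>i s. hsem c ((fst s)(x := int i), snd s)) [0..<i] s0" for i
  \<comment> \<open>The loop keeps its bound in \<open>t\<close> and its counter in
    \<open>t + 1\<close>. The body is compiled with temporaries from \<open>t + 2\<close> on, and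
    the induction hypothesis protects the registers from \<open>b\<close> up to
    \<open>t + 1\<close>; so the body may assign to \<open>x\<close> and \<open>y\<close>.\<close>
  define P where "P i s' \<longleftrightarrow> agree b s' (it i) \<and> (\<forall>z<b. fst s' z \<le> int N) \<and>
      (\<forall>y. b \<le> y \<and> y < t \<longrightarrow> fst s' y = fst s y) \<and> fst s' t = fst s y \<and> fst s' (t + 1) = int i"
    for i :: nat and s' :: state
  let ?body = "Seq (Assign x (Reg (t + 1)))
            (Seq (hcomp c (t + 2)) (Assign (t + 1) (Add (Reg (t + 1)) (Const 1))))"
  let ?b = "Sub (Reg t) (Reg (t + 1))"
  have step: "eval_expr ?b s' > 0 \<and> runs ?body s' (hcost c N + 6) (P (Suc i))"
    if "i < n" "P i s'" for i s'
  proof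
    obtain r' m where s': "s' = (r', m)" by (cases s') auto
    show "eval_expr ?b s' > 0" using that unfolding P_def n s' by auto
    have ok: "hok N c ((fst (it i))(x := int i), snd (it i))"
      using HFor.prems(5) \<open>i < n\<close> unfolding n_def it_def by (simp add: Let_def)
    have nx: "it (Suc i) = hsem c ((fst (it i))(x := int i), snd (it i))"
      unfolding it_def by simp
    show "runs ?body s' (hcost c N + 6) (P (Suc i))" unfolding s'
      apply (rule runs_Seq[where ?t1.0 = 2 and ?t2.0 = "hcost c N + 4" and P = "\<lambda>s. s = (r'(x := int i), m)"])
      subgoal using \<open>P i s'\<close> by (auto intro!: runs_Assign simp: P_def s')
       apply clarify
       apply (rule runs_Seq[OF HFor.IH[where ?s0.0 = "((fst (it i))(x := int i), snd (it i))"], where ?t2.0 = 4])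
      subgoal using xt by simp
      subgoal using xt by simp
      subgoal using \<open>P i s'\<close> by (auto simp: P_def s' agree_def)
      subgoal using \<open>P i s'\<close> that nN by (auto simp: P_def s')
      subgoal by (rule ok)
      subgoal for _ _ s''
        apply (cases s'')
        using \<open>P i s'\<close> xt apply (auto intro!: runs_Assign simp: P_def s' nx agree_def)
        done
       apply simp_all
      done
  qed
  have stop: "\<not> eval_expr ?b s > 0" if "P n s" for s
    using that unfolding P_def n by auto
  have W: "runs (While ?b ?body) s (1 + cost_expr ?b + (n - 0) * (1 + cost_expr ?b + (hcost c N + 6))) (P n)"
    if "P 0 s" for s
    by (rule runs_While[where P = P]) (use step stop that in auto)
  have ncost: "(n - 0) * (1 + cost_expr ?b + (hcost c N + 6)) \<le> N * (hcost c N + 10)"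
    using nN by (simp add: mult_le_mono)
  obtain r m where s: "s = (r, m)" by (cases s) auto
  show ?case unfolding hcomp.simps s
    apply (rule runs_Seq[where ?t1.0 = 2 and ?t2.0 = "6 + N * (hcost c N + 10)" and P = "\<lambda>s. s = (r(t := r y), m)"])
      apply (simp add: runs_Assign)
     apply clarify
     apply (rule runs_Seq[where ?t1.0 = 2 and ?t2.0 = "4 + N * (hcost c N + 10)" and P = "P 0"])
    subgoal using xt HFor.prems by (auto intro!: runs_Assign simp: P_def s it_def agree_def)
      apply (rule runs_mono[OF W])
        apply assumption
    subgoal using ncost by simp
    subgoal by (auto simp: P_def it_def n_def s)
    by simp_all
qed

section \<open>Polynomial bounds on the running time\<close>

primrec xdeg :: "xexp \<Rightarrow> nat" where
  "xdeg (XC i) = 0"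
| "xdeg (XR x) = 0"
| "xdeg (XM e) = xdeg e"
| "xdeg (XAdd a b) = max (xdeg a) (xdeg b)"
| "xdeg (XSub a b) = max (xdeg a) (xdeg b)"
| "xdeg (XIf c a b) = max (xdeg c) (max (xdeg a) (xdeg b))"
| "xdeg (XSum x y e) = Suc (xdeg e)"

primrec xcoef :: "xexp \<Rightarrow> nat" where
  "xcoef (XC i) = 2"
| "xcoef (XR x) = 2"
| "xcoef (XM e) = xcoef e + 3"
| "xcoef (XAdd a b) = xcoef a + xcoef b + 4"
| "xcoef (XSub a b) = xcoef a + xcoef b + 4"
| "xcoef (XIf c a b) = xcoef c + xcoef a + xcoef b + 2"
| "xcoef (XSum x y e) = xcoef e + 26"

primrec hdeg :: "hcom \<Rightarrow> nat" where
  "hdeg (HSet x e) = xdeg e"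
| "hdeg (HStore a e) = max (xdeg a) (xdeg e)"
| "hdeg (HSeq c1 c2) = max (hdeg c1) (hdeg c2)"
| "hdeg (HFor x y c) = Suc (hdeg c)"

primrec hcoef :: "hcom \<Rightarrow> nat" where
  "hcoef (HSet x e) = xcoef e + 2"
| "hcoef (HStore a e) = xcoef a + xcoef e + 3"
| "hcoef (HSeq c1 c2) = hcoef c1 + hcoef c2"
| "hcoef (HFor x y c) = hcoef c + 18"

text \<open>With \<open>1 \<le> N\<close> the highest power absorbs the lower ones. A sum adds 26 =
  14 + 12 to the coefficient, its constant and its linear cost.\<close>

lemma xcost_le:
  assumes "1 \<le> N"
  shows "xcost e N \<le> xcoef e * N ^ xdeg e"
proof -
  have mono: "a \<le> b * N ^ k \<Longrightarrow> k \<le> l \<Longrightarrow> a \<le> b * N ^ l" for a b k l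
    by (meson assms le_trans mult_le_mono2 power_increasing)
  have one: "1 \<le> N ^ k" for k using assms by simp
  show ?thesis
  proof (induction e)
    case (XM e)
    then show ?case using one[of "xdeg e"] by (simp add: algebra_simps)
  next
    case (XAdd a b)
    show ?case
      using mono[OF XAdd.IH(1), of "max (xdeg a) (xdeg b)"] mono[OF XAdd.IH(2), of "max (xdeg a) (xdeg b)"]
        one[of "max (xdeg a) (xdeg b)"]
      by (simp add: algebra_simps)
  next
    case (XSub a b)
    show ?case
      using mono[OF XSub.IH(1), of "max (xdeg a) (xdeg b)"] mono[OF XSub.IH(2), of "max (xdeg a) (xdeg b)"]
        one[of "max (xdeg a) (xdeg b)"]
      by (simp add: algebra_simps)
  next
    case (XIf c a b)
    let ?d = "max (xdeg c) (max (xdeg a) (xdeg b))"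
    have "xcost c N \<le> xcoef c * N ^ ?d" "xcost a N \<le> xcoef a * N ^ ?d" "xcost b N \<le> xcoef b * N ^ ?d"
      using XIf.IH by (auto intro: mono)
    with one[of ?d] show ?case by (simp only: xcost.simps xcoef.simps xdeg.simps add_mult_distrib)
  next
    case (XSum x y e)
    have "N * xcost e N \<le> xcoef e * (N * N ^ xdeg e)"
      using mult_le_mono2[OF XSum, of N] by (simp add: ac_simps)
    moreover have "N \<le> N * N ^ xdeg e" "1 \<le> N * N ^ xdeg e" using assms one[of "xdeg e"] by auto
    moreover have "xcost (XSum x y e) N = 14 + N * xcost e N + 12 * N" by (simp add: algebra_simps)
    moreover have "xcoef (XSum x y e) * N ^ xdeg (XSum x y e) =
      xcoef e * (N * N ^ xdeg e) + 26 * (N * N ^ xdeg e)" by (simp add: algebra_simps)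
    ultimately show ?case by linarith
  qed auto
qed

lemma hcost_le:
  assumes "1 \<le> N"
  shows "hcost c N \<le> hcoef c * N ^ hdeg c"
proof -
  have mono: "a \<le> b * N ^ k \<Longrightarrow> k \<le> l \<Longrightarrow> a \<le> b * N ^ l" for a b k l
    by (meson assms le_trans mult_le_mono2 power_increasing)
  have one: "1 \<le> N ^ k" for k using assms by simp
  show ?thesis
  proof (induction c)
    case (HSet x e)
    show ?case using xcost_le[OF assms, of e] one[of "xdeg e"] by (simp add: algebra_simps)
  next
    case (HStore a e)
    let ?d = "max (xdeg a) (xdeg e)"
    show ?case
      using mono[OF xcost_le[OF assms, of a], of ?d] mono[OF xcost_le[OF assms, of e], of ?d] one[of ?d]
      by (simp add: algebra_simps)
  next
    case (HSeq c1 c2)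
    let ?d = "max (hdeg c1) (hdeg c2)"
    show ?case
      using mono[OF HSeq.IH(1), of ?d] mono[OF HSeq.IH(2), of ?d] by (simp add: algebra_simps)
  next
    case (HFor x y c)
    have "N * hcost c N \<le> hcoef c * (N * N ^ hdeg c)"
      using mult_le_mono2[OF HFor, of N] by (simp add: ac_simps)
    moreover have "N \<le> N * N ^ hdeg c" "1 \<le> N * N ^ hdeg c" using assms one[of "hdeg c"] by auto
    moreover have "hcost (HFor x y c) N = 8 + N * hcost c N + 10 * N" by (simp add: algebra_simps)
    moreover have "hcoef (HFor x y c) * N ^ hdeg (HFor x y c) =
      hcoef c * (N * N ^ hdeg c) + 18 * (N * N ^ hdeg c)" by (simp add: algebra_simps)
    ultimately show ?case by linarith
  qed
qed

section \<open>Weakest preconditions\<close>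

text \<open>
  Weakest precondition of \<open>c\<close> for the postcondition \<open>Q\<close>, together with the side condition \<^const>\<open>hok\<close>
  of the running time bound.
\<close>

definition hwp :: "nat \<Rightarrow> hcom \<Rightarrow> ((nat \<Rightarrow> int) \<Rightarrow> (int \<Rightarrow> int) \<Rightarrow> bool) \<Rightarrow> (nat \<Rightarrow> int) \<Rightarrow> (int \<Rightarrow> int) \<Rightarrow> bool" where
  "hwp N c Q r m \<longleftrightarrow> hok N c (r, m) \<and> (case hsem c (r, m) of (r', m') \<Rightarrow> Q r' m')"

lemma hwp_HSet: "hwp N (HSet x e) Q r m \<longleftrightarrow> xev e r m \<le> int N \<and> Q (r(x := xev e r m)) m"
  by (simp add: hwp_def)

lemma hwp_HStore: "hwp N (HStore a e) Q r m \<longleftrightarrow> Q r (m(xev a r m := xev e r m))"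
  by (simp add: hwp_def)

lemma hwp_HSeq: "hwp N (HSeq c1 c2) Q r m \<longleftrightarrow> hwp N c1 (hwp N c2 Q) r m"
  by (auto simp: hwp_def split: prod.splits)

lemma hwp_mono: "hwp N c Q r m \<Longrightarrow> (\<And>r m. Q r m \<Longrightarrow> Q' r m) \<Longrightarrow> hwp N c Q' r m"
  by (auto simp: hwp_def split: prod.splits)

text \<open>The bound is read once, on entry, so the invariant need not preserve register
  \<open>y\<close>. The invariant of step \<open>i\<close> is assumed before the loop sets its own
  register \<open>x\<close>.\<close>

lemma hwp_HFor:
  assumes "I 0 r m"
    and step: "\<And>i r' m'. i < nat (r y) \<Longrightarrow> I i r' m' \<Longrightarrow> hwp N c (I (Suc i)) (r'(x := int i)) m'"
    and "\<And>r' m'. I (nat (r y)) r' m' \<Longrightarrow> Q r' m'"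
  shows "hwp N (HFor x y c) Q r m"
proof -
  define it where "it i = fold (\<lambda>i s. hsem c ((fst s)(x := int i), snd s)) [0..<i] (r, m)" for i
  have I: "I i (fst (it i)) (snd (it i))" if "i \<le> nat (r y)" for i
    using that
  proof (induction i)
    case 0
    then show ?case using assms(1) by (simp add: it_def)
  next
    case (Suc i)
    then have "hwp N c (I (Suc i)) ((fst (it i))(x := int i)) (snd (it i))"
      by (intro step) auto
    then show ?case by (auto simp: hwp_def it_def split: prod.splits)
  qed
  have "hok N c ((fst (it i))(x := int i), snd (it i))" if "i < nat (r y)" for i
    using step[OF that I[of i]] that by (simp add: hwp_def)
  moreover have "Q (fst (it (nat (r y)))) (snd (it (nat (r y))))"
    using I[of "nat (r y)"] assms(3) by simp
  ultimately show ?thesis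
    by (auto simp: hwp_def it_def Let_def split: prod.splits)
qed

text \<open>The passage from source programs to the machine: \<open>N\<close> has to bound the
  initial registers below \<open>b\<close> and, through \<open>hok\<close>, every value assigned to
  a register.\<close>

lemma exec_hcomp:
  assumes "hwp N c Q r m" "hbelow b c" "0 < b" "1 \<le> N" "\<And>z. z < b \<Longrightarrow> r z \<le> int N"
    and "\<And>r m. Q r m \<Longrightarrow> r 0 = v"
  shows "\<exists>T s'. exec (hcomp c b) (r, m) T s' \<and> T \<le> hcoef c * N ^ hdeg c \<and> fst s' 0 = v"
proof -
  obtain r' m' where h: "hsem c (r, m) = (r', m')" "Q r' m'" "hok N c (r, m)"
    using assms(1) by (auto simp: hwp_def split: prod.splits)
  have "runs (hcomp c b) (r, m) (hcost c N) (\<lambda>s'. fst s' 0 = v)"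
    by (rule runs_mono[OF runs_hcomp[where b = b and ?s0.0 = "(r, m)"]])
      (use assms h in \<open>auto simp: agree_def\<close>)
  then show ?thesis
    using hcost_le[OF \<open>1 \<le> N\<close>, of c] unfolding runs_def using le_trans by blast
qed

section \<open>Dilation 2 and 2-spanners\<close>

lemma enat_sum_less_3: "(a::enat) + b < enat 3 \<Longrightarrow> 1 \<le> a \<Longrightarrow> 1 \<le> b \<Longrightarrow> a < 2 \<and> b < (2::enat)"
  by (cases a; cases b) (auto simp: one_enat_def numeral_eq_enat)

lemma path_weight_Cons_Cons: "path_weight w (x # y # xs) = w x y + path_weight w (y # xs)"
  unfolding path_weight_def by (simp add: sum.lessThan_Suc_shift del: sum.lessThan_Suc)

lemma path_weight_single: "path_weight w [x] = 0"
  by (simp add: path_weight_def)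

lemma weighted_dist_le: "is_path V E u xs v \<Longrightarrow> weighted_dist V E w u v \<le> path_weight w xs"
  unfolding weighted_dist_def by (rule INF_lower) simp

lemma weighted_dist_lessE:
  assumes "weighted_dist V E w u v < c"
  obtains xs where "is_path V E u xs v" "path_weight w xs < c"
  using assms unfolding weighted_dist_def INF_less_iff by blast

lemma path_weight_ge:
  assumes "distinct xs" "\<And>x y. x \<noteq> y \<Longrightarrow> 1 \<le> w x y"
  shows "enat (length xs - 1) \<le> path_weight w xs"
proof -
  have "(\<Sum>i<length xs - 1. 1::enat) \<le> path_weight w xs"
    unfolding path_weight_def
    by (intro sum_mono assms(2)) (use assms(1) in \<open>auto simp: nth_eq_iff_index_eq\<close>)
  then show ?thesis by (simp add: of_nat_eq_enat)
qed

lemma path_weight_le: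
  assumes "successively (\<lambda>x y. w x y \<le> 1) xs"
  shows "path_weight w xs \<le> enat (length xs - 1)"
  using assms
proof (induction xs rule: induct_list012)
  case (3 x y zs)
  then have "w x y \<le> 1" "path_weight w (y # zs) \<le> enat (length zs)" by auto
  then have "w x y + path_weight w (y # zs) \<le> 1 + enat (length zs)" by (rule add_mono)
  then show ?case by (simp add: path_weight_Cons_Cons one_enat_def)
qed (auto simp: path_weight_def)

lemma hop_dist_ge_1:
  assumes "x \<noteq> y" shows "1 \<le> hop_dist V H x y"
  unfolding hop_dist_def weighted_dist_def
proof (rule INF_greatest)
  fix xs assume "xs \<in> {xs. is_path V H x xs y}"
  then have xs: "is_path V H x xs y" by simp
  then have "1 \<le> length xs - 1" using assms
    unfolding is_path_def by (cases xs; cases "tl xs"; cases "tl (tl xs)") auto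
  moreover have "enat (length xs - 1) \<le> path_weight (\<lambda>_ _. 1) xs"
    using xs by (intro path_weight_ge) (auto simp: is_path_def)
  ultimately show "1 \<le> path_weight (\<lambda>_ _. 1) xs"
    by (metis enat_ord_simps(1) one_enat_def order.trans)
qed

lemma hop_dist_le_1:
  assumes "{x, y} \<in> H" "x \<in> V" "y \<in> V" "x \<noteq> y"
  shows "hop_dist V H x y \<le> 1"
proof -
  have "is_path V H x [x, y] y" using assms by (simp add: is_path_def)
  from weighted_dist_le[OF this, of "\<lambda>_ _. 1"] show ?thesis
    by (simp add: hop_dist_def path_weight_Cons_Cons path_weight_single)
qed

lemma hop_dist_less_2:
  assumes "hop_dist V H x y < 2" "x \<noteq> y"
  shows "{x, y} \<in> H"
proof -
  obtain xs where xs: "is_path V H x xs y" "path_weight (\<lambda>_ _. 1) xs < 2"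
    using assms(1) unfolding hop_dist_def by (rule weighted_dist_lessE)
  have "enat (length xs - 1) \<le> path_weight (\<lambda>_ _. 1) xs"
    using xs by (intro path_weight_ge) (auto simp: is_path_def)
  from this xs(2) have "enat (length xs - 1) < 2" by (rule order.strict_trans1)
  then have "enat (length xs - 1) < enat 2" by (simp add: numeral_eq_enat)
  then have "length xs \<le> 2" by simp
  then show ?thesis using xs(1) assms(2) unfolding is_path_def
    by (cases xs; cases "tl xs"; cases "tl (tl xs)") auto
qed

text \<open>A detour of weight 2 has two edges of weight 1, so both must lie in \<open>H\<close>;
  for the direct edge this is the premise.\<close>

definition spanner2 :: "'a set set \<Rightarrow> 'a set set \<Rightarrow> bool" where
  "spanner2 E H \<longleftrightarrow>
     (\<forall>u v. {u, v} \<in> H \<longrightarrow> {u, v} \<in> E \<or> (\<exists>w. {u, w} \<in> E \<inter> H \<and> {w, v} \<in> E \<inter> H))"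

lemma vertex_pairs_iff: "{u, v} \<in> vertex_pairs V \<longleftrightarrow> u \<in> V \<and> v \<in> V \<and> u \<noteq> v"
  unfolding vertex_pairs_def by (auto simp: doubleton_eq_iff)

text \<open>Paths must not repeat vertices. If \<open>w\<close> already occurs, the path is cut
  there instead of being extended.\<close>

lemma is_path_snoc:
  assumes "is_path V E u xs v" "{v, w} \<in> E" "w \<in> V"
  obtains ys where "is_path V E u ys w" "length ys \<le> Suc (length xs)"
proof (cases "w \<in> set xs")
  case True
  then obtain as bs where xs: "xs = as @ w # bs" by (meson split_list)
  have "is_path V E u (as @ [w]) w"
    using assms(1) unfolding is_path_def xs
    by (auto simp: successively_append_iff hd_append split: if_splits)
  then show ?thesis using that xs by force
next
  case False
  have "is_path V E u (xs @ [w]) w"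
    using assms False unfolding is_path_def
    by (auto simp: successively_append_iff hd_append split: if_splits)
  then show ?thesis using that by force
qed

text \<open>Each edge costs at most two replacement edges. Repetitions are cut off as they arise, so
  there is a path at every stage.\<close>

lemma spanner2_path:
  assumes "spanner2 E H" "H \<subseteq> vertex_pairs V"
    and "xs \<noteq> []" "set xs \<subseteq> V" "successively (\<lambda>x y. {x, y} \<in> H) xs"
  shows "\<exists>ys. is_path V (E \<inter> H) (hd xs) ys (last xs) \<and> length ys - 1 \<le> 2 * (length xs - 1)"
  using assms(3-5)
proof (induction xs rule: rev_induct)
  case (snoc v xs)
  show ?case
  proof (cases "xs = []")
    case True
    then show ?thesis using snoc.prems by (intro exI[of _ "[v]"]) (auto simp: is_path_def)
  next
    case False
    then have h: "{last xs, v} \<in> H" "successively (\<lambda>x y. {x, y} \<in> H) xs"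
      using snoc.prems by (auto simp: successively_append_iff)
    then obtain ys where ys: "is_path V (E \<inter> H) (hd xs) ys (last xs)" "length ys - 1 \<le> 2 * (length xs - 1)"
      using snoc False by auto
    have "\<exists>zs. is_path V (E \<inter> H) (hd xs) zs v \<and> length zs \<le> length ys + 2"
    proof (cases "{last xs, v} \<in> E")
      case True
      with is_path_snoc[OF ys(1), of v] h(1) snoc.prems show ?thesis
        by (metis Int_iff add_2_eq_Suc' assms(2) le_SucI subsetD vertex_pairs_iff)
    next
      case False
      then obtain w where w: "{last xs, w} \<in> E \<inter> H" "{w, v} \<in> E \<inter> H"
        using assms(1) h(1) unfolding spanner2_def by blast
      then have V: "w \<in> V" "v \<in> V" using assms(2) by (auto simp: vertex_pairs_iff)
      obtain zs where zs: "is_path V (E \<inter> H) (hd xs) zs w" "length zs \<le> Suc (length ys)"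
        using is_path_snoc[OF ys(1) w(1) V(1)] .
      obtain zs' where "is_path V (E \<inter> H) (hd xs) zs' v" "length zs' \<le> Suc (length zs)"
        using is_path_snoc[OF zs(1) w(2) V(2)] .
      then show ?thesis using zs(2) by (intro exI[of _ zs']) auto
    qed
    then obtain zs where zs: "is_path V (E \<inter> H) (hd xs) zs v" "length zs \<le> length ys + 2" by blast
    have "length ys > 0" using ys(1) by (auto simp: is_path_def)
    moreover have "length xs > 0" using False by simp
    ultimately have "length zs - 1 \<le> 2 * length xs" using zs(2) ys(2) by linarith
    then show ?thesis using False zs(1) by (auto simp: hd_append)
  qed
qed simp

lemma dilation_at_most_2_iff:
  assumes "H \<subseteq> vertex_pairs V"
  shows "dilation_at_most 2 V E H \<longleftrightarrow> spanner2 E H"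
proof
  assume dil: "dilation_at_most 2 V E H"
  show "spanner2 E H" unfolding spanner2_def
  proof (intro allI impI)
    fix u v assume uv: "{u, v} \<in> H"
    then have V: "u \<in> V" "v \<in> V" "u \<noteq> v" using assms vertex_pairs_iff[of u v V] by blast+
    have "weighted_dist V E (hop_dist V H) u v \<le> enat 2 * hop_dist V H u v"
      using dil V unfolding dilation_at_most_def by blast
    also have "\<dots> \<le> enat 2 * 1"
      by (intro mult_left_mono hop_dist_le_1) (use uv V in auto)
    \<comment> \<open>The distance is an infimum; it takes a strict bound to obtain an actual
      path.\<close>
    also have "\<dots> < enat 3" by simp
    finally obtain xs where xs: "is_path V E u xs v" "path_weight (hop_dist V H) xs < enat 3"
      by (rule weighted_dist_lessE)
    have "enat (length xs - 1) \<le> path_weight (hop_dist V H) xs"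
      using xs by (intro path_weight_ge hop_dist_ge_1) (auto simp: is_path_def)
    from this xs(2) have "enat (length xs - 1) < enat 3" by (rule order.strict_trans1)
    then have len: "length xs \<le> 3" by simp
    then consider "xs = [u, v]" | w where "xs = [u, w, v]"
      using xs(1) V unfolding is_path_def
      by (cases xs; cases "tl xs"; cases "tl (tl xs)"; cases "tl (tl (tl xs))") auto
    then show "{u, v} \<in> E \<or> (\<exists>w. {u, w} \<in> E \<inter> H \<and> {w, v} \<in> E \<inter> H)"
    proof cases
      case 1
      then show ?thesis using xs(1) by (simp add: is_path_def)
    next
      case (2 w)
      then have w: "{u, w} \<in> E" "{w, v} \<in> E" "u \<noteq> w" "w \<noteq> v" using xs(1) by (auto simp: is_path_def)
      have "hop_dist V H u w + hop_dist V H w v < enat 3"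
        using xs(2) 2 by (simp add: path_weight_Cons_Cons path_weight_single)
      then have "hop_dist V H u w < 2 \<and> hop_dist V H w v < 2"
        using enat_sum_less_3 hop_dist_ge_1[OF w(3)] hop_dist_ge_1[OF w(4)] by blast
      then have "{u, w} \<in> H" "{w, v} \<in> H" using w hop_dist_less_2 by metis+
      then show ?thesis using w by blast
    qed
  qed
next
  assume sp: "spanner2 E H"
  show "dilation_at_most 2 V E H" unfolding dilation_at_most_def
  proof (intro ballI)
    fix u v assume V: "u \<in> V" "v \<in> V"
    show "weighted_dist V E (hop_dist V H) u v \<le> enat 2 * hop_dist V H u v"
    proof (cases "hop_dist V H u v")
      case (enat h)
      then have "hop_dist V H u v < enat (Suc h)" by simp
      then obtain xs where xs: "is_path V H u xs v" "path_weight (\<lambda>_ _. 1) xs < enat (Suc h)"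
        unfolding hop_dist_def by (rule weighted_dist_lessE)
      have "enat (length xs - 1) \<le> path_weight (\<lambda>_ _. 1) xs"
        using xs by (intro path_weight_ge) (auto simp: is_path_def)
      from this xs(2) have "enat (length xs - 1) < enat (Suc h)" by (rule order.strict_trans1)
      then have h: "length xs - 1 \<le> h" by simp
      obtain ys where ys: "is_path V (E \<inter> H) u ys v" "length ys - 1 \<le> 2 * (length xs - 1)"
        using spanner2_path[OF sp assms, of xs] xs(1) unfolding is_path_def by auto
      have E: "is_path V E u ys v"
        using ys(1) unfolding is_path_def by (auto elim: successively_mono)
      have "successively (\<lambda>x y. hop_dist V H x y \<le> 1) ys"
      proof (rule successively_mono)
        show "successively (\<lambda>x y. {x, y} \<in> E \<inter> H) ys" using ys(1) by (simp add: is_path_def)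
        show "hop_dist V H x y \<le> 1" if "{x, y} \<in> E \<inter> H" for x y
        proof -
          have "x \<in> V" "y \<in> V" "x \<noteq> y" using that assms vertex_pairs_iff[of x y V] by blast+
          with that show ?thesis by (intro hop_dist_le_1) auto
        qed
      qed
      then have "path_weight (hop_dist V H) ys \<le> enat (length ys - 1)" by (rule path_weight_le)
      also have "\<dots> \<le> enat (2 * h)" using ys(2) h by simp
      finally show ?thesis using weighted_dist_le[OF E, of "hop_dist V H"] enat by simp
    \<comment> \<open>Here the hop distance is \<open>\<infinity>\<close>, and so is its
      double.\<close>
    qed (simp add: times_enat_simps)
  qed
qed

text \<open>Passing to \<open>(S \<inter> H) - E\<close> neither enlarges \<open>S\<close> nor loses
  a blue edge. So the search need not check that the sets it adds are non-edges of \<open>G\<close>,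
  or pairs at all.\<close>

lemma dilation_augmentation_2_iff:
  assumes "finite_graph V H" "finite_graph V E"
  shows "dilation_augmentation 2 V E H k \<longleftrightarrow>
    (\<exists>S. finite S \<and> int (card S) \<le> k \<and> spanner2 (E \<union> S) H)"
proof
  assume "dilation_augmentation 2 V E H k"
  then obtain S where S: "S \<subseteq> vertex_pairs V - E" "int (card S) \<le> k" "spanner2 (E \<union> S) H"
    using assms unfolding dilation_augmentation_def finite_graph_def by (auto simp: dilation_at_most_2_iff)
  have "vertex_pairs V \<subseteq> Pow V" by (auto simp: vertex_pairs_def)
  then have "finite S" using S(1) assms(1) unfolding finite_graph_def
    by (meson Diff_subset finite_Pow_iff finite_subset order_trans)
  with S show "\<exists>S. finite S \<and> int (card S) \<le> k \<and> spanner2 (E \<union> S) H" by blast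
next
  assume "\<exists>S. finite S \<and> int (card S) \<le> k \<and> spanner2 (E \<union> S) H"
  then obtain S where S: "finite S" "int (card S) \<le> k" "spanner2 (E \<union> S) H" by blast
  let ?S = "(S \<inter> H) - E"
  have "card ?S \<le> card S" using S(1) by (intro card_mono) auto
  moreover have "?S \<subseteq> vertex_pairs V - E" using assms(1) by (auto simp: finite_graph_def)
  moreover have "spanner2 (E \<union> ?S) H" using S(3) unfolding spanner2_def by blast
  ultimately show "dilation_augmentation 2 V E H k"
    using assms S(2) unfolding dilation_augmentation_def finite_graph_def
    by (intro exI[of _ ?S]) (auto simp: dilation_at_most_2_iff)
qed

section \<open>Candidate edges\<close>

lemma card_filter_sum: "finite A \<Longrightarrow> card {x \<in> A. P x} = (\<Sum>x\<in>A. if P x then 1 else 0)"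
  by (simp flip: sum.inter_filter)

text \<open>
  Double counting yields \<open>card N / (2 * k * d)\<close> elements of \<open>N\<close> with \<open>d\<close> neighbours each among
  \<open>2 * k * d\<close> elements of \<open>W\<close>; \<open>d\<close> of them have the same neighbours there.
\<close>

lemma heavy_card:
  fixes k d :: nat and V :: "'a set"
  assumes free: "biclique_free d V E" and E: "E \<subseteq> vertex_pairs V" and V: "finite V"
    and W: "W \<subseteq> V" and N: "N \<subseteq> V"
    and heavy: "\<And>w. w \<in> W \<Longrightarrow> card N \<le> k * card {v \<in> N. {w, v} \<in> E} + 2 * k"
    and large: "4 * k \<le> card N" "2 ^ (2 * k * d) * d * (2 * k * d) < card N"
  shows "card W \<le> 2 * k * d"
proof (rule ccontr)
  define M where "M = 2 * k * d"
  assume "\<not> card W \<le> 2 * k * d"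
  then have cW: "M < card W" by (simp add: M_def)
  then obtain W' where W': "W' \<subseteq> W" "card W' = M" by (meson obtain_subset_with_card_n less_imp_le)
  have fin: "finite W'" "finite N" using W W' N V by (meson finite_subset)+
  have "W \<noteq> {}" using cW by auto
  then have k: "k > 0" using heavy large(2) by (cases "k = 0") auto
  \<comment> \<open>For \<open>d = 0\<close> the empty sets form a biclique.\<close>
  have d: "d > 0"
  proof (rule ccontr)
    assume "\<not> d > 0"
    then have "\<exists>A B. A \<subseteq> V \<and> B \<subseteq> V \<and> A \<inter> B = {} \<and> card A = d \<and> card B = d \<and> (\<forall>a\<in>A. \<forall>b\<in>B. {a, b} \<in> E)"
      by (intro exI[of _ "{}"]) simp
    then show False using free unfolding biclique_free_def by blast
  qed
  let ?m = "card N"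
  let ?A = "\<lambda>v. {w \<in> W'. {w, v} \<in> E}"
  define good where "good = {v \<in> N. d \<le> card (?A v)}"
  have "(\<Sum>w\<in>W'. card {v \<in> N. {w, v} \<in> E}) = (\<Sum>w\<in>W'. \<Sum>v\<in>N. if {w, v} \<in> E then 1 else 0)"
    by (intro sum.cong card_filter_sum fin refl)
  also have "\<dots> = (\<Sum>v\<in>N. \<Sum>w\<in>W'. if {w, v} \<in> E then 1 else 0)"
    by (rule sum.swap)
  also have "\<dots> = (\<Sum>v\<in>N. card (?A v))"
    by (intro sum.cong card_filter_sum[symmetric] fin refl)
  \<comment> \<open>A vertex outside \<open>good\<close> has at most \<open>d - 1\<close> neighbours
    in \<open>W'\<close>, any other at most \<open>M\<close>.\<close>
  also have "\<dots> \<le> (\<Sum>v\<in>N. (d - 1) + (if v \<in> good then M else 0))"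
  proof (rule sum_mono)
    fix v assume "v \<in> N"
    have "card (?A v) \<le> card W'" using fin by (intro card_mono) auto
    then show "card (?A v) \<le> (d - 1) + (if v \<in> good then M else 0)"
      using \<open>v \<in> N\<close> W'(2) unfolding good_def by auto
  qed
  also have "\<dots> = ?m * (d - 1) + card good * M"
  proof -
    have "N \<inter> good = good" by (auto simp: good_def)
    then show ?thesis using fin by (simp add: sum.distrib sum.If_cases)
  qed
  finally have le: "(\<Sum>w\<in>W'. card {v \<in> N. {w, v} \<in> E}) \<le> ?m * (d - 1) + card good * M" .
  have "2 * k * (d * ?m) = (\<Sum>w\<in>W'. ?m)" using W' M_def by simp
  also have "\<dots> \<le> (\<Sum>w\<in>W'. 2 * k * card {v \<in> N. {w, v} \<in> E})"
  proof (rule sum_mono)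
    fix w assume "w \<in> W'"
    then have "?m \<le> k * card {v \<in> N. {w, v} \<in> E} + 2 * k" using heavy W' by blast
    \<comment> \<open>As \<open>4 * k \<le> ?m\<close>, the slack \<open>2 * k\<close> is at most
      half of \<open>?m\<close>; this is where the factor 2 comes from.\<close>
    then show "?m \<le> 2 * k * card {v \<in> N. {w, v} \<in> E}" using large(1) by linarith
  qed
  also have "\<dots> = 2 * k * (\<Sum>w\<in>W'. card {v \<in> N. {w, v} \<in> E})"
    by (rule sum_distrib_left[symmetric])
  also have "\<dots> \<le> 2 * k * (?m * (d - 1) + card good * M)"
    using le by (rule mult_le_mono2)
  finally have "2 * k * (d * ?m) \<le> 2 * k * (?m * (d - 1) + card good * M)" .
  then have "d * ?m \<le> ?m * (d - 1) + card good * M" using k by simp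
  moreover have "d * ?m = ?m * (d - 1) + ?m" using d by (cases d) auto
  ultimately have mle: "?m \<le> card good * M" by simp
  have "card (\<Union>D\<in>Pow W'. {v \<in> good. ?A v = D}) \<le> (\<Sum>D\<in>Pow W'. card {v \<in> good. ?A v = D})"
    by (rule card_UN_le) (use fin in simp)
  moreover have "(\<Union>D\<in>Pow W'. {v \<in> good. ?A v = D}) = good"
  proof (intro equalityI subsetI)
    fix v assume "v \<in> good"
    then show "v \<in> (\<Union>D\<in>Pow W'. {v \<in> good. ?A v = D})" by (intro UN_I[of "?A v"]) simp_all
  qed (erule UN_E, simp)
  ultimately have "card good \<le> (\<Sum>D\<in>Pow W'. card {v \<in> good. ?A v = D})"
    by (simp only:)
  also have "\<dots> \<le> (\<Sum>D\<in>Pow W'. d)"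
  \<comment> \<open>Members of \<open>good\<close> with the same neighbourhood \<open>D\<close>
    share at least \<open>d\<close> neighbours, so more than \<open>d\<close> of them would contain
    one side of a biclique.\<close>
  proof (rule sum_mono, rule ccontr)
    fix D assume D: "D \<in> Pow W'" and "\<not> card {v \<in> good. ?A v = D} \<le> d"
    then have c: "d < card {v \<in> good. ?A v = D}" by simp
    then have "{v \<in> good. ?A v = D} \<noteq> {}" by (metis card.empty not_less_zero)
    then obtain v where "v \<in> good" "?A v = D" by blast
    then have cD: "d \<le> card D" unfolding good_def by blast
    obtain Y where Y: "Y \<subseteq> {v \<in> good. ?A v = D}" "card Y = d"
      using c by (meson obtain_subset_with_card_n less_imp_le)
    obtain X where X: "X \<subseteq> D" "card X = d" using cD by (meson obtain_subset_with_card_n)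
    have adj: "\<forall>a\<in>X. \<forall>b\<in>Y. {a, b} \<in> E"
    proof (intro ballI)
      fix a b assume "a \<in> X" "b \<in> Y"
      then have "a \<in> D" "?A b = D" using X Y by auto
      then have "a \<in> ?A b" by simp
      then show "{a, b} \<in> E" by simp
    qed
    moreover have "X \<inter> Y = {}"
    proof (rule ccontr)
      assume "X \<inter> Y \<noteq> {}"
      then obtain a where "{a, a} \<in> E" using adj by blast
      then show False using E vertex_pairs_iff[of a a V] by blast
    qed
    moreover have "X \<subseteq> V" using X(1) D W'(1) W by auto
    moreover have "good \<subseteq> N" by (auto simp: good_def)
    then have "Y \<subseteq> V" using Y(1) N by auto
    ultimately show False using free X Y unfolding biclique_free_def by blast
  qed
  also have "\<dots> = 2 ^ M * d" using fin W' by (simp add: card_Pow)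
  finally have "card good * M \<le> 2 ^ M * d * M" by simp
  with mle large(2) show False unfolding M_def by simp
qed

definition endpoints :: "'a set set \<Rightarrow> 'a set" where
  "endpoints S = {x. \<exists>y. {x, y} \<in> S}"

text \<open>\<open>S\<close> is any family of sets. Only members with at most two elements have the
  form \<open>{x, y}\<close>, and each of them contributes at most two endpoints.\<close>

lemma card_endpoints:
  assumes "finite S"
  shows "finite (endpoints S)" "card (endpoints S) \<le> 2 * card S"
proof -
  let ?P = "{e \<in> S. finite e \<and> card e \<le> 2}"
  have sub: "endpoints S \<subseteq> \<Union>?P"
  proof
    fix x assume "x \<in> endpoints S"
    then obtain y where "{x, y} \<in> S" unfolding endpoints_def by blast
    moreover have "card {x, y} \<le> 2" by (cases "x = y") auto
    ultimately show "x \<in> \<Union>?P" by blast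
  qed
  have fin: "finite (\<Union>?P)" using assms by auto
  show "finite (endpoints S)" using sub fin by (rule finite_subset)
  have "card (endpoints S) \<le> card (\<Union>?P)" using fin sub by (rule card_mono)
  also have "\<dots> \<le> (\<Sum>e\<in>?P. card e)" using card_UN_le[of ?P "\<lambda>e. e"] assms by simp
  also have "\<dots> \<le> (\<Sum>e\<in>?P. 2)" by (rule sum_mono) auto
  also have "\<dots> \<le> 2 * card S" using assms by (simp add: card_mono)
  finally show "card (endpoints S) \<le> 2 * card S" .
qed

section \<open>Search states, conflicts and candidates\<close>

locale search =
  fixes n k g :: nat and E H :: "nat set set"
begin

definition blue :: "nat set set \<Rightarrow> nat set set" where
  "blue S = (E \<union> S) \<inter> H"

definition conflict :: "nat set set \<Rightarrow> nat \<Rightarrow> nat \<Rightarrow> bool" where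
  "conflict S u v \<longleftrightarrow>
     {u, v} \<in> H \<and> {u, v} \<notin> blue S \<and> \<not> (\<exists>w<n. {u, w} \<in> blue S \<and> {w, v} \<in> blue S)"

definition cnbhd :: "nat set set \<Rightarrow> nat \<Rightarrow> nat set" where
  "cnbhd S u = {v. v < n \<and> conflict S u v}"

definition high :: "nat set set \<Rightarrow> nat \<Rightarrow> bool" where
  "high S u \<longleftrightarrow> g \<le> card (cnbhd S u)"

definition touched :: "nat set set \<Rightarrow> nat \<Rightarrow> bool" where
  "touched S u \<longleftrightarrow> cnbhd S u \<noteq> {}"

definition same_type :: "nat set set \<Rightarrow> nat \<Rightarrow> nat \<Rightarrow> bool" where
  "same_type S w w' \<longleftrightarrow>
     (\<forall>t<n. touched S t \<longrightarrow> ({t, w} \<in> blue S \<longleftrightarrow> {t, w'} \<in> blue S) \<and> ({t, w} \<in> H \<longleftrightarrow> {t, w'} \<in> H))"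

text \<open>Untouched vertices are represented by the least index of their type, a choice that loops
  can test.\<close>

definition repr :: "nat set set \<Rightarrow> nat \<Rightarrow> bool" where
  "repr S w \<longleftrightarrow> (\<forall>w'<w. touched S w' \<or> \<not> same_type S w w')"

text \<open>
  The edges to branch over. If \<open>u\<close> has many conflicts, one of the at most \<open>k\<close> chosen edges \<open>uw\<close>
  must resolve a \<open>1/k\<close> fraction of those that no chosen edge touches at their other end. If there
  is no such \<open>u\<close>, then few vertices are in conflict, and it suffices to try one of the remaining
  vertices per adjacency pattern.
\<close>

definition cand :: "nat set set \<Rightarrow> nat \<Rightarrow> nat \<Rightarrow> bool" where
  "cand S u w \<longleftrightarrow> u < n \<and> w < n \<and> {u, w} \<in> H \<and> {u, w} \<notin> blue S \<and>
     (high S u \<and> card (cnbhd S u) \<le> k * card {v \<in> cnbhd S u. {w, v} \<in> E} + 2 * k \<or>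
      (\<forall>x<n. \<not> high S x) \<and> touched S u \<and> (touched S w \<or> repr S w))"

definition cands :: "nat set set \<Rightarrow> (nat \<times> nat) set" where
  "cands S = {(u, w). cand S u w}"

definition solved :: "nat set set \<Rightarrow> bool" where
  "solved S \<longleftrightarrow> (\<forall>u<n. \<forall>v<n. \<not> conflict S u v)"

end

text \<open>\<open>search\<close> makes no assumptions, so that the program can be described without
  them; they enter here, where the branching is shown to be correct.\<close>

locale graphs = search +
  fixes d :: nat
  assumes E: "E \<subseteq> vertex_pairs {..<n}" and H: "H \<subseteq> vertex_pairs {..<n}"
    and free: "biclique_free d {..<n} E"
begin

lemma H_D: "{u, v} \<in> H \<Longrightarrow> u < n \<and> v < n \<and> u \<noteq> v"
  using H vertex_pairs_iff[of u v "{..<n}"] by auto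

lemma conflict_D: "conflict S u v \<Longrightarrow> u < n \<and> v < n \<and> u \<noteq> v"
  unfolding conflict_def using H_D by blast

lemma solved_iff: "solved S \<longleftrightarrow> spanner2 (E \<union> S) H"
proof -
  have "spanner2 (E \<union> S) H \<longleftrightarrow> (\<forall>u v. \<not> conflict S u v)"
    unfolding spanner2_def conflict_def blue_def using H_D by blast
  also have "\<dots> \<longleftrightarrow> solved S" unfolding solved_def using conflict_D by blast
  finally show ?thesis by simp
qed

lemma blue_mono: "S \<subseteq> S' \<Longrightarrow> blue S \<subseteq> blue S'"
  by (auto simp: blue_def)

lemma conflict_antimono: "S \<subseteq> S' \<Longrightarrow> conflict S' u v \<Longrightarrow> conflict S u v"
  unfolding conflict_def using blue_mono[of S S'] by blast

lemma solved_mono: "S \<subseteq> S' \<Longrightarrow> solved S \<Longrightarrow> solved S'"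
  unfolding solved_def using conflict_antimono by blast

lemma conflict_sym: "conflict S u v \<Longrightarrow> conflict S v u"
  unfolding conflict_def by (metis insert_commute)

lemma touched_iff: "touched S u \<longleftrightarrow> (\<exists>v. conflict S u v)"
  unfolding touched_def cnbhd_def using conflict_D by blast

lemma touched_less: "touched S u \<Longrightarrow> u < n"
  using touched_iff conflict_D by blast

lemma finite_cnbhd [simp]: "finite (cnbhd S u)"
  unfolding cnbhd_def by simp

text \<open>A conflict of \<open>S\<close> that \<open>S'\<close> resolves needs a new edge. The
  outcomes are asymmetric: the last one says that the edge at \<open>u\<close> is old. A partner
  \<open>v\<close> touched by no edge of \<open>S'\<close> leaves only the second outcome.\<close>

lemma conflict_resolved:
  assumes "conflict S u v" "S \<subseteq> S'" "solved S'"
  obtains "{u, v} \<in> S' - S"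
    | w where "w < n" "{u, w} \<in> blue S' - blue S" "{w, v} \<in> blue S'"
    | w where "w < n" "{v, w} \<in> blue S' - blue S" "{u, w} \<in> blue S"
proof -
  have "\<not> conflict S' u v" using assms(1,3) conflict_D[of S u v] unfolding solved_def by blast
  then consider "{u, v} \<in> blue S'" | w where "w < n" "{u, w} \<in> blue S'" "{w, v} \<in> blue S'"
    using assms(1) unfolding conflict_def by blast
  then show ?thesis
  proof cases
    case 1
    then have "{u, v} \<in> S' - S" using assms(1) unfolding conflict_def blue_def by blast
    then show ?thesis using that by blast
  next
    case (2 w)
    then have "{u, w} \<notin> blue S \<or> {w, v} \<notin> blue S" using assms(1) unfolding conflict_def by blast
    then show ?thesis
    proof
      assume "{u, w} \<notin> blue S"
      then show ?thesis using that(2)[of w] 2 by blast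
    next
      assume wv: "{w, v} \<notin> blue S"
      show ?thesis
      proof (cases "{u, w} \<in> blue S")
        case True
        moreover have "{v, w} \<in> blue S' - blue S" using wv 2(3) by (simp add: insert_commute)
        ultimately show ?thesis using that(3)[of w] 2(1) by blast
      next
        case False
        then show ?thesis using that(2)[of w] 2 by blast
      qed
    qed
  qed
qed

lemma blue_diff: "e \<in> blue S' - blue S \<Longrightarrow> e \<in> S' - S \<and> e \<in> H \<and> e \<notin> E"
  by (auto simp: blue_def)

lemma conflict_endpoints:
  assumes "conflict S u v" "S \<subseteq> S'" "solved S'"
  shows "u \<in> endpoints S' \<or> v \<in> endpoints S'"
  using assms
proof (rule conflict_resolved)
  assume "{u, v} \<in> S' - S"
  then show ?thesis by (auto simp: endpoints_def)
next
  fix w assume "{u, w} \<in> blue S' - blue S"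
  from blue_diff[OF this] show ?thesis by (auto simp: endpoints_def)
next
  fix w assume "{v, w} \<in> blue S' - blue S"
  from blue_diff[OF this] show ?thesis by (auto simp: endpoints_def)
qed

lemma conflict_new_edge:
  assumes "conflict S u v" "S \<subseteq> S'" "solved S'"
  shows "\<exists>a w. touched S a \<and> {a, w} \<in> blue S' - blue S"
  using assms
proof (rule conflict_resolved)
  assume "{u, v} \<in> S' - S"
  then have "{u, v} \<in> blue S' - blue S" using assms(1) by (auto simp: conflict_def blue_def)
  then show ?thesis using assms(1) touched_iff by blast
qed (use assms(1) conflict_sym touched_iff in blast)+

text \<open>Were \<open>u\<close> not an endpoint, all of its more than \<open>2 * k\<close>
  conflict partners would be. For the candidate, the partners outside \<open>endpoints S'\<close>
  are distributed over the at most \<open>k\<close> new edges at \<open>u\<close>.\<close>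

lemma high_new_edge:
  assumes "S \<subseteq> S'" "finite S'" "card S' \<le> k" "solved S'" and u: "u < n" "high S u" "2 * k < g"
  shows "u \<in> endpoints S'" "\<exists>w. cand S u w \<and> {u, w} \<in> S' - S"
proof -
  let ?N = "cnbhd S u" and ?X = "endpoints S'"
  have X: "finite ?X" "card ?X \<le> 2 * k" using card_endpoints[OF assms(2)] assms(3) by auto
  have cN: "2 * k < card ?N" using u by (simp add: high_def)
  have NX: "card (?N \<inter> ?X) \<le> 2 * k" using X by (meson card_mono inf_le2 le_trans)
  have "\<not> ?N \<subseteq> ?X" using cN NX by (metis inf.absorb1 not_less)
  then show "u \<in> ?X" using conflict_endpoints[OF _ assms(1,4)] unfolding cnbhd_def by blast
  define P where "P = {w. w < n \<and> {u, w} \<in> blue S' - blue S}"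
  have cP: "card P \<le> k"
  proof -
    have "card P \<le> card S'"
    proof (rule card_inj_on_le[where f = "\<lambda>w. {u, w}"])
      show "inj_on (\<lambda>w. {u, w}) P" by (auto simp: inj_on_def doubleton_eq_iff)
      show "(\<lambda>w. {u, w}) ` P \<subseteq> S'" unfolding P_def using blue_diff by blast
    qed fact
    then show ?thesis using assms(3) by simp
  qed
  let ?Q = "\<lambda>w. {v \<in> ?N. {w, v} \<in> E}"
  have "?N - ?X \<subseteq> (\<Union>w\<in>P. ?Q w)"
  proof
    fix v assume v: "v \<in> ?N - ?X"
    then have c: "conflict S u v" by (simp add: cnbhd_def)
    show "v \<in> (\<Union>w\<in>P. ?Q w)"
      using c assms(1,4)
    proof (rule conflict_resolved)
      assume "{u, v} \<in> S' - S"
      then have "v \<in> ?X" unfolding endpoints_def by (metis (mono_tags) Diff_iff insert_commute mem_Collect_eq)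
      then show ?thesis using v by simp
    next
      fix w assume w: "w < n" "{u, w} \<in> blue S' - blue S" "{w, v} \<in> blue S'"
      \<comment> \<open>\<open>v\<close> is no endpoint, so \<open>wv\<close> was not chosen and
        must come from \<open>E\<close>.\<close>
      have "{w, v} \<notin> S'" using v unfolding endpoints_def by (metis (mono_tags) Diff_iff insert_commute mem_Collect_eq)
      then have "{w, v} \<in> E" using w(3) by (simp add: blue_def)
      then show ?thesis using w v unfolding P_def by blast
    next
      fix w assume "{v, w} \<in> blue S' - blue S"
      then have "v \<in> ?X" unfolding endpoints_def using blue_diff by blast
      then show ?thesis using v by simp
    qed
  qed
  then have "card (?N - ?X) \<le> card (\<Union>w\<in>P. ?Q w)" by (intro card_mono) (auto simp: P_def)
  also have "\<dots> \<le> (\<Sum>w\<in>P. card (?Q w))" by (rule card_UN_le) (simp add: P_def)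
  finally have sum: "card (?N - ?X) \<le> (\<Sum>w\<in>P. card (?Q w))" .
  have "card ?N = card (?N \<inter> ?X) + card (?N - ?X)" by (simp add: card_Int_Diff)
  then have N2: "card ?N \<le> 2 * k + card (?N - ?X)" using NX by simp
  \<comment> \<open>Averaging: if every \<open>w\<close> in \<open>P\<close> fell short, then
    \<open>k\<close> times the sum would be less than \<open>k * (card ?N - 2 * k)\<close>, against
    the lower bound just found. Strictness needs \<open>P\<close> to be nonempty; an empty
    \<open>P\<close> would leave at most \<open>2 * k\<close> partners.\<close>
  have "\<exists>w\<in>P. card ?N \<le> k * card (?Q w) + 2 * k"
  proof (rule ccontr)
    assume "\<not> ?thesis"
    then have lt: "\<And>w. w \<in> P \<Longrightarrow> k * card (?Q w) + 2 * k < card ?N" by auto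
    have "P \<noteq> {}"
    proof
      assume "P = {}"
      then have "card (?N - ?X) = 0" using sum by (simp only: sum.empty UN_empty le_zero_eq)
      then show False using N2 cN by linarith
    qed
    moreover have finP: "finite P" by (simp add: P_def)
    ultimately have "(\<Sum>w\<in>P. k * card (?Q w)) < (\<Sum>w\<in>P. card ?N - 2 * k)"
      by (intro sum_strict_mono) (use lt in force)+
    also have "\<dots> = card P * (card ?N - 2 * k)" by simp
    also have "\<dots> \<le> k * (card ?N - 2 * k)" using cP by simp
    also have "\<dots> \<le> k * card (?N - ?X)" using N2 by (intro mult_le_mono2) linarith
    also have "\<dots> \<le> (\<Sum>w\<in>P. k * card (?Q w))" using sum by (simp add: sum_distrib_left[symmetric])
    finally show False by simp
  qed
  then obtain w where "w \<in> P" "card ?N \<le> k * card (?Q w) + 2 * k" by blast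
  moreover from this have "w < n" "{u, w} \<in> S' - S" "{u, w} \<in> H" "{u, w} \<notin> blue S"
    using blue_diff[of "{u, w}" S' S] unfolding P_def by blast+
  ultimately show "\<exists>w. cand S u w \<and> {u, w} \<in> S' - S"
    using u unfolding cand_def by (intro exI[of _ w]) simp
qed

text \<open>All high vertices are endpoints of the solution \<open>S'\<close>, which leaves
  \<open>2 * k\<close> choices of \<open>u\<close>; \<open>heavy_card\<close> leaves
  \<open>2 * k * d\<close> choices of \<open>w\<close> for each.\<close>

lemma card_cands_high:
  assumes "S \<subseteq> S'" "finite S'" "card S' \<le> k" "solved S'" and "x < n" "high S x"
    and g: "2 * k < g" "4 * k \<le> g" "2 ^ (2 * k * d) * d * (2 * k * d) < g"
  shows "card (cands S) \<le> 2 * k * (2 * k * d)"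
proof -
  let ?U = "{u. u < n \<and> high S u}"
  let ?W = "\<lambda>u. {w. w < n \<and> card (cnbhd S u) \<le> k * card {v \<in> cnbhd S u. {w, v} \<in> E} + 2 * k}"
  have "?U \<subseteq> endpoints S'" using high_new_edge(1)[OF assms(1-4) _ _ g(1)] by blast
  then have U: "card ?U \<le> 2 * k"
    using card_endpoints[OF assms(2)] assms(3) card_mono by (metis (no_types, lifting) le_trans mult_le_mono2)
  have "cands S \<subseteq> Sigma ?U ?W"
    using assms(5,6) unfolding cands_def cand_def by blast
  then have "card (cands S) \<le> card (Sigma ?U ?W)" by (intro card_mono) auto
  also have "\<dots> = (\<Sum>u\<in>?U. card (?W u))" by (simp add: card_SigmaI)
  also have "\<dots> \<le> (\<Sum>u\<in>?U. 2 * k * d)"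
  proof (rule sum_mono)
    fix u assume "u \<in> ?U"
    then have "g \<le> card (cnbhd S u)" by (simp add: high_def)
    then show "card (?W u) \<le> 2 * k * d"
      using g by (intro heavy_card[OF free E, of _ "cnbhd S u"]) (auto simp: cnbhd_def)
  qed
  also have "\<dots> \<le> 2 * k * (2 * k * d)" using U by (simp add: mult_le_mono1)
  finally show ?thesis .
qed

text \<open>A touched vertex is an endpoint of the solution or one of the fewer than
  \<open>g\<close> partners of an endpoint, which gives \<open>\<tau>\<close>. An untouched
  representative is determined by two subsets of the touched vertices, hence the factor
  \<open>2 ^ \<tau> * 2 ^ \<tau>\<close>.\<close>

lemma card_cands_low:
  assumes "S \<subseteq> S'" "finite S'" "card S' \<le> k" "solved S'" and low: "\<And>x. x < n \<Longrightarrow> \<not> high S x"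
  defines "\<tau> \<equiv> 2 * k + 2 * k * g"
  shows "card (cands S) \<le> \<tau> * (\<tau> + 2 ^ \<tau> * 2 ^ \<tau>)"
proof -
  let ?X = "endpoints S'" and ?T = "{u. touched S u}"
  let ?R = "{w. w < n \<and> \<not> touched S w \<and> repr S w}"
  have X: "finite ?X" "card ?X \<le> 2 * k" using card_endpoints[OF assms(2)] assms(3) by auto
  \<comment> \<open>\<open>S'\<close> may contain arbitrary sets, so its endpoints need not be
    vertices, while \<open>low\<close> speaks of vertices only.\<close>
  let ?Y = "{x \<in> ?X. x < n}"
  have Y: "finite ?Y" "card ?Y \<le> 2 * k" using X card_mono[of ?X ?Y] by auto
  have "?T \<subseteq> ?X \<union> (\<Union>x\<in>?Y. cnbhd S x)"
  proof
    fix u assume "u \<in> ?T"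
    then obtain v where uv: "conflict S u v" using touched_iff by auto
    then have "u \<in> ?X \<or> v \<in> ?X" using conflict_endpoints assms by blast
    then show "u \<in> ?X \<union> (\<Union>x\<in>?Y. cnbhd S x)"
      using conflict_sym[OF uv] conflict_D[OF uv] unfolding cnbhd_def by blast
  qed
  then have "card ?T \<le> card (?X \<union> (\<Union>x\<in>?Y. cnbhd S x))" using X by (intro card_mono) auto
  also have "\<dots> \<le> card ?X + card (\<Union>x\<in>?Y. cnbhd S x)" by (rule card_Un_le)
  also have "card (\<Union>x\<in>?Y. cnbhd S x) \<le> (\<Sum>x\<in>?Y. card (cnbhd S x))" using Y by (intro card_UN_le)
  also have "\<dots> \<le> (\<Sum>x\<in>?Y. g)" using low by (intro sum_mono) (auto simp: high_def not_le intro: less_imp_le)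
  also have "\<dots> \<le> 2 * k * g" using Y by (simp add: mult_le_mono1)
  finally have T: "card ?T \<le> \<tau>" using X unfolding \<tau>_def by simp
  have finT: "finite ?T" using touched_less by (metis (mono_tags) finite_Collect_less_nat finite_subset mem_Collect_eq subsetI)
  have "card ?R \<le> card (Pow ?T \<times> Pow ?T)"
  proof (rule card_inj_on_le[where f = "\<lambda>w. ({t \<in> ?T. {t, w} \<in> blue S}, {t \<in> ?T. {t, w} \<in> H})"])
    show "inj_on (\<lambda>w. ({t \<in> ?T. {t, w} \<in> blue S}, {t \<in> ?T. {t, w} \<in> H})) ?R"
    proof (rule inj_onI)
      fix w w' assume w: "w \<in> ?R" "w' \<in> ?R"
        and eq: "({t \<in> ?T. {t, w} \<in> blue S}, {t \<in> ?T. {t, w} \<in> H}) =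
                 ({t \<in> ?T. {t, w'} \<in> blue S}, {t \<in> ?T. {t, w'} \<in> H})"
      have "same_type S w w'" "same_type S w' w" using eq unfolding same_type_def by auto
      then have "\<not> w < w'" "\<not> w' < w" using w unfolding repr_def by blast+
      then show "w = w'" by simp
    qed
  qed (use finT in auto)
  also have "\<dots> = 2 ^ card ?T * 2 ^ card ?T" using finT by (simp add: card_cartesian_product card_Pow)
  also have "\<dots> \<le> 2 ^ \<tau> * 2 ^ \<tau>" using T by (intro mult_le_mono) auto
  finally have R: "card ?R \<le> 2 ^ \<tau> * 2 ^ \<tau>" .
  have "cands S \<subseteq> ?T \<times> (?T \<union> ?R)" using low unfolding cands_def cand_def by blast
  then have "card (cands S) \<le> card (?T \<times> (?T \<union> ?R))" using finT by (intro card_mono) auto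
  also have "\<dots> \<le> card ?T * (card ?T + card ?R)"
    by (simp add: card_cartesian_product card_Un_le mult_le_mono2)
  also have "\<dots> \<le> \<tau> * (\<tau> + 2 ^ \<tau> * 2 ^ \<tau>)" using T R by (intro mult_le_mono add_mono)
  finally show ?thesis .
qed

section \<open>Exchanging vertices of the same type\<close>

text \<open>Only edges not yet chosen are moved, since \<^const>\<open>same_type\<close> already accounts for the chosen ones.\<close>

lemma swap_solution:
  assumes "S \<subseteq> S'" "solved S'" and w: "\<not> touched S w" "\<not> touched S w'" "same_type S w w'"
    and "w < n" "w' < n"
  defines "\<pi> \<equiv> transpose w w'"
  shows "solved (S \<union> (`) \<pi> ` (S' - S))"
proof -
  let ?S = "S \<union> (`) \<pi> ` (S' - S)"
  have blue_\<pi>: "{t, \<pi> x} \<in> blue ?S" if t: "touched S t" and b: "{t, x} \<in> blue S'" for t x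
  proof -
    have "t \<noteq> w" "t \<noteq> w'" using t w by blast+
    then have t_fix: "\<pi> t = t" unfolding \<pi>_def by simp
    \<comment> \<open>Trivial unless \<open>x\<close> is \<open>w\<close> or \<open>w'\<close>,
      where it is \<open>same_type\<close> at the touched vertex \<open>t\<close>.\<close>
    have ty: "{t, x} \<in> blue S \<longleftrightarrow> {t, \<pi> x} \<in> blue S" "{t, x} \<in> H \<longleftrightarrow> {t, \<pi> x} \<in> H"
      using w(3) t touched_less[OF t] unfolding same_type_def \<pi>_def transpose_def by auto
    show ?thesis
    proof (cases "{t, x} \<in> blue S")
      case True
      then show ?thesis using ty(1) blue_mono[of S ?S] by blast
    next
      case False
      then have d: "{t, x} \<in> S' - S" "{t, x} \<in> H" using b blue_diff by blast+
      then have "\<pi> ` {t, x} \<in> ?S" by blast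
      then have "{t, \<pi> x} \<in> ?S" using t_fix by simp
      then show ?thesis using ty(2) d(2) unfolding blue_def by blast
    qed
  qed
  show ?thesis unfolding solved_def
  proof (intro allI impI notI)
    fix u v assume "u < n" "v < n" and c: "conflict ?S u v"
    \<comment> \<open>A conflict left over is one of \<open>S\<close>, so both of its ends are
      touched and fixed by \<open>\<pi>\<close>. The image of whatever resolved it in
      \<open>S'\<close> resolves it again.\<close>
    then have cS: "conflict S u v" using conflict_antimono by blast
    then have t: "touched S u" "touched S v" using touched_iff conflict_sym by blast+
    then have "u \<noteq> w" "u \<noteq> w'" "v \<noteq> w" "v \<noteq> w'" using w by blast+
    then have fixed: "\<pi> u = u" "\<pi> v = v" unfolding \<pi>_def by simp_all
    have "\<not> conflict S' u v" using assms(2) \<open>u < n\<close> \<open>v < n\<close> unfolding solved_def by blast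
    then consider "{u, v} \<in> blue S'" | x where "x < n" "{u, x} \<in> blue S'" "{x, v} \<in> blue S'"
      using cS unfolding conflict_def by blast
    then show False
    proof cases
      case 1
      then have "{u, v} \<in> blue ?S" using blue_\<pi>[OF t(1), of v] fixed by simp
      then show False using c unfolding conflict_def by blast
    next
      case (2 x)
      have "{u, \<pi> x} \<in> blue ?S" using blue_\<pi>[OF t(1)] 2 by blast
      moreover have "{\<pi> x, v} \<in> blue ?S" using blue_\<pi>[OF t(2), of x] 2 by (metis insert_commute)
      moreover have "\<pi> x < n" using 2(1) assms(6,7) unfolding \<pi>_def transpose_def by auto
      ultimately show False using c unfolding conflict_def by blast
    qed
  qed
qed

text \<open>The least untouched vertex of the type will do, since \<open>same_type\<close> is
  transitive.\<close>

lemma same_type_repr: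
  assumes "\<not> touched S w"
  obtains w' where "w' \<le> w" "\<not> touched S w'" "same_type S w w'" "repr S w'"
proof -
  let ?P = "\<lambda>w'. \<not> touched S w' \<and> same_type S w w'"
  have P: "?P w" using assms by (simp add: same_type_def)
  have "repr S (LEAST w'. ?P w')" unfolding repr_def
  proof (intro allI impI)
    fix x assume x: "x < (LEAST w'. ?P w')"
    then have "\<not> ?P x" by (rule not_less_Least)
    moreover have "same_type S w (LEAST w'. ?P w')" using LeastI[of ?P, OF P] by blast
    ultimately show "touched S x \<or> \<not> same_type S (LEAST w'. ?P w') x"
      unfolding same_type_def by blast
  qed
  then show ?thesis using that LeastI[of ?P, OF P] Least_le[of ?P, OF P] by blast
qed

text \<open>The new edge of \<open>S'\<close> at a touched vertex may end in an untouched vertex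
  that is no representative. Then the solution itself is exchanged, for one that is still within the
  budget and has no more edges outside \<open>S\<close>.\<close>

lemma low_new_edge:
  assumes "S \<subseteq> S'" "finite S'" "card S' \<le> k" "solved S'" "\<not> solved S"
    and low: "\<And>x. x < n \<Longrightarrow> \<not> high S x"
  shows "\<exists>u w S''. cand S u w \<and> {u, w} \<in> S'' - S \<and> S \<subseteq> S'' \<and> finite S'' \<and> card S'' \<le> k \<and> solved S'' \<and>
    card (S'' - S) \<le> card (S' - S)"
proof -
  obtain u v where "conflict S u v" using assms(5) unfolding solved_def by blast
  then obtain a w where a: "touched S a" "{a, w} \<in> blue S' - blue S"
    using conflict_new_edge assms by blast
  have aw: "{a, w} \<in> S' - S" "{a, w} \<in> H" "a < n" "w < n" using blue_diff[OF a(2)] H_D by blast+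
  show ?thesis
  proof (cases "touched S w")
    case True
    then have "cand S a w" unfolding cand_def using a aw low by blast
    then show ?thesis using assms(1-4) aw(1) by (intro exI[of _ a] exI[of _ w] exI[of _ S']) simp
  next
    case False
    then obtain w' where w': "w' \<le> w" "\<not> touched S w'" "same_type S w w'" "repr S w'"
      by (rule same_type_repr)
    define \<pi> where "\<pi> = transpose w w'"
    let ?S = "S \<union> (`) \<pi> ` (S' - S)"
    have "{a, w'} \<notin> blue S" "{a, w'} \<in> H" using w'(3) a aw unfolding same_type_def by blast+
    moreover have "w' < n" using w'(1) aw(4) by simp
    ultimately have cand: "cand S a w'" "{a, w'} \<notin> S"
      unfolding cand_def using a(1) aw(3) low w'(4) by (blast, simp add: blue_def)
    have "a \<noteq> w" "a \<noteq> w'" using a(1) False w'(2) by blast+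
    then have "\<pi> a = a" "\<pi> w = w'" unfolding \<pi>_def by simp_all
    then have "\<pi> ` {a, w} = {a, w'}" by simp
    then have mem: "{a, w'} \<in> ?S" using aw(1) by (metis UnI2 image_eqI)
    have sol: "solved ?S" unfolding \<pi>_def
      by (rule swap_solution[OF assms(1,4) False w'(2,3) aw(4) \<open>w' < n\<close>])
    have fin: "finite S" "finite (S' - S)" using assms(1,2) by (auto intro: finite_subset)
    have c1: "card (?S - S) \<le> card (S' - S)"
    proof -
      have "card (?S - S) \<le> card ((`) \<pi> ` (S' - S))" using fin by (intro card_mono) auto
      also have "\<dots> \<le> card (S' - S)" using fin by (intro card_image_le)
      finally show ?thesis .
    qed
    have "card ?S \<le> k"
    proof -
      have "card ?S \<le> card S + card ((`) \<pi> ` (S' - S))" by (rule card_Un_le)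
      also have "\<dots> \<le> card S + card (S' - S)" using fin by (simp add: card_image_le)
      also have "\<dots> = card S'" using assms(1,2) by (simp add: card_Diff_subset card_mono finite_subset)
      finally show ?thesis using assms(3) by simp
    qed
    with mem sol fin c1 cand show ?thesis by (intro exI[of _ a] exI[of _ w'] exI[of _ ?S]) simp
  qed
qed

text \<open>One round of branching. The strictly falling number of missing edges limits the search
  to \<open>k\<close> rounds.\<close>

lemma new_edge:
  assumes "S \<subseteq> S'" "finite S'" "card S' \<le> k" "solved S'" "\<not> solved S" "2 * k < g"
  shows "\<exists>u w S''. cand S u w \<and> insert {u, w} S \<subseteq> S'' \<and> finite S'' \<and> card S'' \<le> k \<and> solved S'' \<and>
    card (S'' - insert {u, w} S) < card (S' - S)"
proof -
  obtain u w S'' where *: "cand S u w" "{u, w} \<in> S'' - S" "S \<subseteq> S''" "finite S''" "card S'' \<le> k" "solved S''"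
    "card (S'' - S) \<le> card (S' - S)"
  proof (cases "\<exists>u<n. high S u")
    case True
    then show ?thesis using high_new_edge(2)[OF assms(1-4) _ _ assms(6)] assms that by blast
  next
    case False
    then show ?thesis using low_new_edge[OF assms(1-5)] that by blast
  qed
  have "S'' - insert {u, w} S \<subset> S'' - S" using *(2) by blast
  then have "card (S'' - insert {u, w} S) < card (S'' - S)" using *(4) by (intro psubset_card_mono) auto
  then show ?thesis using * by (intro exI[of _ u] exI[of _ w] exI[of _ S'']) auto
qed

end

section \<open>The search tree\<close>

context search
begin

text \<open>Position in the lexicographic order of the candidates, defined by counting so that it
  can be evaluated without building a list.\<close>

definition rank :: "nat set set \<Rightarrow> nat \<Rightarrow> nat \<Rightarrow> nat" where
  "rank S u w = card {(a, b). cand S a b \<and> (a < u \<or> a = u \<and> b < w)}"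

text \<open>Distinct candidates have distinct ranks, so at most one summand meets its condition and
  the sum acts as a selection.\<close>

definition pick_u :: "nat set set \<Rightarrow> nat \<Rightarrow> nat" where
  "pick_u S r = (\<Sum>u<n. \<Sum>w<n. if cand S u w \<and> rank S u w = r then u else 0)"

definition pick_w :: "nat set set \<Rightarrow> nat \<Rightarrow> nat" where
  "pick_w S r = (\<Sum>u<n. \<Sum>w<n. if cand S u w \<and> rank S u w = r then w else 0)"

text \<open>
  The base-\<open>F\<close> digits of \<open>z\<close> are the choices made along one branch of the search. A digit that is
  not the rank of any candidate adds \<open>{0}\<close>, which is not an edge of any graph and hence harmless.
\<close>

primrec branch :: "nat \<Rightarrow> nat \<Rightarrow> nat \<Rightarrow> nat set set" where
  "branch F z 0 = {}"
| "branch F z (Suc i) =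
     (let S = branch F z i; r = z div F ^ i mod F in insert {pick_u S r, pick_w S r} S)"

lemma cands_subset: "cands S \<subseteq> {..<n} \<times> {..<n}"
  unfolding cands_def cand_def by auto

lemma finite_cands: "finite (cands S)"
  using cands_subset by (rule finite_subset) simp

lemma rank_mono:
  assumes "cand S u w" "u < u' \<or> u = u' \<and> w < w'"
  shows "rank S u w < rank S u' w'"
  unfolding rank_def
proof (rule psubset_card_mono)
  show "finite {(a, b). cand S a b \<and> (a < u' \<or> a = u' \<and> b < w')}"
    using finite_cands[of S] by (rule finite_subset[rotated]) (auto simp: cands_def)
  have "(u, w) \<in> {(a, b). cand S a b \<and> (a < u' \<or> a = u' \<and> b < w')}"
    "(u, w) \<notin> {(a, b). cand S a b \<and> (a < u \<or> a = u \<and> b < w)}" using assms by auto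
  moreover have "{(a, b). cand S a b \<and> (a < u \<or> a = u \<and> b < w)}
    \<subseteq> {(a, b). cand S a b \<and> (a < u' \<or> a = u' \<and> b < w')}" using assms(2) by auto
  ultimately show "{(a, b). cand S a b \<and> (a < u \<or> a = u \<and> b < w)}
    \<subset> {(a, b). cand S a b \<and> (a < u' \<or> a = u' \<and> b < w')}" by blast
qed

lemma rank_inj:
  assumes "cand S u w" "cand S u' w'" "rank S u w = rank S u' w'"
  shows "u = u' \<and> w = w'"
  using rank_mono[OF assms(1), of u' w'] rank_mono[OF assms(2), of u w] assms(3)
  by (metis less_irrefl linorder_neqE_nat)

lemma rank_less:
  assumes "cand S u w"
  shows "rank S u w < card (cands S)"
  unfolding rank_def
proof (rule psubset_card_mono[OF finite_cands])
  have "(u, w) \<in> cands S" using assms by (simp add: cands_def)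
  then show "{(a, b). cand S a b \<and> (a < u \<or> a = u \<and> b < w)} \<subset> cands S"
    unfolding cands_def by auto
qed

lemma sum_pick:
  fixes f :: "nat \<Rightarrow> nat \<Rightarrow> nat"
  assumes "cand S u w"
  shows "(\<Sum>a<n. \<Sum>b<n. if cand S a b \<and> rank S a b = rank S u w then f a b else 0) = f u w"
proof -
  have un: "u < n" "w < n" using assms by (auto simp: cand_def)
  have iff: "cand S a b \<and> rank S a b = rank S u w \<longleftrightarrow> a = u \<and> b = w" for a b
    using rank_inj[OF _ assms] assms by blast
  have "(\<Sum>a<n. \<Sum>b<n. if cand S a b \<and> rank S a b = rank S u w then f a b else 0) =
      (\<Sum>a<n. \<Sum>b<n. if b = w then if a = u then f u w else 0 else 0)"
    unfolding iff by (intro sum.cong refl) auto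
  also have "\<dots> = f u w" using un by simp
  finally show ?thesis .
qed

lemma pick_rank:
  assumes "cand S u w"
  shows "pick_u S (rank S u w) = u" "pick_w S (rank S u w) = w"
  using sum_pick[OF assms, of "\<lambda>a b. a"] sum_pick[OF assms, of "\<lambda>a b. b"]
  by (simp_all only: pick_u_def pick_w_def)

lemma pick_le: "pick_u S r \<le> n" "pick_w S r \<le> n"
proof -
  have "pick_u S r \<le> n \<and> pick_w S r \<le> n"
  proof (cases "\<exists>u w. cand S u w \<and> rank S u w = r")
    case True
    then obtain u w where uw: "cand S u w" "rank S u w = r" by blast
    then have "u < n" "w < n" by (auto simp: cand_def)
    then show ?thesis using pick_rank[OF uw(1)] uw(2) by simp
  next
    case False
    then have none: "(cand S a b \<and> rank S a b = r) = False" for a b by blast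
    show ?thesis by (simp add: pick_u_def pick_w_def none del: de_Morgan_conj)
  qed
  then show "pick_u S r \<le> n" "pick_w S r \<le> n" by auto
qed

lemma card_branch: "finite (branch F z i)" "card (branch F z i) \<le> i"
  by (induction i) (auto simp: Let_def card_insert_if)

text \<open>The first \<open>i\<close> choices read only the lowest \<open>i\<close> digits, so
  another digit can be put on top without disturbing them.\<close>

lemma branch_cong:
  assumes "\<And>j. j < i \<Longrightarrow> z div F ^ j mod F = z' div F ^ j mod F"
  shows "branch F z i = branch F z' i"
  using assms by (induction i) (auto simp: Let_def)

end

context graphs
begin

lemma digit_add:
  fixes F :: nat
  assumes "j < i"
  shows "(z + r * F ^ i) div F ^ j mod F = z div F ^ j mod F"
proof (cases "F = 0")
  case False
  have "i = Suc (i - Suc j) + j" using assms by simp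
  then have "F ^ i = F ^ j * (F * F ^ (i - Suc j))" by (metis power_Suc power_add mult.commute)
  then have "z + r * F ^ i = z + F ^ j * (F * (r * F ^ (i - Suc j)))" by (simp add: ac_simps)
  moreover have "(z + F ^ j * (F * (r * F ^ (i - Suc j)))) div F ^ j = F * (r * F ^ (i - Suc j)) + z div F ^ j"
    using False by (intro div_mult_self2) simp
  ultimately show ?thesis by (simp only: mod_mult_self4)
qed (use assms in \<open>simp add: power_0_left\<close>)

lemma branch_complete:
  assumes "finite S0" "card S0 \<le> k" "solved S0" and g: "2 * k < g" and F: "F > 0"
    and cands: "\<And>S S'. S \<subseteq> S' \<Longrightarrow> finite S' \<Longrightarrow> card S' \<le> k \<Longrightarrow> solved S' \<Longrightarrow> card (cands S) \<le> F"
    and "i \<le> k"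
  shows "\<exists>z<F ^ i. \<exists>S. branch F z i \<subseteq> S \<and> finite S \<and> card S \<le> k \<and> solved S \<and>
    card (S - branch F z i) \<le> k - i"
  using \<open>i \<le> k\<close>
proof (induction i)
  case 0
  then show ?case using assms by (intro exI[of _ 0] conjI) auto
next
  case (Suc i)
  then obtain z S where z: "z < F ^ i" "branch F z i \<subseteq> S" "finite S" "card S \<le> k" "solved S"
    "card (S - branch F z i) \<le> k - i" by auto
  let ?B = "branch F z i"
  show ?case
  proof (cases "solved ?B")
    \<comment> \<open>The next digit still adds a set, but supersets of a solved set are solved. The
      longer branch is then its own solution, of at most \<open>Suc i \<le> k\<close> sets.\<close>
    case True
    have sub: "?B \<subseteq> branch F z (Suc i)" by (auto simp: Let_def)
    have "z < F ^ Suc i" using z(1) F by (metis less_le_trans mult_le_mono1 nat_mult_1 power_Suc Suc_leI One_nat_def)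
    moreover have "card (branch F z (Suc i)) \<le> k" using card_branch(2)[of F z "Suc i"] Suc.prems by linarith
    moreover have "solved (branch F z (Suc i))" using solved_mono[OF sub True] .
    ultimately show ?thesis using card_branch(1)[of F z "Suc i"]
      by (intro exI[of _ z] conjI exI[of _ "branch F z (Suc i)"]) simp_all
  next
    case False
    obtain u w S' where S': "cand ?B u w" "insert {u, w} ?B \<subseteq> S'" "finite S'" "card S' \<le> k" "solved S'"
      "card (S' - insert {u, w} ?B) < card (S - ?B)"
      using new_edge[OF z(2-5) False g] by blast
    define r where "r = rank ?B u w"
    \<comment> \<open>The bound on the candidates makes the rank a legal digit, which
      \<open>z'\<close> carries in position \<open>i\<close>.\<close>
    have r: "r < F" using rank_less[OF S'(1)] cands[OF z(2-5)] by (simp add: r_def)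
    define z' where "z' = z + r * F ^ i"
    have "branch F z' i = ?B" unfolding z'_def by (intro branch_cong digit_add)
    moreover have "z' div F ^ i mod F = r" unfolding z'_def using z(1) r F by simp
    ultimately have "branch F z' (Suc i) = insert {u, w} ?B"
      using pick_rank[OF S'(1)] by (simp add: Let_def r_def)
    moreover have "z' < F ^ Suc i"
    proof -
      have "z' < (r + 1) * F ^ i" using z(1) by (simp add: z'_def)
      also have "\<dots> \<le> F * F ^ i" using r by (intro mult_le_mono1) simp
      finally show ?thesis by simp
    qed
    ultimately show ?thesis using S' z(6) by (intro exI[of _ z'] conjI exI[of _ S']) auto
  qed
qed

text \<open>A branch contains at most \<open>k\<close> sets whatever its digits, so a solved one is
  a solution. The bounds on \<open>g\<close>, \<open>F\<close> and \<open>Z\<close> serve the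
  converse.\<close>

lemma search_correct:
  assumes "2 * k < g" "4 * k \<le> g" "2 ^ (2 * k * d) * d * (2 * k * d) < g"
    and F: "2 * k * (2 * k * d) \<le> F" "F > 0"
      "(2 * k + 2 * k * g) * ((2 * k + 2 * k * g) + 2 ^ (2 * k + 2 * k * g) * 2 ^ (2 * k + 2 * k * g)) \<le> F"
    and Z: "F ^ k \<le> Z"
  shows "(\<exists>z<Z. solved (branch F z k)) \<longleftrightarrow> (\<exists>S. finite S \<and> card S \<le> k \<and> spanner2 (E \<union> S) H)"
proof
  assume "\<exists>z<Z. solved (branch F z k)"
  then obtain z where "solved (branch F z k)" by blast
  then show "\<exists>S. finite S \<and> card S \<le> k \<and> spanner2 (E \<union> S) H"
    using card_branch[of F z k] by (intro exI[of _ "branch F z k"]) (simp add: solved_iff)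
next
  assume "\<exists>S. finite S \<and> card S \<le> k \<and> spanner2 (E \<union> S) H"
  then obtain S0 where S0: "finite S0" "card S0 \<le> k" "solved S0" unfolding solved_iff by blast
  have cands: "card (cands S) \<le> F" if "S \<subseteq> S'" "finite S'" "card S' \<le> k" "solved S'" for S S'
  proof (cases "\<exists>x<n. high S x")
    case True
    then obtain x where "x < n" "high S x" by blast
    from card_cands_high[OF that this assms(1-3)] F(1) show ?thesis by (rule le_trans)
  next
    case False
    then have "\<And>x. x < n \<Longrightarrow> \<not> high S x" by blast
    from card_cands_low[OF that this] F(3) show ?thesis by (rule le_trans)
  qed
  have "\<exists>z<F ^ k. \<exists>S. branch F z k \<subseteq> S \<and> finite S \<and> card S \<le> k \<and> solved S \<and>
    card (S - branch F z k) \<le> k - k"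
    by (rule branch_complete[OF S0 assms(1) F(2) _ le_refl]) (rule cands)
  then obtain z S where z: "z < F ^ k" "branch F z k \<subseteq> S" "finite S" "solved S" "card (S - branch F z k) = 0"
    unfolding diff_self_eq_0 le_zero_eq by blast
  then have "S - branch F z k = {}" by (metis card_0_eq finite_Diff)
  then have "S = branch F z k" using z(2) by blast
  moreover have "z < Z" using z(1) Z by linarith
  ultimately show "\<exists>z<Z. solved (branch F z k)" using z(4) by blast
qed

end

section \<open>Choice of the parameters\<close>

lemma square_bound: "16 \<le> g \<Longrightarrow> g * g + g + 1 \<le> (2::nat) ^ g"
proof (induction g rule: nat_induct_at_least)
  case base
  then show ?case by simp
next
  case (Suc g)
  have "16 * g \<le> g * g" using Suc.hyps by (rule mult_le_mono1)
  then have "3 * g + 3 \<le> g * g" using Suc.hyps by linarith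
  have "Suc g * Suc g + Suc g + 1 = g * g + (3 * g + 3)" by simp
  also have "\<dots> \<le> g * g + g * g" using \<open>3 * g + 3 \<le> g * g\<close> by (rule add_left_mono)
  also have "\<dots> \<le> 2 * (g * g + g + 1)" by simp
  also have "\<dots> \<le> 2 * 2 ^ g" using Suc.IH by simp
  finally show ?case by simp
qed

text \<open>The low case needs about \<open>2 ^ (3 * \<tau> + 1)\<close> candidates, and
  \<open>16 * k \<le> g\<close> puts this exponent below \<open>g * g + g + 1 \<le> 2 ^ g\<close>;
  hence the double exponential \<open>F\<close>. Likewise \<open>F ^ k = 2 ^ (2 ^ g * k)\<close>
  with \<open>2 ^ g * k \<le> F\<close>, so \<open>2 ^ F\<close> branches suffice.\<close>

lemma parameter_bounds:
  fixes k d :: nat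
  defines "g \<equiv> (2 ^ (4 * d + 4)) ^ (k + 1)"
  defines "F \<equiv> 2 ^ (2 ^ g)"
  defines "\<tau> \<equiv> 2 * k + 2 * k * g"
  shows "2 * k < g" "4 * k \<le> g" "2 ^ (2 * k * d) * d * (2 * k * d) < g"
    "2 * k * (2 * k * d) \<le> F" "F > 0" "\<tau> * (\<tau> + 2 ^ \<tau> * 2 ^ \<tau>) \<le> F" "F ^ k \<le> 2 ^ F"
proof -
  have le2: "m \<le> 2 ^ m" for m :: nat by (simp add: less_imp_le)
  have g: "g = 2 ^ ((4 * d + 4) * (k + 1))" unfolding g_def by (simp only: power_mult)
  have "(2::nat) ^ (k + 4) \<le> g" unfolding g by (intro power_increasing) (auto simp: algebra_simps)
  then have k16: "16 * 2 ^ k \<le> g" by (simp add: power_add)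
  then show kg: "2 * k < g" "4 * k \<le> g" using less_exp[of k] by linarith+
  have g16: "16 \<le> g" "16 * k \<le> g" using k16 one_le_power[of "2::nat" k] less_exp[of k] by linarith+
  have sq: "g * g + g + 1 \<le> 2 ^ g" using square_bound[OF g16(1)] .
  have gF: "g \<le> F" unfolding F_def using le2[of g] le2[of "2 ^ g"] by linarith
  show "F > 0" by (simp add: F_def)
  have "2 ^ (2 * k * d) * d * (2 * k * d) \<le> 2 ^ (2 * k * d) * 2 ^ d * 2 ^ (2 * k * d)"
    by (intro mult_le_mono le2 le_refl)
  also have "\<dots> = 2 ^ (4 * k * d + d)" by (simp flip: power_add)
  also have "\<dots> < g" unfolding g by (intro power_strict_increasing) (auto simp: algebra_simps)
  finally show "2 ^ (2 * k * d) * d * (2 * k * d) < g" .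
  have "2 * k * (2 * k * d) \<le> 2 ^ (2 * k) * 2 ^ (2 * k * d)" by (intro mult_le_mono le2)
  also have "\<dots> = 2 ^ (2 * k + 2 * k * d)" by (simp add: power_add)
  also have "\<dots> \<le> g" unfolding g by (intro power_increasing) (auto simp: algebra_simps)
  finally show "2 * k * (2 * k * d) \<le> F" using gF by linarith
  have "16 * k * g \<le> g * g" using g16(2) by (rule mult_le_mono1)
  then have "\<tau> + \<tau> + \<tau> + 1 \<le> g * g + g + 1" unfolding \<tau>_def using g16(2) by linarith
  then have \<tau>: "\<tau> + \<tau> + \<tau> + 1 \<le> 2 ^ g" using sq by linarith
  have "(2::nat) ^ \<tau> \<le> 2 ^ \<tau> * 2 ^ \<tau>" by simp
  then have "\<tau> \<le> 2 ^ \<tau> * 2 ^ \<tau>" using le2[of \<tau>] by linarith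
  then have "\<tau> * (\<tau> + 2 ^ \<tau> * 2 ^ \<tau>) \<le> 2 ^ \<tau> * (2 ^ \<tau> * 2 ^ \<tau> + 2 ^ \<tau> * 2 ^ \<tau>)"
    using le2[of \<tau>] by (intro mult_le_mono add_le_mono le_refl)
  also have "\<dots> = 2 ^ (\<tau> + \<tau> + \<tau> + 1)" by (simp add: power_add)
  also have "\<dots> \<le> F" unfolding F_def using \<tau> by (intro power_increasing) auto
  finally show "\<tau> * (\<tau> + 2 ^ \<tau> * 2 ^ \<tau>) \<le> F" .
  have "16 * g \<le> g * g" using g16(1) by (rule mult_le_mono1)
  then have "g + g \<le> 2 ^ g" using sq by linarith
  have "2 ^ g * k \<le> 2 ^ g * 2 ^ g" using g16(2) le2[of g] by (intro mult_le_mono2) linarith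
  also have "\<dots> = 2 ^ (g + g)" by (simp add: power_add)
  also have "\<dots> \<le> F" unfolding F_def using \<open>g + g \<le> 2 ^ g\<close> by (intro power_increasing) auto
  finally have "2 ^ g * k \<le> F" .
  then have "(2::nat) ^ (2 ^ g * k) \<le> 2 ^ F" by (intro power_increasing) auto
  then show "F ^ k \<le> 2 ^ F" unfolding F_def by (simp add: power_mult)
qed

section \<open>The search program\<close>

definition holds :: "xexp \<Rightarrow> (nat \<Rightarrow> int) \<Rightarrow> (int \<Rightarrow> int) \<Rightarrow> bool" where
  "holds e r m \<longleftrightarrow> xev e r m > 0"

definition xand :: "xexp \<Rightarrow> xexp \<Rightarrow> xexp" where "xand a b = XIf a b (XC 0)"
definition xor :: "xexp \<Rightarrow> xexp \<Rightarrow> xexp" where "xor a b = XIf a (XC 1) b"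
definition xnot :: "xexp \<Rightarrow> xexp" where "xnot a = XIf a (XC 0) (XC 1)"
definition xiff :: "xexp \<Rightarrow> xexp \<Rightarrow> xexp" where "xiff a b = XIf a b (xnot b)"
definition xless :: "xexp \<Rightarrow> xexp \<Rightarrow> xexp" where "xless a b = XSub b a"
definition xle :: "xexp \<Rightarrow> xexp \<Rightarrow> xexp" where "xle a b = xnot (XSub a b)"
definition xeq :: "xexp \<Rightarrow> xexp \<Rightarrow> xexp" where "xeq a b = xand (xle a b) (xle b a)"
definition xcount :: "nat \<Rightarrow> nat \<Rightarrow> xexp \<Rightarrow> xexp" where
  "xcount x y e = XSum x y (XIf e (XC 1) (XC 0))"

lemma holds_simps [simp]:
  "holds (xand a b) r m \<longleftrightarrow> holds a r m \<and> holds b r m"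
  "holds (xor a b) r m \<longleftrightarrow> holds a r m \<or> holds b r m"
  "holds (xnot a) r m \<longleftrightarrow> \<not> holds a r m"
  "holds (xiff a b) r m \<longleftrightarrow> (holds a r m \<longleftrightarrow> holds b r m)"
  "holds (xless a b) r m \<longleftrightarrow> xev a r m < xev b r m"
  "holds (xle a b) r m \<longleftrightarrow> xev a r m \<le> xev b r m"
  "holds (xeq a b) r m \<longleftrightarrow> xev a r m = xev b r m"
  by (auto simp: holds_def xand_def xor_def xnot_def xiff_def xless_def xle_def xeq_def)

lemma xev_XIf_holds: "xev (XIf c a b) r m = (if holds c r m then xev a r m else xev b r m)"
  by (simp add: holds_def)

lemma xev_xcount [simp]:
  "xev (xcount x y e) r m = int (card {i. i < nat (r y) \<and> holds e (r(x := int i)) m})"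
proof -
  have "(\<Sum>i<nat (r y). if holds e (r(x := int i)) m then 1 else 0 :: int) =
    int (card {i \<in> {..<nat (r y)}. holds e (r(x := int i)) m})"
    by (subst card_filter_sum) (simp_all only: of_nat_sum if_distrib[of int] of_nat_1 of_nat_0 finite_lessThan)
  then show ?thesis unfolding xcount_def xev.simps(7) xev_XIf_holds xev.simps(1) by simp
qed

text \<open>A count is positive iff there is a witness, so counting doubles as bounded
  quantification.\<close>

lemma holds_xcount [simp]:
  "holds (xcount x y e) r m \<longleftrightarrow> (\<exists>i<nat (r y). holds e (r(x := int i)) m)"
  unfolding holds_def[of "xcount x y e"] by (auto simp: card_gt_0_iff)

lemma xbelow_simps [simp]:
  "xbelow t (xand a b) \<longleftrightarrow> xbelow t a \<and> xbelow t b"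
  "xbelow t (xor a b) \<longleftrightarrow> xbelow t a \<and> xbelow t b"
  "xbelow t (xnot a) \<longleftrightarrow> xbelow t a"
  "xbelow t (xiff a b) \<longleftrightarrow> xbelow t a \<and> xbelow t b"
  "xbelow t (xless a b) \<longleftrightarrow> xbelow t a \<and> xbelow t b"
  "xbelow t (xle a b) \<longleftrightarrow> xbelow t a \<and> xbelow t b"
  "xbelow t (xeq a b) \<longleftrightarrow> xbelow t a \<and> xbelow t b"
  "xbelow t (xcount x y e) \<longleftrightarrow> x < t \<and> y < t \<and> xbelow t e"
  by (auto simp: xand_def xor_def xnot_def xiff_def xless_def xle_def xeq_def xcount_def)

text \<open>
  Registers 0, 1, 2, 8 hold \<open>n\<close>, \<open>k\<close>, \<open>g\<close> and the number of edges chosen so far; the endpoints of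
  the \<open>j\<close>-th chosen edge are at the addresses \<open>-1 - 2j\<close> and \<open>-2 - 2j\<close>. An argument \<open>t\<close> is the
  first register that the expression may bind.
\<close>

definition stack_u :: "nat \<Rightarrow> xexp" where "stack_u j = XM (XSub (XSub (XC (-1)) (XR j)) (XR j))"
definition stack_w :: "nat \<Rightarrow> xexp" where "stack_w j = XM (XSub (XSub (XC (-2)) (XR j)) (XR j))"

text \<open>The row offset is a product, obtained by adding \<open>n\<close> as often as the row
  index says.\<close>

definition e_E :: "nat \<Rightarrow> nat \<Rightarrow> nat \<Rightarrow> xexp" where
  "e_E u v t = XM (XAdd (XSum t u (XR 0)) (XR v))"

definition e_H :: "nat \<Rightarrow> nat \<Rightarrow> nat \<Rightarrow> xexp" where
  "e_H u v t = XM (XAdd (XAdd (XSum t 0 (XR 0)) (XSum t u (XR 0))) (XR v))"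

definition e_chosen :: "nat \<Rightarrow> nat \<Rightarrow> nat \<Rightarrow> xexp" where
  "e_chosen u v t = xcount t 8
     (xor (xand (xeq (stack_u t) (XR u)) (xeq (stack_w t) (XR v)))
          (xand (xeq (stack_u t) (XR v)) (xeq (stack_w t) (XR u))))"

definition e_blue :: "nat \<Rightarrow> nat \<Rightarrow> nat \<Rightarrow> xexp" where
  "e_blue u v t = xand (e_H u v t) (xor (e_E u v t) (e_chosen u v t))"

definition e_conflict :: "nat \<Rightarrow> nat \<Rightarrow> nat \<Rightarrow> xexp" where
  "e_conflict u v t = xand (e_H u v t) (xand (xnot (e_blue u v t))
     (xnot (xcount t 0 (xand (e_blue u t (t + 1)) (e_blue t v (t + 1))))))"

text \<open>Serves as the number of conflicts and, being positive exactly at touched vertices, also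
  as a test.\<close>

definition e_deg :: "nat \<Rightarrow> nat \<Rightarrow> xexp" where
  "e_deg u t = xcount t 0 (e_conflict u t (t + 1))"

definition e_high :: "nat \<Rightarrow> nat \<Rightarrow> xexp" where
  "e_high u t = xle (XR 2) (e_deg u t)"

definition e_same_type :: "nat \<Rightarrow> nat \<Rightarrow> nat \<Rightarrow> xexp" where
  "e_same_type w w' t = xnot (xcount t 0 (xand (e_deg t (t + 1)) (xnot (xand
     (xiff (e_blue t w (t + 1)) (e_blue t w' (t + 1))) (xiff (e_H t w (t + 1)) (e_H t w' (t + 1)))))))"

definition e_repr :: "nat \<Rightarrow> nat \<Rightarrow> xexp" where
  "e_repr w t = xnot (xcount t w (xand (xnot (e_deg t (t + 1))) (e_same_type w t (t + 1))))"

definition e_cand :: "nat \<Rightarrow> nat \<Rightarrow> nat \<Rightarrow> xexp" where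
  "e_cand u w t = xand (e_H u w t) (xand (xnot (e_blue u w t)) (xor
     (xand (e_high u t) (xle (e_deg u t) (XAdd
        (XSum t 0 (XIf (xand (e_conflict u t (t + 1)) (e_E w t (t + 1))) (XR 1) (XC 0)))
        (XAdd (XR 1) (XR 1)))))
     (xand (xnot (xcount t 0 (e_high t (t + 1)))) (xand (e_deg u t) (xor (e_deg w t) (e_repr w t))))))"

definition e_rank :: "nat \<Rightarrow> nat \<Rightarrow> nat \<Rightarrow> xexp" where
  "e_rank u w t = XSum t 0 (xcount (t + 1) 0 (xand (e_cand t (t + 1) (t + 2))
     (xor (xless (XR t) (XR u)) (xand (xeq (XR t) (XR u)) (xless (XR (t + 1)) (XR w))))))"

definition e_selected :: xexp where
  "e_selected = xand (e_cand 20 21 22) (xeq (e_rank 20 21 22) (XR 9))"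

definition e_pick_u :: xexp where
  "e_pick_u = XSum 20 0 (XSum 21 0 (XIf e_selected (XR 20) (XC 0)))"

definition e_pick_w :: xexp where
  "e_pick_w = XSum 20 0 (XSum 21 0 (XIf e_selected (XR 21) (XC 0)))"

definition e_solved :: xexp where
  "e_solved = xnot (xcount 20 0 (xcount 21 0 (e_conflict 20 21 22)))"

lemma xbelow_e [simp]:
  "j < b \<Longrightarrow> xbelow b (stack_u j)"
  "j < b \<Longrightarrow> xbelow b (stack_w j)"
  "u < b \<Longrightarrow> v < b \<Longrightarrow> t < b \<Longrightarrow> xbelow b (e_E u v t)"
  "u < b \<Longrightarrow> v < b \<Longrightarrow> t < b \<Longrightarrow> xbelow b (e_H u v t)"
  by (auto simp: stack_u_def stack_w_def e_E_def e_H_def)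

lemma xbelow_blue [simp]: "u < b \<Longrightarrow> v < b \<Longrightarrow> t < b \<Longrightarrow> 8 < b \<Longrightarrow> xbelow b (e_blue u v t)"
  by (auto simp: e_chosen_def e_blue_def)

lemma xbelow_conflict [simp]: "u < b \<Longrightarrow> v < b \<Longrightarrow> t + 1 < b \<Longrightarrow> 8 < b \<Longrightarrow> xbelow b (e_conflict u v t)"
  by (auto simp: e_conflict_def)

lemma xbelow_deg [simp]: "u < b \<Longrightarrow> t + 2 < b \<Longrightarrow> 8 < b \<Longrightarrow> xbelow b (e_deg u t)"
  by (auto simp: e_deg_def)

lemma xbelow_same_type [simp]: "u < b \<Longrightarrow> v < b \<Longrightarrow> t + 3 < b \<Longrightarrow> 8 < b \<Longrightarrow> xbelow b (e_same_type u v t)"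
  by (auto simp: e_same_type_def)

lemma xbelow_cand [simp]: "u < b \<Longrightarrow> v < b \<Longrightarrow> t + 4 < b \<Longrightarrow> 8 < b \<Longrightarrow> xbelow b (e_cand u v t)"
  by (auto simp: e_cand_def e_high_def e_repr_def)

lemma xbelow_rank [simp]: "u < b \<Longrightarrow> v < b \<Longrightarrow> t + 6 < b \<Longrightarrow> 8 < b \<Longrightarrow> xbelow b (e_rank u v t)"
  by (auto simp: e_rank_def)

lemma xbelow_pick [simp]: "28 < b \<Longrightarrow> xbelow b e_pick_u" "28 < b \<Longrightarrow> xbelow b e_pick_w"
    "28 < b \<Longrightarrow> xbelow b e_solved"
  by (auto simp: e_pick_u_def e_pick_w_def e_selected_def e_solved_def)

section \<open>Correctness of the expressions\<close>

definition stacked :: "(int \<Rightarrow> int) \<Rightarrow> nat \<Rightarrow> nat set set \<Rightarrow> bool" where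
  "stacked m i S \<longleftrightarrow> (\<forall>a b. {a, b} \<in> S \<longleftrightarrow>
     (\<exists>j<i. m (-1 - int j - int j) = int a \<and> m (-2 - int j - int j) = int b \<or>
            m (-1 - int j - int j) = int b \<and> m (-2 - int j - int j) = int a))"

lemma stacked_0: "stacked m 0 {}"
  by (simp add: stacked_def)

lemma stacked_Suc:
  assumes "stacked m i S"
  shows "stacked (m(-1 - int i - int i := int p, -2 - int i - int i := int q)) (Suc i) (insert {p, q} S)"
proof -
  let ?m = "m(-1 - int i - int i := int p, -2 - int i - int i := int q)"
  have new: "?m (-1 - int i - int i) = int p" "?m (-2 - int i - int i) = int q" by auto
  have old: "?m (-1 - int j - int j) = m (-1 - int j - int j)" "?m (-2 - int j - int j) = m (-2 - int j - int j)"
    if "j < i" for j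
  proof -
    have "-1 - int j - int j \<noteq> -1 - int i - int i" "-2 - int j - int j \<noteq> -2 - int i - int i"
      "-1 - int j - int j \<noteq> -2 - int i - int i" "-2 - int j - int j \<noteq> -1 - int i - int i"
      using that by presburger+
    then show "?m (-1 - int j - int j) = m (-1 - int j - int j)" "?m (-2 - int j - int j) = m (-2 - int j - int j)"
      by simp_all
  qed
  show ?thesis
    unfolding stacked_def
  proof (intro allI)
    fix a b
    let ?P = "\<lambda>m j. m (-1 - int j - int j) = int a \<and> m (-2 - int j - int j) = int b \<or>
            m (-1 - int j - int j) = int b \<and> m (-2 - int j - int j) = int a"
    have "(\<exists>j<i. ?P ?m j) \<longleftrightarrow> (\<exists>j<i. ?P m j)" using old by metis
    also have "\<dots> \<longleftrightarrow> {a, b} \<in> S" using assms unfolding stacked_def by simp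
    finally have 1: "(\<exists>j<i. ?P ?m j) \<longleftrightarrow> {a, b} \<in> S" .
    have 2: "?P ?m i \<longleftrightarrow> {a, b} = {p, q}" unfolding new by (auto simp: doubleton_eq_iff)
    have "(\<exists>j<Suc i. ?P ?m j) \<longleftrightarrow> (\<exists>j<i. ?P ?m j) \<or> ?P ?m i"
      by (subst Ex_less_Suc) (rule disj_commute)
    then show "{a, b} \<in> insert {p, q} S \<longleftrightarrow> (\<exists>j<Suc i. ?P ?m j)" unfolding 1 2 by blast
  qed
qed

context search
begin

definition stores_graphs :: "(int \<Rightarrow> int) \<Rightarrow> bool" where
  "stores_graphs m \<longleftrightarrow> (\<forall>u<n. \<forall>v<n.
     (m (int u * int n + int v) > 0 \<longleftrightarrow> {u, v} \<in> E) \<and>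
     (m (int n * int n + int u * int n + int v) > 0 \<longleftrightarrow> {u, v} \<in> H))"

text \<open>Register 1 is left out: it keeps the given budget, which may be negative, whereas
  \<open>k\<close> will be its nonnegative part. The two agree wherever candidates are
  evaluated.\<close>

definition represents :: "(nat \<Rightarrow> int) \<Rightarrow> (int \<Rightarrow> int) \<Rightarrow> nat set set \<Rightarrow> bool" where
  "represents r m S \<longleftrightarrow> r 0 = int n \<and> r 2 = int g \<and> stores_graphs m \<and> stacked m (nat (r 8)) S"

lemma represents_upd [simp]: "20 \<le> t \<Longrightarrow> represents (r(t := a)) m S \<longleftrightarrow> represents r m S"
  by (auto simp: represents_def)

lemma holds_E:
  assumes "represents r m S" "0 < t" "u < t" "v < t" "r u = int a" "r v = int b" "a < n" "b < n"
  shows "holds (e_E u v t) r m \<longleftrightarrow> {a, b} \<in> E"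
  using assms by (simp add: holds_def e_E_def represents_def stores_graphs_def)

lemma holds_H:
  assumes "represents r m S" "0 < t" "u < t" "v < t" "r u = int a" "r v = int b" "a < n" "b < n"
  shows "holds (e_H u v t) r m \<longleftrightarrow> {a, b} \<in> H"
  using assms by (simp add: holds_def e_H_def represents_def stores_graphs_def)

lemma holds_blue:
  assumes "represents r m S" "20 \<le> t" "u < t" "v < t" "r u = int a" "r v = int b" "a < n" "b < n"
  shows "holds (e_blue u v t) r m \<longleftrightarrow> {a, b} \<in> blue S"
proof -
  have "holds (e_chosen u v t) r m \<longleftrightarrow> {a, b} \<in> S"
    using assms unfolding e_chosen_def represents_def stacked_def
    by (auto simp: stack_u_def stack_w_def)
  then show ?thesis
    using assms holds_E[OF assms(1) _ assms(3-8)] holds_H[OF assms(1) _ assms(3-8)]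
    by (auto simp: e_blue_def blue_def)
qed

lemma holds_conflict:
  assumes rep: "represents r m S" and "20 \<le> t" "u < t" "v < t" "r u = int a" "r v = int b" "a < n" "b < n"
  shows "holds (e_conflict u v t) r m \<longleftrightarrow> conflict S a b"
proof -
  have "r 0 = int n" using rep by (simp add: represents_def)
  moreover have "holds (e_blue u t (t + 1)) (r(t := int i)) m \<longleftrightarrow> {a, i} \<in> blue S"
    "holds (e_blue t v (t + 1)) (r(t := int i)) m \<longleftrightarrow> {i, b} \<in> blue S" if "i < n" for i
    by (rule holds_blue; use assms that in simp)+
  moreover have "holds (e_blue u v t) r m \<longleftrightarrow> {a, b} \<in> blue S" by (rule holds_blue; use assms in simp)
  moreover have "holds (e_H u v t) r m \<longleftrightarrow> {a, b} \<in> H" by (rule holds_H; use assms in simp)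
  ultimately show ?thesis
    by (auto simp: e_conflict_def conflict_def)
qed

lemma xev_deg:
  assumes rep: "represents r m S" and "20 \<le> t" "u < t" "r u = int a" "a < n"
  shows "xev (e_deg u t) r m = int (card (cnbhd S a))"
proof -
  have "r 0 = int n" using rep by (simp add: represents_def)
  moreover have "holds (e_conflict u t (t + 1)) (r(t := int i)) m \<longleftrightarrow> conflict S a i" if "i < n" for i
    by (rule holds_conflict) (use assms that in simp_all)
  ultimately have "{i. i < nat (r 0) \<and> holds (e_conflict u t (t + 1)) (r(t := int i)) m} = cnbhd S a"
    by (auto simp: cnbhd_def)
  then show ?thesis by (simp add: e_deg_def)
qed

lemma holds_deg:
  assumes rep: "represents r m S" and "20 \<le> t" "u < t" "r u = int a" "a < n"
  shows "holds (e_deg u t) r m \<longleftrightarrow> touched S a"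
proof -
  have "finite (cnbhd S a)" by (simp add: cnbhd_def)
  then show ?thesis
    using xev_deg[OF assms] by (simp add: holds_def touched_def card_gt_0_iff)
qed

lemma holds_high:
  assumes rep: "represents r m S" and "20 \<le> t" "u < t" "r u = int a" "a < n"
  shows "holds (e_high u t) r m \<longleftrightarrow> high S a"
  using xev_deg[OF assms] rep by (simp add: e_high_def high_def represents_def)

lemma holds_same_type:
  assumes rep: "represents r m S" and "20 \<le> t" "u < t" "v < t" "r u = int a" "r v = int b" "a < n" "b < n"
  shows "holds (e_same_type u v t) r m \<longleftrightarrow> same_type S a b"
proof -
  have "r 0 = int n" using rep by (simp add: represents_def)
  moreover have "holds (e_deg t (t + 1)) (r(t := int i)) m \<longleftrightarrow> touched S i" if "i < n" for i
    by (rule holds_deg; use assms that in simp)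
  moreover have "holds (e_blue t u (t + 1)) (r(t := int i)) m \<longleftrightarrow> {i, a} \<in> blue S"
      "holds (e_blue t v (t + 1)) (r(t := int i)) m \<longleftrightarrow> {i, b} \<in> blue S" if "i < n" for i
    by (rule holds_blue; use assms that in simp)+
  moreover have "holds (e_H t u (t + 1)) (r(t := int i)) m \<longleftrightarrow> {i, a} \<in> H"
      "holds (e_H t v (t + 1)) (r(t := int i)) m \<longleftrightarrow> {i, b} \<in> H" if "i < n" for i
    by (rule holds_H[where S = S]; use assms that in simp)+
  ultimately show ?thesis
    by (auto simp: e_same_type_def same_type_def)
qed

lemma holds_repr:
  assumes rep: "represents r m S" and "20 \<le> t" "u < t" "r u = int a" "a < n"
  shows "holds (e_repr u t) r m \<longleftrightarrow> repr S a"
proof -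
  have "holds (e_deg t (t + 1)) (r(t := int i)) m \<longleftrightarrow> touched S i" if "i < a" for i
    by (rule holds_deg; use assms that in simp)
  moreover have "holds (e_same_type u t (t + 1)) (r(t := int i)) m \<longleftrightarrow> same_type S a i" if "i < a" for i
    by (rule holds_same_type; use assms that in simp)
  ultimately show ?thesis
    using assms(4) by (auto simp: e_repr_def repr_def)
qed

lemma holds_cand:
  assumes rep: "represents r m S" and "20 \<le> t" "u < t" "v < t" "r u = int a" "r v = int b" "a < n" "b < n"
    and k: "r 1 = int k"
  shows "holds (e_cand u v t) r m \<longleftrightarrow> cand S a b"
proof -
  have n: "r 0 = int n" using rep by (simp add: represents_def)
  have c: "holds (e_conflict u t (t + 1)) (r(t := int i)) m \<longleftrightarrow> conflict S a i" if "i < n" for i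
    by (rule holds_conflict; use assms that in simp)
  have e: "holds (e_E v t (t + 1)) (r(t := int i)) m \<longleftrightarrow> {b, i} \<in> E" if "i < n" for i
    by (rule holds_E[where S = S]; use assms that in simp)
  have h: "holds (e_high t (t + 1)) (r(t := int i)) m \<longleftrightarrow> high S i" if "i < n" for i
    by (rule holds_high; use assms that in simp)
  \<comment> \<open>Adding \<open>k\<close> once for every hit replaces a multiplication by
    \<open>k\<close>.\<close>
  have "xev (XSum t 0 (XIf (xand (e_conflict u t (t + 1)) (e_E v t (t + 1))) (XR 1) (XC 0))) r m =
      (\<Sum>i<n. if conflict S a i \<and> {b, i} \<in> E then int k else 0)"
    unfolding xev.simps(7) xev_XIf_holds n nat_int
    by (intro sum.cong refl) (use c e k assms in auto)
  also have "\<dots> = int k * (\<Sum>i<n. if conflict S a i \<and> {b, i} \<in> E then 1 else 0)"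
    by (subst sum_distrib_left) (intro sum.cong refl, auto)
  also have "\<dots> = int k * int (\<Sum>i<n. if conflict S a i \<and> {b, i} \<in> E then 1 else 0)"
    by (simp only: of_nat_sum if_distrib[of int] of_nat_1 of_nat_0)
  also have "\<dots> = int (k * card {i \<in> {..<n}. conflict S a i \<and> {b, i} \<in> E})"
    by (subst card_filter_sum) simp_all
  also have "{i \<in> {..<n}. conflict S a i \<and> {b, i} \<in> E} = {v \<in> cnbhd S a. {b, v} \<in> E}"
    by (auto simp: cnbhd_def)
  finally have sum: "xev (XSum t 0 (XIf (xand (e_conflict u t (t + 1)) (e_E v t (t + 1))) (XR 1) (XC 0))) r m =
    int (k * card {v \<in> cnbhd S a. {b, v} \<in> E})" .
  have blue: "holds (e_blue u v t) r m \<longleftrightarrow> {a, b} \<in> blue S" by (rule holds_blue; use assms in simp)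
  have H: "holds (e_H u v t) r m \<longleftrightarrow> {a, b} \<in> H" by (rule holds_H[where S = S]; use assms in simp)
  have deg: "xev (e_deg u t) r m = int (card (cnbhd S a))" by (rule xev_deg; use assms in simp)
  have t: "holds (e_deg u t) r m \<longleftrightarrow> touched S a" "holds (e_deg v t) r m \<longleftrightarrow> touched S b"
    by (rule holds_deg; use assms in simp)+
  have rp: "holds (e_repr v t) r m \<longleftrightarrow> repr S b" by (rule holds_repr; use assms in simp)
  have hi: "holds (e_high u t) r m \<longleftrightarrow> high S a" by (rule holds_high; use assms in simp)
  have all: "(\<exists>i<nat (r 0). holds (e_high t (t + 1)) (r(t := int i)) m) \<longleftrightarrow> (\<exists>i<n. high S i)"
    using h n by auto
  have le: "xev (e_deg u t) r m \<le> xev (XAdd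
        (XSum t 0 (XIf (xand (e_conflict u t (t + 1)) (e_E v t (t + 1))) (XR 1) (XC 0)))
        (XAdd (XR 1) (XR 1))) r m \<longleftrightarrow> card (cnbhd S a) \<le> k * card {v \<in> cnbhd S a. {b, v} \<in> E} + 2 * k"
  proof -
    have "xev (XAdd (XR 1) (XR 1)) r m = int (2 * k)" using k by simp
    then show ?thesis unfolding xev.simps(4)[of "XSum _ _ _"] sum deg by (simp only: of_nat_le_iff flip: of_nat_add)
  qed
  show ?thesis
    unfolding e_cand_def cand_def holds_simps holds_xcount blue H t rp hi all le
    using assms by blast
qed

lemma card_pairs:
  "(\<Sum>a<n. card {b. b < n \<and> P a b}) = card {(a, b). a < n \<and> b < n \<and> P a b}"
proof -
  have "{(a, b). a < n \<and> b < n \<and> P a b} = Sigma {..<n} (\<lambda>a. {b. b < n \<and> P a b})" by auto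
  then show ?thesis by (simp add: card_SigmaI)
qed

lemma xev_rank:
  assumes rep: "represents r m S" and "20 \<le> t" "u < t" "v < t" "r u = int a" "r v = int b"
    and k: "r 1 = int k"
  shows "xev (e_rank u v t) r m = int (rank S a b)"
proof -
  have n: "r 0 = int n" using rep by (simp add: represents_def)
  have c: "holds (e_cand t (t + 1) (t + 2)) (r(t := int i, t + 1 := int j)) m \<longleftrightarrow> cand S i j"
    if "i < n" "j < n" for i j
    by (rule holds_cand; use assms that in simp)
  have "{j. j < n \<and> cand S i j \<and> (i < a \<or> i = a \<and> j < b)} = {j. j < nat ((r(t := int i)) 0) \<and>
     holds (xand (e_cand t (t + 1) (t + 2))
     (xor (xless (XR t) (XR u)) (xand (xeq (XR t) (XR u)) (xless (XR (t + 1)) (XR v))))) (r(t := int i, t + 1 := int j)) m}"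
    if "i < n" for i
    using c[OF that] n assms by auto
  then have "xev (e_rank u v t) r m = (\<Sum>i<n. int (card {j. j < n \<and> cand S i j \<and> (i < a \<or> i = a \<and> j < b)}))"
    unfolding e_rank_def xev.simps(7) n nat_int xev_xcount by (intro sum.cong refl) simp
  also have "\<dots> = int (card {(i, j). i < n \<and> j < n \<and> cand S i j \<and> (i < a \<or> i = a \<and> j < b)})"
    by (simp flip: card_pairs)
  also have "{(i, j). i < n \<and> j < n \<and> cand S i j \<and> (i < a \<or> i = a \<and> j < b)} =
      {(i, j). cand S i j \<and> (i < a \<or> i = a \<and> j < b)}" by (auto simp: cand_def)
  finally show ?thesis by (simp add: rank_def)
qed

lemma xev_pick:
  assumes rep: "represents r m S" and "r 1 = int k" "r 9 = int x"
  shows "xev e_pick_u r m = int (pick_u S x)" "xev e_pick_w r m = int (pick_w S x)"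
proof -
  have n: "r 0 = int n" using rep by (simp add: represents_def)
  have sel: "holds e_selected (r(20 := int u, 21 := int w)) m \<longleftrightarrow> cand S u w \<and> rank S u w = x"
    if "u < n" "w < n" for u w
  proof -
    let ?r = "r(20 := int u, 21 := int w)"
    have rep': "represents ?r m S" using rep by simp
    have "holds (e_cand 20 21 22) ?r m \<longleftrightarrow> cand S u w"
      by (rule holds_cand[OF rep']) (use that assms in simp_all)
    moreover have "xev (e_rank 20 21 22) ?r m = int (rank S u w)"
      by (rule xev_rank[OF rep']) (use assms in simp_all)
    ultimately show ?thesis using assms by (simp add: e_selected_def)
  qed
  have "xev e_pick_u r m = (\<Sum>u<n. \<Sum>w<n. int (if cand S u w \<and> rank S u w = x then u else 0))"
    unfolding e_pick_u_def xev.simps(7) xev_XIf_holds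
    by (intro sum.cong) (use sel n in auto)
  then show "xev e_pick_u r m = int (pick_u S x)" by (simp add: pick_u_def)
  have "xev e_pick_w r m = (\<Sum>u<n. \<Sum>w<n. int (if cand S u w \<and> rank S u w = x then w else 0))"
    unfolding e_pick_w_def xev.simps(7) xev_XIf_holds
    by (intro sum.cong) (use sel n in auto)
  then show "xev e_pick_w r m = int (pick_w S x)" by (simp add: pick_w_def)
qed

lemma holds_solved:
  assumes rep: "represents r m S"
  shows "holds e_solved r m \<longleftrightarrow> solved S"
proof -
  have n: "r 0 = int n" using rep by (simp add: represents_def)
  have "holds (e_conflict 20 21 22) (r(20 := int u, 21 := int v)) m \<longleftrightarrow> conflict S u v"
    if "u < n" "v < n" for u v
    by (rule holds_conflict; use rep that in simp)
  then show ?thesis using n by (auto simp: e_solved_def solved_def)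
qed

end

section \<open>Computing the parameters\<close>

definition pow2_to :: "nat \<Rightarrow> nat \<Rightarrow> hcom" where
  "pow2_to y x = HSeq (HSet y (XC 1)) (HFor 12 x (HSet y (XAdd (XR y) (XR y))))"

text \<open>The loop multiplies \<open>x\<close> by a power of \<open>z\<close>, with exponent in
  \<open>y\<close>; the inner sum is a single product by repeated addition.\<close>

definition multiply :: "nat \<Rightarrow> nat \<Rightarrow> nat \<Rightarrow> hcom" where
  "multiply x y z = HFor 12 y (HSet x (XSum 20 z (XR x)))"

lemma hwp_pow2_to:
  assumes "y \<noteq> 12" "x \<noteq> y" "2 ^ nat (r x) \<le> N"
    and "\<And>r'. (\<And>z. z \<noteq> y \<Longrightarrow> z \<noteq> 12 \<Longrightarrow> r' z = r z) \<Longrightarrow> r' y = 2 ^ nat (r x) \<Longrightarrow> Q r' m"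
  shows "hwp N (pow2_to y x) Q r m"
  unfolding pow2_to_def hwp_HSeq hwp_HSet
proof (intro conjI)
  have "(1::nat) \<le> 2 ^ nat (r x)" by simp
  then have "1 \<le> N" using assms(3) by (rule le_trans)
  then show "xev (XC 1) r m \<le> int N" by simp
  let ?I = "\<lambda>i r' m'. m' = m \<and> (\<forall>z. z \<noteq> y \<and> z \<noteq> 12 \<longrightarrow> r' z = r z) \<and> r' y = 2 ^ i"
  show "hwp N (HFor 12 x (HSet y (XAdd (XR y) (XR y)))) Q (r(y := xev (XC 1) r m)) m"
  proof (rule hwp_HFor[where I = ?I])
    fix i r' m' assume "i < nat ((r(y := xev (XC 1) r m)) x)" and I: "?I i r' m'"
    then have "Suc i \<le> nat (r x)" using assms(2) by simp
    then have "(2::nat) ^ Suc i \<le> 2 ^ nat (r x)" by (intro power_increasing) auto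
    then have "(2::nat) ^ Suc i \<le> N" using assms(3) by linarith
    then have "int (2 ^ Suc i) \<le> int N" by (simp only: of_nat_le_iff)
    then show "hwp N (HSet y (XAdd (XR y) (XR y))) (?I (Suc i)) (r'(12 := int i)) m'"
      unfolding hwp_HSet using I assms(1) by simp
  next
    fix r' m' assume "?I (nat ((r(y := xev (XC 1) r m)) x)) r' m'"
    then show "Q r' m'" using assms(2,4) by simp
  qed simp
qed

text \<open>\<open>1 \<le> b\<close> keeps the intermediate products from exceeding the final one,
  so bounding that one by \<open>N\<close> is enough.\<close>

lemma hwp_multiply:
  assumes x: "x \<noteq> 12" "x \<noteq> y" "x \<noteq> z" "z \<noteq> 12" "x \<noteq> 20"
    and a: "r x = int a" "r z = int b" "1 \<le> b" "a * b ^ nat (r y) \<le> N"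
    and Q: "\<And>r'. (\<And>v. v \<noteq> x \<Longrightarrow> v \<noteq> 12 \<Longrightarrow> r' v = r v) \<Longrightarrow> r' x = int (a * b ^ nat (r y)) \<Longrightarrow> Q r' m"
  shows "hwp N (multiply x y z) Q r m"
  unfolding multiply_def
proof (rule hwp_HFor[where I = "\<lambda>i r' m'. m' = m \<and> (\<forall>v. v \<noteq> x \<and> v \<noteq> 12 \<longrightarrow> r' v = r v) \<and> r' x = int (a * b ^ i)"])
  fix i r' m' assume i: "i < nat (r y)"
    and I: "m' = m \<and> (\<forall>v. v \<noteq> x \<and> v \<noteq> 12 \<longrightarrow> r' v = r v) \<and> r' x = int (a * b ^ i)"
  have "b ^ Suc i \<le> b ^ nat (r y)" using i a(3) by (intro power_increasing) auto
  then have "a * b ^ Suc i \<le> N" using a(4) by (meson le_trans mult_le_mono2)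
  then have N: "int (a * b ^ Suc i) \<le> int N" by (simp only: of_nat_le_iff)
  have "xev (XSum 20 z (XR x)) (r'(12 := int i)) m' = int (a * b ^ Suc i)"
    using I x a by simp
  then show "hwp N (HSet x (XSum 20 z (XR x)))
      (\<lambda>r' m'. m' = m \<and> (\<forall>v. v \<noteq> x \<and> v \<noteq> 12 \<longrightarrow> r' v = r v) \<and> r' x = int (a * b ^ Suc i)) (r'(12 := int i)) m'"
    unfolding hwp_HSet using I N by simp
qed (use a Q in auto)

text \<open>Free of state arguments, so that it also rewrites nested postconditions.\<close>

lemma hwp_HSeq_eq: "hwp N (HSeq c1 c2) Q = hwp N c1 (hwp N c2 Q)"
  by (intro ext) (rule hwp_HSeq)

text \<open>The base is \<open>16 * 16 ^ d\<close>, one run of \<open>multiply\<close>; a second run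
  multiplies it by its own \<open>k\<close>-th power.\<close>

definition par_g :: "nat \<Rightarrow> nat \<Rightarrow> nat" where
  "par_g k d = (2 ^ (4 * d + 4)) ^ (k + 1)"

definition par_F :: "nat \<Rightarrow> nat \<Rightarrow> nat" where
  "par_F k d = 2 ^ (2 ^ par_g k d)"

definition par_Z :: "nat \<Rightarrow> nat \<Rightarrow> nat" where
  "par_Z k d = 2 ^ par_F k d"

text \<open>From \<open>k\<close> and \<open>d\<close> in registers 1 and 16, computes \<open>g\<close>, \<open>F\<close> and \<open>Z\<close> in registers 2, 3 and 4.\<close>

definition parameters :: hcom where
  "parameters =
     HSeq (HSet 17 (XC 16)) (HSeq (HSet 15 (XC 16)) (HSeq (multiply 15 16 17)
       (HSeq (HSet 2 (XR 15)) (HSeq (multiply 2 1 15)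
         (HSeq (pow2_to 14 2) (HSeq (pow2_to 3 14) (pow2_to 4 3)))))))"

lemma par_le:
  "16 \<le> par_g k d" "k \<le> par_g k d" "d \<le> par_g k d" "2 ^ (4 * d + 4) \<le> par_g k d"
  "2 ^ par_g k d \<le> par_Z k d" "par_F k d \<le> par_Z k d" "par_g k d \<le> par_Z k d"
proof -
  have lt: "m \<le> 2 ^ m" for m :: nat by (simp add: less_imp_le)
  have g: "par_g k d = 2 ^ ((4 * d + 4) * (k + 1))" unfolding par_g_def by (simp only: power_mult)
  have "(2::nat) ^ 4 \<le> par_g k d" unfolding g by (intro power_increasing) auto
  then show "16 \<le> par_g k d" by simp
  have "k \<le> (4 * d + 4) * (k + 1)" "d \<le> (4 * d + 4) * (k + 1)" by (simp_all add: algebra_simps)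
  then show "k \<le> par_g k d" "d \<le> par_g k d" using lt[of "(4 * d + 4) * (k + 1)"] unfolding g by linarith+
  show "2 ^ (4 * d + 4) \<le> par_g k d" unfolding g by (intro power_increasing) auto
  show "2 ^ par_g k d \<le> par_Z k d" "par_F k d \<le> par_Z k d" "par_g k d \<le> par_Z k d"
    using lt[of "par_g k d"] lt[of "2 ^ par_g k d"] lt[of "par_F k d"] unfolding par_Z_def par_F_def by linarith+
qed

lemma hwp_parameters:
  assumes d: "r 16 = int d" and N: "par_Z (nat (r 1)) d \<le> N"
    and Q: "\<And>r'. (\<And>x. x \<notin> {2, 3, 4, 12, 14, 15, 17} \<Longrightarrow> r' x = r x) \<Longrightarrow> r' 2 = int (par_g (nat (r 1)) d) \<Longrightarrow>
      r' 3 = int (par_F (nat (r 1)) d) \<Longrightarrow> r' 4 = int (par_Z (nat (r 1)) d) \<Longrightarrow> Q r' m"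
  shows "hwp N parameters Q r m"
proof -
  let ?k = "nat (r 1)"
  note le = par_le[where k = ?k and d = d]
  have pw: "(16::nat) * 16 ^ d = 2 ^ (4 * d + 4)" by (simp add: power_add power_mult)
  have pw': "(2 ^ (4 * d + 4)) * (2 ^ (4 * d + 4)) ^ ?k = par_g ?k d" by (simp add: par_g_def)
  have N': "16 \<le> N" "16 * 16 ^ d \<le> N" "2 ^ (4 * d + 4) \<le> N" "par_g ?k d \<le> N" "2 ^ par_g ?k d \<le> N" "par_F ?k d \<le> N"
    unfolding pw using le N by linarith+
  show ?thesis
    unfolding parameters_def hwp_HSeq_eq hwp_HSet
  proof (intro conjI)
    show "hwp N (multiply 15 16 17) (\<lambda>r m. xev (XR 15) r m \<le> int N \<and> hwp N (multiply 2 1 15)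
         (hwp N (pow2_to 14 2) (hwp N (pow2_to 3 14) (hwp N (pow2_to 4 3) Q))) (r(2 := xev (XR 15) r m)) m)
         (r(17 := xev (XC 16) r m, 15 := xev (XC 16) (r(17 := xev (XC 16) r m)) m)) m"
    proof (rule hwp_multiply[where a = 16 and b = 16])
      fix r1 assume "\<And>v. v \<noteq> 15 \<Longrightarrow> v \<noteq> 12 \<Longrightarrow> r1 v = (r(17 := xev (XC 16) r m, 15 := xev (XC 16) (r(17 := xev (XC 16) r m)) m)) v"
        "r1 15 = int (16 * 16 ^ nat ((r(17 := xev (XC 16) r m, 15 := xev (XC 16) (r(17 := xev (XC 16) r m)) m)) 16))"
      then have r1: "\<And>v. v \<notin> {12, 15, 17} \<Longrightarrow> r1 v = r v" "r1 15 = int (2 ^ (4 * d + 4))"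
        unfolding pw[symmetric] by (simp_all add: d)
      show "xev (XR 15) r1 m \<le> int N \<and> hwp N (multiply 2 1 15)
         (hwp N (pow2_to 14 2) (hwp N (pow2_to 3 14) (hwp N (pow2_to 4 3) Q))) (r1(2 := xev (XR 15) r1 m)) m"
      proof (intro conjI)
        show "xev (XR 15) r1 m \<le> int N" using r1(2) N'(3) by (simp only: xev.simps of_nat_le_iff)
        show "hwp N (multiply 2 1 15) (hwp N (pow2_to 14 2) (hwp N (pow2_to 3 14) (hwp N (pow2_to 4 3) Q)))
            (r1(2 := xev (XR 15) r1 m)) m"
        proof (rule hwp_multiply[where a = "2 ^ (4 * d + 4)" and b = "2 ^ (4 * d + 4)"])
          have y: "nat ((r1(2 := xev (XR 15) r1 m)) 1) = ?k" using r1(1)[of 1] by simp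
          show "2 ^ (4 * d + 4) * (2 ^ (4 * d + 4)) ^ nat ((r1(2 := xev (XR 15) r1 m)) 1) \<le> N"
            unfolding y pw' by (rule N'(4))
          fix r2 assume "\<And>v. v \<noteq> 2 \<Longrightarrow> v \<noteq> 12 \<Longrightarrow> r2 v = (r1(2 := xev (XR 15) r1 m)) v"
            "r2 2 = int (2 ^ (4 * d + 4) * (2 ^ (4 * d + 4)) ^ nat ((r1(2 := xev (XR 15) r1 m)) 1))"
          then have r2: "\<And>v. v \<notin> {2, 12, 15, 17} \<Longrightarrow> r2 v = r v" "r2 2 = int (par_g ?k d)"
            unfolding y pw' using r1 by simp_all
          show "hwp N (pow2_to 14 2) (hwp N (pow2_to 3 14) (hwp N (pow2_to 4 3) Q)) r2 m"
          proof (rule hwp_pow2_to)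
            show "2 ^ nat (r2 2) \<le> N" using r2(2) N'(5) by simp
            fix r3 assume "\<And>z. z \<noteq> 14 \<Longrightarrow> z \<noteq> 12 \<Longrightarrow> r3 z = r2 z" "r3 14 = 2 ^ nat (r2 2)"
            then have r3: "\<And>v. v \<notin> {2, 12, 14, 15, 17} \<Longrightarrow> r3 v = r v" "r3 2 = int (par_g ?k d)"
              "r3 14 = int (2 ^ par_g ?k d)"
              using r2 by simp_all
            show "hwp N (pow2_to 3 14) (hwp N (pow2_to 4 3) Q) r3 m"
            proof (rule hwp_pow2_to)
              show "2 ^ nat (r3 14) \<le> N" using N'(6) unfolding r3 nat_int par_F_def .
              fix r4 assume "\<And>z. z \<noteq> 3 \<Longrightarrow> z \<noteq> 12 \<Longrightarrow> r4 z = r3 z" "r4 3 = 2 ^ nat (r3 14)"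
              then have r4: "\<And>v. v \<notin> {2, 3, 12, 14, 15, 17} \<Longrightarrow> r4 v = r v" "r4 2 = int (par_g ?k d)"
                "r4 3 = int (par_F ?k d)"
                unfolding r3 nat_int par_F_def using r3 by simp_all
              show "hwp N (pow2_to 4 3) Q r4 m"
              proof (rule hwp_pow2_to)
                show "2 ^ nat (r4 3) \<le> N" using N unfolding r4 nat_int par_Z_def .
                fix r5 assume "\<And>z. z \<noteq> 4 \<Longrightarrow> z \<noteq> 12 \<Longrightarrow> r5 z = r4 z" "r5 4 = 2 ^ nat (r4 3)"
                then have "\<And>v. v \<notin> {2, 3, 4, 12, 14, 15, 17} \<Longrightarrow> r5 v = r v" "r5 2 = int (par_g ?k d)"
                  "r5 3 = int (par_F ?k d)" "r5 4 = int (par_Z ?k d)"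
                  unfolding r4 nat_int par_Z_def using r4 by simp_all
                then show "Q r5 m" by (rule Q)
              qed simp_all
            qed simp_all
          qed simp_all
        qed (use r1 in simp_all)
      qed
    qed (use N' d in simp_all)
  qed (use N' in simp_all)
qed

section \<open>The search program and its verification\<close>

definition e_quotient :: xexp where
  "e_quotient = xcount 20 7 (xle (XAdd (XSum 21 20 (XR 3)) (XR 3)) (XR 7))"

text \<open>Register 7 gives up its lowest base-\<open>F\<close> digit to register 9. The loop
  register 8 is at the same time the height of the stack that receives the new edge.\<close>

definition search_step :: hcom where
  "search_step =
     HSeq (HSet 13 e_quotient) (HSeq (HSet 9 (XSub (XR 7) (XSum 20 13 (XR 3))))
       (HSeq (HSet 10 e_pick_u) (HSeq (HSet 11 e_pick_w)
         (HSeq (HStore (XSub (XSub (XC (-1)) (XR 8)) (XR 8)) (XR 10))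
           (HSeq (HStore (XSub (XSub (XC (-2)) (XR 8)) (XR 8)) (XR 11)) (HSet 7 (XR 13)))))))"

text \<open>After its last round the loop leaves the budget minus 1 in register 8, or an older value
  if it never ran; hence the reset before the test. Cells of earlier branches are simply
  overwritten.\<close>

definition search_branch :: hcom where
  "search_branch =
     HSeq (HSet 7 (XR 6)) (HSeq (HFor 8 1 search_step) (HSeq (HSet 8 (XR 1))
       (HSet 5 (XIf (xor (XR 5) e_solved) (XC 1) (XC 0)))))"

text \<open>Adding 1 turns the positivity test into one for a nonnegative budget. A negative budget
  must be refused here, as the search without rounds may succeed.\<close>

definition search_all :: hcom where
  "search_all =
     HSeq (HSet 5 (XC 0)) (HSeq (HFor 6 4 search_branch)
       (HSet 0 (XIf (XAdd (XR 1) (XC 1)) (XR 5) (XC 0))))"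

text \<open>\<open>d\<close> occurs as a constant only, so degree and coefficient of the running
  time are the same for all \<open>d\<close>.\<close>

definition decide :: "nat \<Rightarrow> hcom" where
  "decide d = HSeq (HSet 16 (XC (int d))) (HSeq parameters search_all)"

text \<open>Division by counting: \<open>i < z div F\<close> iff
  \<open>Suc i * F \<le> z\<close>.\<close>

lemma xev_quotient:
  assumes "r 7 = int z" "r 3 = int F" "F > 0"
  shows "xev e_quotient r m = int (z div F)"
proof -
  have eq: "i < z \<and> int i * int F + int F \<le> int z \<longleftrightarrow> i < z div F" for i
  proof -
    have "int i * int F + int F = int (Suc i * F)" by simp
    then have "int i * int F + int F \<le> int z \<longleftrightarrow> Suc i * F \<le> z" by (simp only: of_nat_le_iff)
    also have "\<dots> \<longleftrightarrow> Suc i \<le> z div F"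
      using less_eq_div_iff_mult_less_eq[OF assms(3), of "Suc i" z] by (rule sym)
    finally have "int i * int F + int F \<le> int z \<longleftrightarrow> i < z div F" unfolding Suc_le_eq .
    moreover have "z div F \<le> z" by simp
    ultimately show ?thesis by linarith
  qed
  have "xev e_quotient r m = int (card {i. i < z \<and> int i * int F + int F \<le> int z})"
    using assms by (simp add: e_quotient_def)
  also have "{i. i < z \<and> int i * int F + int F \<le> int z} = {..<z div F}"
    unfolding eq by (simp add: lessThan_def)
  finally show ?thesis by simp
qed

context search
begin

lemma stores_graphs_upd:
  assumes "a < 0"
  shows "stores_graphs (m(a := x)) \<longleftrightarrow> stores_graphs m"
proof -
  have "int u * int n + int v \<noteq> a" "int n * int n + int u * int n + int v \<noteq> a" for u v
  proof -
    have "0 \<le> int u * int n + int v" "0 \<le> int n * int n + int u * int n + int v" by simp_all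
    then show "int u * int n + int v \<noteq> a" "int n * int n + int u * int n + int v \<noteq> a"
      using assms by linarith+
  qed
  then show ?thesis by (simp add: stores_graphs_def)
qed

lemma stores_graphs_input: "stores_graphs (input_memory n E H)"
  unfolding stores_graphs_def
proof (intro allI impI)
  fix u v assume uv: "u < n" "v < n"
  have inj: "i * n + j = u * n + v \<longleftrightarrow> i = u \<and> j = v" if "j < n" for i j
    using that uv by (metis add.commute div_mult_self3 div_less add_0 mod_mult_self3 mod_less less_nat_zero_code)
  have less: "i * n + j < n * n" if "i < n" "j < n" for i j
  proof -
    have "i * n + j < Suc i * n" using that by simp
    also have "\<dots> \<le> n * n" using that by (intro mult_le_mono1) simp
    finally show ?thesis .
  qed
  have 1: "(\<exists>i<n. \<exists>j<n. {i, j} \<in> E \<and> int (u * n + v) = int (i * n + j)) \<longleftrightarrow> {u, v} \<in> E"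
    unfolding of_nat_eq_iff using inj uv by metis
  have 2: "\<not> (\<exists>i<n. \<exists>j<n. {i, j} \<in> H \<and> int (u * n + v) = int (n * n + i * n + j))"
    unfolding of_nat_eq_iff using less[OF uv] by (metis add.assoc not_add_less1)
  have 3: "\<not> (\<exists>i<n. \<exists>j<n. {i, j} \<in> E \<and> int (n * n + u * n + v) = int (i * n + j))"
    unfolding of_nat_eq_iff using less by (metis add.assoc not_add_less1)
  have 4: "(\<exists>i<n. \<exists>j<n. {i, j} \<in> H \<and> int (n * n + u * n + v) = int (n * n + i * n + j)) \<longleftrightarrow> {u, v} \<in> H"
    unfolding of_nat_eq_iff add.assoc add_left_cancel using inj uv by metis
  have "input_memory n E H (int (u * n + v)) > 0 \<longleftrightarrow> {u, v} \<in> E"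
    unfolding input_memory_def 1 if_not_P[OF 2] by simp
  moreover have "input_memory n E H (int (n * n + u * n + v)) > 0 \<longleftrightarrow> {u, v} \<in> H"
    unfolding input_memory_def 4 if_not_P[OF 3] by simp
  ultimately show "(input_memory n E H (int u * int n + int v) > 0 \<longleftrightarrow> {u, v} \<in> E) \<and>
     (input_memory n E H (int n * int n + int u * int n + int v) > 0 \<longleftrightarrow> {u, v} \<in> H)"
    by simp
qed

definition outer_inv :: "int \<Rightarrow> nat \<Rightarrow> nat \<Rightarrow> int \<Rightarrow> (nat \<Rightarrow> int) \<Rightarrow> (int \<Rightarrow> int) \<Rightarrow> bool" where
  "outer_inv l F Z a r m \<longleftrightarrow> r 0 = int n \<and> r 1 = l \<and> r 2 = int g \<and> r 3 = int F \<and> r 4 = int Z \<and> r 5 = a \<and>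
     stores_graphs m"

definition inner_inv :: "int \<Rightarrow> nat \<Rightarrow> nat \<Rightarrow> int \<Rightarrow> nat \<Rightarrow> nat \<Rightarrow> (nat \<Rightarrow> int) \<Rightarrow> (int \<Rightarrow> int) \<Rightarrow> bool" where
  "inner_inv l F Z a z i r m \<longleftrightarrow> outer_inv l F Z a r m \<and> r 7 = int (z div F ^ i) \<and>
     stacked m i (branch F z i)"

lemma hwp_search_step:
  assumes inv: "inner_inv (int k) F Z a z i r m" and N: "n \<le> N" "z \<le> N" and F: "F > 0"
  shows "hwp N search_step (inner_inv (int k) F Z a z (Suc i)) (r(8 := int i)) m"
proof -
  let ?z = "z div F ^ i" and ?S = "branch F z i"
  let ?x = "?z mod F"
  let ?u = "pick_u ?S ?x" and ?w = "pick_w ?S ?x"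
  note inv' = inv[unfolded inner_inv_def outer_inv_def]
  define r0 where "r0 = r(8 := int i)"
  have q: "xev e_quotient r0 m = int (?z div F)"
    by (rule xev_quotient) (use inv' F in \<open>auto simp: r0_def\<close>)
  define r1 where "r1 = r0(13 := int (?z div F))"
  have x: "xev (XSub (XR 7) (XSum 20 13 (XR 3))) r1 m = int ?x"
    using inv' by (simp add: r1_def r0_def minus_div_mult_eq_mod flip: of_nat_mult of_nat_diff)
  define r2 where "r2 = r1(9 := int ?x)"
  have rep: "represents r2 m ?S" "r2 1 = int k" "r2 9 = int ?x"
    using inv' by (auto simp: represents_def r2_def r1_def r0_def)
  define r3 where "r3 = r2(10 := int ?u)"
  have rep3: "represents r3 m ?S" "r3 1 = int k" "r3 9 = int ?x"
    using rep by (auto simp: represents_def r3_def)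
  define m' where "m' = m(-1 - int i - int i := int ?u, -2 - int i - int i := int ?w)"
  have "z div F ^ i \<le> z" "?z div F \<le> ?z" "?x \<le> ?z" by simp_all
  then have le: "?z div F \<le> N" "?x \<le> N" "?u \<le> N" "?w \<le> N"
    using N pick_le[of ?S ?x] by linarith+
  have sg: "stores_graphs m'" unfolding m'_def using inv' by (simp add: stores_graphs_upd)
  have st: "stacked m' (Suc i) (branch F z (Suc i))"
    unfolding m'_def branch.simps Let_def by (rule stacked_Suc) (use inv' in simp)
  have zd: "?z div F = z div F ^ Suc i" by (metis div_mult2_eq power_Suc2)
  define r4 where "r4 = r3(11 := int ?w)"
  have r4: "r4 8 = int i" "r4 10 = int ?u" "r4 11 = int ?w" "r4 13 = int (?z div F)"
    by (simp_all add: r4_def r3_def r2_def r1_def r0_def)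
  have inv4: "inner_inv (int k) F Z a z (Suc i) (r4(7 := int (?z div F))) m'"
    unfolding inner_inv_def
  proof (intro conjI)
    show "outer_inv (int k) F Z a (r4(7 := int (?z div F))) m'"
      using inv' sg by (simp add: outer_inv_def r4_def r3_def r2_def r1_def r0_def)
    show "(r4(7 := int (?z div F))) 7 = int (z div F ^ Suc i)" unfolding zd by simp
  qed (rule st)
  have "hwp N search_step (inner_inv (int k) F Z a z (Suc i)) r0 m"
    \<comment> \<open>Symbolic execution; each register state is folded into its name before the
      next command is evaluated.\<close>
    unfolding search_step_def hwp_HSeq hwp_HSet hwp_HStore
    unfolding q r1_def[symmetric]
    unfolding x r2_def[symmetric]
    unfolding xev_pick(1)[OF rep] r3_def[symmetric]
    unfolding xev_pick(2)[OF rep3] r4_def[symmetric]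
    unfolding xev.simps r4 m'_def[symmetric]
    using le inv4 by (simp only: of_nat_le_iff simp_thms)
  then show ?thesis by (simp add: r0_def)
qed

lemma hwp_search_branch:
  assumes inv: "outer_inv l F Z a r m" and N: "n \<le> N" "z \<le> N" "l \<le> int N" "1 \<le> N" and F: "F > 0"
    and k: "k = nat l"
  shows "hwp N search_branch (outer_inv l F Z (if a > 0 \<or> solved (branch F z k) then 1 else 0))
    (r(6 := int z)) m"
  unfolding search_branch_def hwp_HSeq_eq
proof -
  let ?Q = "outer_inv l F Z (if a > 0 \<or> solved (branch F z k) then 1 else 0)"
  let ?rest = "hwp N (HSet 8 (XR 1)) (hwp N (HSet 5 (XIf (xor (XR 5) e_solved) (XC 1) (XC 0))) ?Q)"
  have "hwp N (HFor 8 1 search_step) ?rest (r(6 := int z, 7 := int z)) m"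
  proof (rule hwp_HFor[where I = "inner_inv l F Z a z"])
    show "inner_inv l F Z a z 0 (r(6 := int z, 7 := int z)) m"
      using inv by (simp add: inner_inv_def outer_inv_def stacked_0)
  next
    fix i r' m' assume "i < nat ((r(6 := int z, 7 := int z)) 1)" and I: "inner_inv l F Z a z i r' m'"
    \<comment> \<open>The loop body is reached only for a positive budget, where \<open>l\<close>
      and \<open>k\<close> agree.\<close>
    then have "l = int k" using inv k by (simp add: outer_inv_def)
    with I show "hwp N search_step (inner_inv l F Z a z (Suc i)) (r'(8 := int i)) m'"
      using hwp_search_step[OF _ N(1,2) F] by simp
  next
    fix r' m' assume "inner_inv l F Z a z (nat ((r(6 := int z, 7 := int z)) 1)) r' m'"
    then have I: "inner_inv l F Z a z k r' m'" using inv k by (simp add: outer_inv_def)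
    have rep: "represents (r'(8 := l)) m' (branch F z k)"
      using I by (simp add: represents_def inner_inv_def outer_inv_def flip: k)
    have r5: "holds (XR 5) (r'(8 := l)) m' \<longleftrightarrow> a > 0" using I by (simp add: holds_def inner_inv_def outer_inv_def)
    have l: "xev (XR 1) r' m' = l" using I by (simp add: inner_inv_def outer_inv_def)
    have "hwp N (HSet 5 (XIf (xor (XR 5) e_solved) (XC 1) (XC 0))) ?Q (r'(8 := l)) m'"
      unfolding hwp_HSet xev_XIf_holds holds_simps r5 holds_solved[OF rep]
      using I N(4) by (simp add: inner_inv_def outer_inv_def)
    then show "?rest r' m'" unfolding hwp_HSet[of N 8] l using N(3) by simp
  qed
  then show "hwp N (HSet 7 (XR 6)) (hwp N (HFor 8 1 search_step) ?rest) (r(6 := int z)) m"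
    unfolding hwp_HSet[of N 7] using N(2) by simp
qed

lemma hwp_search_all:
  assumes inv: "outer_inv l F Z a r m" and N: "n \<le> N" "Z \<le> N" "l \<le> int N" "1 \<le> N" and F: "F > 0"
    and k: "k = nat l"
  shows "hwp N search_all (\<lambda>r m. r 0 = (if l \<ge> 0 \<and> (\<exists>z<Z. solved (branch F z k)) then 1 else 0)) r m"
proof -
  let ?Q = "\<lambda>r (m :: int \<Rightarrow> int). r (0::nat) = (if l \<ge> 0 \<and> (\<exists>z<Z. solved (branch F z k)) then 1 else (0::int))"
  let ?I = "\<lambda>j. outer_inv l F Z (if \<exists>z<j. solved (branch F z k) then 1 else 0)"
  let ?final = "hwp N (HSet 0 (XIf (XAdd (XR 1) (XC 1)) (XR 5) (XC 0))) ?Q"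
  have "hwp N (HFor 6 4 search_branch) ?final (r(5 := 0)) m"
  proof (rule hwp_HFor[where I = ?I])
    show "?I 0 (r(5 := 0)) m" using inv by (simp add: outer_inv_def)
  next
    fix j r' m' assume j: "j < nat ((r(5 := 0)) 4)" and I: "?I j r' m'"
    then have "j \<le> N" using inv N(2) by (simp add: outer_inv_def)
    from hwp_search_branch[OF I N(1) this N(3,4) F k]
    show "hwp N search_branch (?I (Suc j)) (r'(6 := int j)) m'"
      by (rule hwp_mono) (auto simp: less_Suc_eq split: if_splits)
  next
    fix r' m' assume "?I (nat ((r(5 := 0)) 4)) r' m'"
    then have I: "?I Z r' m'" using inv by (simp add: outer_inv_def)
    then show "?final r' m'" unfolding hwp_HSet using N(4) by (simp add: outer_inv_def)
  qed
  then show ?thesis unfolding search_all_def hwp_HSeq hwp_HSet[of N 5] using N(4) by simp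
qed

end

text \<open>Endpoints are at most \<open>n\<close> and all other values assigned are at most
  \<open>Z\<close>, so \<open>n + Z\<close> bounds every loop.\<close>

lemma hwp_decide:
  assumes "finite_graph {..<n} E" "finite_graph {..<n} H" "biclique_free d {..<n} E"
    and N: "n + par_Z (nat l) d \<le> N"
  shows "hwp N (decide d) (\<lambda>r m. r 0 = (if dilation_augmentation 2 {..<n} E H l then 1 else 0))
    ((\<lambda>_. 0)(0 := int n, 1 := l)) (input_memory n E H)"
proof -
  let ?k = "nat l"
  let ?g = "par_g ?k d" and ?F = "par_F ?k d" and ?Z = "par_Z ?k d"
  let ?r = "(\<lambda>_::nat. 0::int)(0 := int n, 1 := l, 16 := int d)"
  interpret graphs n ?k ?g E H d
    by unfold_locales (use assms in \<open>auto simp: finite_graph_def\<close>)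
  note par = parameter_bounds[where k = ?k and d = d, folded par_g_def, folded par_F_def]
  note le = par_le[where k = ?k and d = d]
  have N': "d \<le> N" "n \<le> N" "?Z \<le> N" "l \<le> int N" "1 \<le> N" using N le by linarith+
  have correct: "l \<ge> 0 \<and> (\<exists>z<?Z. solved (branch ?F z ?k)) \<longleftrightarrow> dilation_augmentation 2 {..<n} E H l"
  proof (cases "l \<ge> 0")
    case True
    have "(\<exists>z<?Z. solved (branch ?F z ?k)) \<longleftrightarrow> (\<exists>S. finite S \<and> card S \<le> ?k \<and> spanner2 (E \<union> S) H)"
      unfolding par_Z_def by (rule search_correct) (rule par)+
    also have "\<dots> \<longleftrightarrow> (\<exists>S. finite S \<and> int (card S) \<le> l \<and> spanner2 (E \<union> S) H)"
      using True by (simp add: le_nat_iff)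
    also have "\<dots> \<longleftrightarrow> dilation_augmentation 2 {..<n} E H l"
      by (rule dilation_augmentation_2_iff[symmetric]) fact+
    finally show ?thesis using True by simp
  next
    \<comment> \<open>No set has negative size, and the program refuses as well.\<close>
    case False
    then have "\<not> int (card S) \<le> l" for S :: "nat set set" by simp
    then show ?thesis using False unfolding dilation_augmentation_def by blast
  qed
  have "hwp N parameters (hwp N search_all (\<lambda>r m. r 0 = (if dilation_augmentation 2 {..<n} E H l then 1 else 0)))
      ?r (input_memory n E H)"
  proof (rule hwp_parameters[where d = d])
    show "?r 16 = int d" by simp
    show "par_Z (nat (?r 1)) d \<le> N" using N' by simp
    fix r' assume r': "\<And>x. x \<notin> {2, 3, 4, 12, 14, 15, 17} \<Longrightarrow> r' x = ?r x" "r' 2 = int (par_g (nat (?r 1)) d)"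
      "r' 3 = int (par_F (nat (?r 1)) d)" "r' 4 = int (par_Z (nat (?r 1)) d)"
    have "outer_inv l ?F ?Z 0 r' (input_memory n E H)"
      using r'(1)[of 0] r'(1)[of 1] r'(1)[of 5] r'(2-4) stores_graphs_input
      by (simp add: outer_inv_def)
    from hwp_search_all[OF this N'(2-5) par(5) refl]
    show "hwp N search_all (\<lambda>r m. r 0 = (if dilation_augmentation 2 {..<n} E H l then 1 else 0)) r' (input_memory n E H)"
      unfolding correct .
  qed
  then show ?thesis
    unfolding decide_def hwp_HSeq_eq hwp_HSet using N'(1) by simp
qed

text \<open>\<open>k\<close> and \<open>d\<close> arrive in registers 0 and 1, while
  \<open>parameters\<close> expects them in 1 and 16; hence the two moves.\<close>

definition time_factor :: "nat \<Rightarrow> nat \<Rightarrow> hcom" where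
  "time_factor C c =
     HSeq (HSet 16 (XR 1)) (HSeq (HSet 1 (XR 0)) (HSeq parameters
       (HSeq (HSet 15 (XC (2 ^ c))) (HSeq (HSet 0 (XC (int C))) (multiply 0 4 15)))))"

lemma hwp_time_factor:
  assumes N: "C * (2 ^ c) ^ par_Z (nat l) d \<le> N" "par_Z (nat l) d \<le> N" "2 ^ c \<le> N" "C \<le> N"
  shows "hwp N (time_factor C c) (\<lambda>r m. r 0 = int (C * (2 ^ c) ^ par_Z (nat l) d))
    ((\<lambda>_. 0)(0 := l, 1 := int d)) m"
proof -
  let ?Q = "\<lambda>r (m :: int \<Rightarrow> int). r (0::nat) = int (C * (2 ^ c) ^ par_Z (nat l) d)"
  let ?r = "(\<lambda>_::nat. 0::int)(0 := l, 1 := l, 16 := int d)"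
  let ?rest = "hwp N (HSet 15 (XC (2 ^ c))) (hwp N (HSet 0 (XC (int C))) (hwp N (multiply 0 4 15) ?Q))"
  note le = par_le[where k = "nat l" and d = d]
  have N': "d \<le> N" "l \<le> int N" using N le by linarith+
  have c: "(2::int) ^ c \<le> int N" using N(3) by (metis of_nat_le_iff of_nat_numeral of_nat_power)
  have "hwp N parameters ?rest ?r m"
  proof (rule hwp_parameters[where d = d])
    show "?r 16 = int d" by simp
    show "par_Z (nat (?r 1)) d \<le> N" using N by simp
    fix r' assume r': "\<And>x. x \<notin> {2, 3, 4, 12, 14, 15, 17} \<Longrightarrow> r' x = ?r x" "r' 2 = int (par_g (nat (?r 1)) d)"
      "r' 3 = int (par_F (nat (?r 1)) d)" "r' 4 = int (par_Z (nat (?r 1)) d)"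
    have r4: "nat (((r'(15 := 2 ^ c))(0 := int C)) 4) = par_Z (nat l) d" using r'(4) by simp
    have "hwp N (multiply 0 4 15) ?Q (r'(15 := 2 ^ c, 0 := int C)) m"
      by (rule hwp_multiply[where a = C and b = "2 ^ c"]) (use N r4 in simp_all)
    then show "?rest r' m" unfolding hwp_HSet using c N(4) by simp
  qed
  moreover have "((\<lambda>_::nat. 0::int)(0 := l, 1 := int d))(16 := int d, 1 := l) = ?r" by auto
  ultimately show ?thesis
    unfolding time_factor_def hwp_HSeq_eq hwp_HSet using N' by simp
qed

lemma hbelow_pow2_to [simp]: "x < b \<Longrightarrow> y < b \<Longrightarrow> 12 < b \<Longrightarrow> hbelow b (pow2_to y x)"
  by (simp add: pow2_to_def)

lemma hbelow_multiply [simp]: "x < b \<Longrightarrow> y < b \<Longrightarrow> z < b \<Longrightarrow> 20 < b \<Longrightarrow> hbelow b (multiply x y z)"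
  by (simp add: multiply_def)

lemma hbelow_parameters: "hbelow 30 parameters"
  by (simp add: parameters_def)

lemma hbelow_decide: "hbelow 30 (decide d)"
  using hbelow_parameters
  by (simp add: decide_def search_all_def search_branch_def search_step_def e_quotient_def)

lemma hbelow_time_factor: "hbelow 30 (time_factor C c)"
  using hbelow_parameters by (simp add: time_factor_def)

lemma computable_time_factor: "computable (\<lambda>l d. C * (2 ^ c) ^ par_Z (nat l) d)"
  unfolding computable_def
proof (intro exI[of _ "hcomp (time_factor C c) 30"] allI)
  fix l d
  \<comment> \<open>Any bound on the values assigned will do, as computability asks only for
    termination.\<close>
  define N where "N = C * (2 ^ c) ^ par_Z (nat l) d + par_Z (nat l) d + 2 ^ c + C"
  note le = par_le[where k = "nat l" and d = d]
  have N: "1 \<le> N" "d \<le> N" "l \<le> int N" unfolding N_def using le by linarith+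
  have "\<exists>T s'. exec (hcomp (time_factor C c) 30) ((\<lambda>_. 0)(0 := l, 1 := int d), \<lambda>_. 0) T s' \<and>
      T \<le> hcoef (time_factor C c) * N ^ hdeg (time_factor C c) \<and>
      fst s' 0 = int (C * (2 ^ c) ^ par_Z (nat l) d)"
  proof (rule exec_hcomp[OF hwp_time_factor hbelow_time_factor])
    show "((\<lambda>_. 0)(0 := l, 1 := int d)) z \<le> int N" for z :: nat using N by simp
  qed (use N in \<open>simp_all add: N_def\<close>)
  then show "\<exists>T s. exec (hcomp (time_factor C c) 30) ((\<lambda>_. 0)(0 := l, 1 := int d), \<lambda>_. 0) T s \<and>
      fst s 0 = int (C * (2 ^ c) ^ par_Z (nat l) d)" by blast
qed

theorem theorem17:
  "\<exists>c::nat. \<forall>d::nat. \<exists>f :: int \<Rightarrow> nat \<Rightarrow> nat. computable f \<and>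
     (\<exists>P. decides_within P
        (\<lambda>n E H k. dilation_augmentation 2 {..<n} E H k)
        (\<lambda>n E H k. biclique_free d {..<n} E)
        (\<lambda>n k. f k d * (max 1 n) ^ c))"
proof -
  define c where "c = hdeg (decide 0)"
  define C where "C = hcoef (decide 0)"
  have cost: "hdeg (decide d) = c" "hcoef (decide d) = C" for d
    by (simp_all add: c_def C_def decide_def)
  \<comment> \<open>\<open>(2 ^ c) ^ Z\<close> is the \<open>c\<close>-th power of the factor
    \<open>2 ^ Z\<close> that separates \<open>Z\<close> from \<open>n\<close> in
    \<open>n + Z\<close>.\<close>
  define f where "f = (\<lambda>l d. C * (2 ^ c) ^ par_Z (nat l) d)"
  have "decides_within (hcomp (decide d) 30)
        (\<lambda>n E H k. dilation_augmentation 2 {..<n} E H k)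
        (\<lambda>n E H k. biclique_free d {..<n} E)
        (\<lambda>n k. f k d * (max 1 n) ^ c)" for d
    unfolding decides_within_def
  proof (intro allI impI)
    fix n :: nat and E H l assume inst: "finite_graph {..<n} E \<and> finite_graph {..<n} H \<and> biclique_free d {..<n} E"
    define Z where "Z = par_Z (nat l) d"
    define N where "N = n + Z"
    note le = par_le[where k = "nat l" and d = d, folded Z_def]
    have N: "1 \<le> N" "l \<le> int N" unfolding N_def using le by linarith+
    have "\<exists>T s'. exec (hcomp (decide d) 30) ((\<lambda>_. 0)(0 := int n, 1 := l), input_memory n E H) T s' \<and>
        T \<le> hcoef (decide d) * N ^ hdeg (decide d) \<and>
        fst s' 0 = (if dilation_augmentation 2 {..<n} E H l then 1 else 0)"
    proof (rule exec_hcomp[OF hwp_decide hbelow_decide])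
      show "((\<lambda>_. 0)(0 := int n, 1 := l)) z \<le> int N" for z :: nat using N by (simp add: N_def)
    qed (use inst N in \<open>simp_all add: N_def Z_def\<close>)
    then obtain T s where T: "exec (hcomp (decide d) 30) (input_state n E H l) T s" "T \<le> C * N ^ c"
        "fst s 0 = (if dilation_augmentation 2 {..<n} E H l then 1 else 0)"
      unfolding cost input_state_def by blast
    \<comment> \<open>Without vertices the sum is \<open>Z\<close> alone, hence
      \<open>max 1 n\<close>.\<close>
    have "N \<le> 2 ^ Z * max 1 n"
    proof -
      have "N \<le> (Z + 1) * max 1 n" unfolding N_def by (cases n) auto
      also have "\<dots> \<le> 2 ^ Z * max 1 n" using less_exp[of Z] by (intro mult_le_mono1) linarith
      finally show ?thesis .
    qed
    then have "N ^ c \<le> (2 ^ Z * max 1 n) ^ c" by (rule power_mono) simp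
    also have "\<dots> = (2 ^ c) ^ Z * max 1 n ^ c" by (simp add: power_mult_distrib mult.commute flip: power_mult)
    finally have "C * N ^ c \<le> f l d * max 1 n ^ c" unfolding f_def Z_def by (simp add: mult.assoc)
    then show "\<exists>T s. exec (hcomp (decide d) 30) (input_state n E H l) T s \<and> T \<le> f l d * max 1 n ^ c \<and>
        fst s 0 = (if dilation_augmentation 2 {..<n} E H l then 1 else 0)"
      using T by (meson le_trans)
  qed
  moreover have "computable f" unfolding f_def by (rule computable_time_factor)
  ultimately show ?thesis by blast
qed

end
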